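(* Let $S$ be a finite set of prime numbers. Then for every positive real number $\varepsilon$ there exists an effectively computable positive integer $n_0$, depending only on $S$ and $\varepsilon$, such that every integral $S$-unit $n$ greater than $n_0$ has more than $$(1-\varepsilon)\frac{\log\log n}{\log\log\log n}$$ digits in its Zeckendorf representation.
   Context: A rational integer is an integral $S$-unit if all its prime factors belong to $S$. The Fibonacci sequence $(F_n)_{n\ge 0}$ is defined by $F_0=0$, $F_1=1$, $F_{n+2}=F_{n+1}+F_n$. Every positive integer $N$ has a unique Zeckendorf representation $N=\varepsilon_\ell F_\ell+\cdots+\varepsilon_1F_1$ with $\varepsilon_\ell=1$, $\varepsilon_j\in\{0,1\}$ and $\varepsilon_j\varepsilon_{j+1}=0$ for $j=1,\dots,\ell-1$; the number of digits of $N$ in its Zeckendorf representation is the number of $j$ with $\varepsilon_j=1$. *)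

theory Defs
  imports
    Complex_Main
    "HOL-Computational_Algebra.Primes"
    "HOL-Number_Theory.Fib"
    "HOL-Library.Nat_Bijection"
begin

definition integral_S_unit :: "nat set \<Rightarrow> int \<Rightarrow> bool" where
  "integral_S_unit S n \<longleftrightarrow> n \<noteq> 0 \<and> (\<forall>p::nat. prime p \<and> int p dvd n \<longrightarrow> p \<in> S)"

section \<open>Zeckendorf representations\<close>

text \<open>
  A digit sequence is given by its support, the set \<open>D\<close> of all \<open>j\<close> whose digit is \<open>1\<close>.
  Since \<open>fib 1 = fib 2\<close>, representations are unique only if the digit with index \<open>1\<close>
  is not used; hence the usual convention that all indices are at least \<open>2\<close>.
\<close>

definition is_zeckendorf :: "nat \<Rightarrow> nat set \<Rightarrow> bool" where
  "is_zeckendorf N D \<longleftrightarrow>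
     finite D \<and> (\<forall>j\<in>D. 2 \<le> j) \<and> (\<forall>j\<in>D. Suc j \<notin> D) \<and> N = (\<Sum>j\<in>D. fib j)"

definition zeckendorf_digits :: "nat \<Rightarrow> nat" where
  "zeckendorf_digits N = card (THE D. is_zeckendorf N D)"

lemma zeckendorf_sum_less:
  assumes "is_zeckendorf N D" "\<forall>j\<in>D. j < m" "1 \<le> m"
  shows "N < fib m"
  using assms
proof (induction m arbitrary: N D rule: less_induct)
  case (less m)
  note Z = less.prems(1)[unfolded is_zeckendorf_def]
  show ?case
  proof (cases "m \<le> 2")
    case True
    with less.prems(2) Z have "D = {}" by fastforce
    with Z have "N = 0" by simp
    with less.prems(3) show ?thesis by (simp add: fib_neq_0_nat)
  next
    case False
    then obtain k where k: "m = Suc (Suc k)" "1 \<le> k"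
      by (intro that[of "m - 2"]) auto
    show ?thesis
    proof (cases "Suc k \<in> D")
      case True
      have lt: "\<forall>j\<in>D - {Suc k}. j < k"
      proof
        fix j assume j: "j \<in> D - {Suc k}"
        then have "j < Suc (Suc k)" "j \<noteq> Suc k" using less.prems(2) k by auto
        moreover have "j \<noteq> k" using j True Z by auto
        ultimately show "j < k" by linarith
      qed
      have N: "N = fib (Suc k) + (\<Sum>j\<in>D - {Suc k}. fib j)"
        using Z True sum.remove[of D "Suc k" fib] by simp
      have "is_zeckendorf (\<Sum>j\<in>D - {Suc k}. fib j) (D - {Suc k})"
        using Z by (auto simp: is_zeckendorf_def)
      from less.IH[OF _ this lt \<open>1 \<le> k\<close>] k N show ?thesis by simp
    next
      case False
      have "\<forall>j\<in>D. j < Suc k"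
        using less.prems(2) k False by (metis less_SucE)
      then have "N < fib (Suc k)"
        using less.IH[of "Suc k" N D] less.prems(1) k by simp
      also have "fib (Suc k) \<le> fib m" using k by (simp add: fib_mono)
      finally show ?thesis .
    qed
  qed
qed

lemma fib_ge_self: "n \<le> fib n + 1"
proof (induction n rule: fib.induct)
  case (3 n)
  show ?case
  proof (cases "n = 0")
    case False
    then have "0 < fib n" by (simp add: fib_neq_0_nat)
    then show ?thesis using 3 by simp
  qed simp
qed auto

lemma zeckendorf_exists: "\<exists>D. is_zeckendorf N D"
proof (induction N rule: less_induct)
  case (less N)
  show ?case
  proof (cases "N = 0")
    case True
    then show ?thesis by (intro exI[of _ "{}"]) (simp add: is_zeckendorf_def)
  next
    case False
    let ?P = "\<lambda>k. 2 \<le> k \<and> fib k \<le> N"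
    have b: "\<forall>k. ?P k \<longrightarrow> k \<le> N + 1"
      using fib_ge_self by (meson add_le_mono1 le_trans)
    have "?P 2" using False by simp
    then have "\<exists>k. ?P k \<and> (\<forall>j. ?P j \<longrightarrow> j \<le> k)"
      using b Greatest_le_nat[of ?P _ "N + 1"] GreatestI_nat[of ?P 2 "N + 1"] by blast
    then obtain k where k: "2 \<le> k" "fib k \<le> N" "\<forall>j. ?P j \<longrightarrow> j \<le> k" by blast
    then have up: "N < fib (Suc k)"
      by (metis Suc_n_not_le_n le_SucI not_le)
    obtain i where i: "k = Suc i" "1 \<le> i"
      using k(1) by (cases k) auto
    have "0 < fib k" using k(1) by (simp add: fib_neq_0_nat)
    then obtain D where D: "is_zeckendorf (N - fib k) D"
      using less.IH[of "N - fib k"] False by auto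
    have lt: "j < i" if "j \<in> D" for j
    proof (rule ccontr)
      assume "\<not> j < i"
      then have "fib i \<le> fib j" by (simp add: fib_mono)
      also have "fib j \<le> N - fib k"
        using D that member_le_sum[of j D fib] by (simp add: is_zeckendorf_def)
      finally show False using up i k(2) by simp
    qed
    then have "k \<notin> D" "\<forall>j\<in>D. Suc j \<noteq> k" "Suc k \<notin> D" using i by fastforce+
    then have "is_zeckendorf N (insert k D)"
      using D k(1,2) by (auto simp: is_zeckendorf_def)
    then show ?thesis ..
  qed
qed

lemma zeckendorf_Max:
  assumes "is_zeckendorf N D" "D \<noteq> {}"
  shows "fib (Max D) \<le> N" "N < fib (Suc (Max D))" "Max D \<in> D"
proof -
  from assms have fin: "finite D" and N: "N = (\<Sum>j\<in>D. fib j)"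
    by (auto simp: is_zeckendorf_def)
  show mem: "Max D \<in> D" using fin assms(2) by simp
  show "fib (Max D) \<le> N" using N fin mem member_le_sum[of "Max D" D fib] by simp
  have "\<forall>j\<in>D. j < Suc (Max D)" using fin by (simp add: less_Suc_eq_le)
  then show "N < fib (Suc (Max D))" using zeckendorf_sum_less[OF assms(1)] by simp
qed

lemma zeckendorf_empty_iff:
  assumes "is_zeckendorf N D"
  shows "D = {} \<longleftrightarrow> N = 0"
proof
  assume "N = 0"
  show "D = {}"
  proof (rule ccontr)
    assume ne: "D \<noteq> {}"
    note M = zeckendorf_Max[OF assms ne]
    have "0 < Max D" using M(3) assms by (fastforce simp: is_zeckendorf_def)
    then have "0 < fib (Max D)" by (rule fib_neq_0_nat)
    then show False using M(1) \<open>N = 0\<close> by simp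
  qed
qed (use assms in \<open>simp add: is_zeckendorf_def\<close>)

lemma zeckendorf_unique:
  assumes "is_zeckendorf N D" "is_zeckendorf N E"
  shows "D = E"
  using assms
proof (induction N arbitrary: D E rule: less_induct)
  case (less N)
  show ?case
  proof (cases "N = 0")
    case True
    then show ?thesis using less.prems zeckendorf_empty_iff by metis
  next
    case False
    then have ne: "D \<noteq> {}" "E \<noteq> {}" using less.prems zeckendorf_empty_iff by auto
    note MD = zeckendorf_Max[OF less.prems(1) ne(1)]
    note ME = zeckendorf_Max[OF less.prems(2) ne(2)]
    have le: "b \<le> a" if "fib b \<le> N" "N < fib (Suc a)" for a b
      using fib_mono[of "Suc a" b] that by linarith
    have eq: "Max D = Max E"
      using le[OF MD(1) ME(2)] le[OF ME(1) MD(2)] by (rule le_antisym)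
    have rm: "is_zeckendorf (N - fib k) (A - {k})" if "is_zeckendorf N A" "k \<in> A" for A k
      using that sum.remove[of A k fib] by (auto simp: is_zeckendorf_def)
    have "0 < Max D" using MD(3) less.prems(1) by (fastforce simp: is_zeckendorf_def)
    then have "N - fib (Max D) < N" using fib_neq_0_nat[of "Max D"] False by simp
    moreover have "is_zeckendorf (N - fib (Max D)) (E - {Max D})"
      using rm[OF less.prems(2) ME(3)] unfolding eq .
    ultimately have "D - {Max D} = E - {Max D}"
      using less.IH rm[OF less.prems(1) MD(3)] by blast
    moreover have "Max D \<in> E" using ME(3) unfolding eq .
    ultimately show ?thesis using MD(3) by blast
  qed
qed

lemma zeckendorf_ex1: "\<exists>!D. is_zeckendorf N D"
  using zeckendorf_exists zeckendorf_unique by blast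

lemma zeckendorf_digits_eq: "is_zeckendorf N D \<Longrightarrow> zeckendorf_digits N = card D"
  unfolding zeckendorf_digits_def by (metis the_equality zeckendorf_unique)

section \<open>Effective computability\<close>

text \<open>
  \<open>total_recursive n f\<close>: on argument lists of length \<open>n\<close>, the function \<open>f\<close> is a total
  \<open>n\<close>-ary recursive function in the sense of Kleene, minimisation being applied only where a
  zero always exists.  Values on lists of any other length carry no meaning.

  A threshold that is effectively computable from a finite set \<open>S\<close> of naturals and a real
  \<open>\<epsilon> > 0\<close> is rendered as a recursive function of \<open>[set_encode S, a, b]\<close>, which must be correct
  for every positive rational \<open>a / b \<le> \<epsilon>\<close>: a real number is not itself finite data.
\<close>

inductive total_recursive :: "nat \<Rightarrow> (nat list \<Rightarrow> nat) \<Rightarrow> bool" where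
  zero: "total_recursive n (\<lambda>xs. 0)"
| succ: "total_recursive 1 (\<lambda>xs. Suc (xs ! 0))"
| proj: "i < n \<Longrightarrow> total_recursive n (\<lambda>xs. xs ! i)"
| comp: "total_recursive (length gs) f \<Longrightarrow> \<forall>g\<in>set gs. total_recursive n g \<Longrightarrow>
    total_recursive n (\<lambda>xs. f (map (\<lambda>g. g xs) gs))"
| prim_rec: "total_recursive n f \<Longrightarrow> total_recursive (Suc (Suc n)) g \<Longrightarrow>
    total_recursive (Suc n)
      (\<lambda>xs. rec_nat (f (tl xs)) (\<lambda>k r. g (k # r # tl xs)) (hd xs))"
| minimise: "total_recursive (Suc n) f \<Longrightarrow>
    \<forall>xs. length xs = n \<longrightarrow> (\<exists>k. f (k # xs) = 0) \<Longrightarrow>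
    total_recursive n (\<lambda>xs. LEAST k. f (k # xs) = 0)"

end

theory Submission
  imports Defs "HOL-Complex_Analysis.Complex_Analysis"
begin

text \<open>
  Let \<open>l\<^sub>1 > \<dots> > l\<^sub>k\<close> be the Zeckendorf indices of the S-unit \<open>n\<close>.  Up to a relative error of about
  \<open>golden\<close> to the power \<open>l\<^sub>j\<^sub>+\<^sub>1 - l\<^sub>1\<close>, the number \<open>sqrt 5 * n\<close> is the product of a power of
  \<open>golden\<close> and of the sum \<open>\<alpha>\<^sub>j\<close> of the numbers \<open>golden ^ (l\<^sub>i - l\<^sub>j)\<close>, \<open>i \<le> j\<close>.  This makes a linear form in
  the logarithms of the primes in \<open>S\<close>, of \<open>sqrt 5\<close>, of \<open>golden\<close> and of \<open>\<alpha>\<^sub>j\<close> small.  A lower bound for such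
  forms that is linear in the height of \<open>\<alpha>\<^sub>j\<close>, hence in \<open>l\<^sub>1 - l\<^sub>j\<close>, and almost linear in \<open>ln l\<^sub>1\<close>
  shows that \<open>l\<^sub>1 - l\<^sub>j\<^sub>+\<^sub>1\<close> exceeds \<open>l\<^sub>1 - l\<^sub>j\<close> at most by a factor \<open>(ln l\<^sub>1) powr (1 + o(1))\<close>; so \<open>l\<^sub>1\<close> is at
  most the \<open>k\<close>-th power of this factor.

  The lower bound is proved by the method of Baker and Feldman.  Siegel's lemma provides an
  exponential polynomial that vanishes to high order at the odd integers.  Extrapolation,
  Liouville's inequality and the linear independence of square roots show that the part of it with
  exponents in a fixed residue class modulo 2 vanishes at the halves of the odd integers, and so on
  modulo higher powers of 2.  In the end the exponent of \<open>\<alpha>\<^sub>j\<close> is constant on the residue class,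
  and too many zeros are left.  Ordinary powers of \<open>z\<close>, used instead of Feldman's polynomials, cost
  only powers of \<open>ln (ln l\<^sub>1)\<close>.  If \<open>\<alpha>\<^sub>j\<close> is dependent on the other numbers modulo squares, one
  extracts square roots; as this halves heights, it either ends soon or produces the same root
  twice, and then \<open>\<alpha>\<^sub>j\<close> can be eliminated from the linear form.
\<close>

section \<open>The ring of integers of the golden field\<close>

text \<open>Square roots are the only irrationalities adjoined to Q(sqrt 5): all numbers stay real,
  every extension has degree a power of 2, and the conjugation behind Liouville's inequality is one
  change of sign in explicit coordinates. This is why the points are halved rather than divided by a
  larger prime. The obstacle is that \<alpha> varies with the truncation and has unbounded height,
  while all other numbers are fixed. Its exponent is therefore allowed a range \<open>c\<close> that
  does not depend on this height, and the other exponents a range larger by the factor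
  \<open>M\<close>, the logarithmic height; the total cost is then linear in \<open>M\<close>, and
  \<open>J\<close> halvings with \<open>c < 2 ^ J\<close> are enough to freeze the exponent of
  \<alpha>. Here \<open>J\<close> is of the order of \<open>ln h\<close> and \<open>h\<close> about
  8 times the logarithm of the leading index, so every power of \<open>J\<close> is negligible
  against \<open>h\<close>; it is the first power of \<open>h\<close> that yields the constant 1 in
  the digit bound. All parameters are explicit natural numbers, and the threshold is built from
  sums, products and powers of 2.\<close>

definition golden :: real where
  "golden = (1 + sqrt 5) / 2"

lemma golden_square: "golden * golden = golden + 1"
  by (simp add: golden_def field_simps)

lemma golden_bounds: "3 / 2 < golden" "golden < 2"
proof -
  have "2 < sqrt 5" by (rule real_less_rsqrt) simp
  then show "3 / 2 < golden" by (simp add: golden_def)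
  have "sqrt 5 < 3" by (rule real_less_lsqrt) simp_all
  then show "golden < 2" by (simp add: golden_def)
qed

lemma sqrt5_irrational: "sqrt 5 \<notin> \<rat>"
proof
  assume "sqrt 5 \<in> \<rat>"
  then obtain m n :: nat where mn: "n \<noteq> 0" "\<bar>sqrt 5\<bar> = real m / real n" "coprime m n"
    by (rule Rats_abs_nat_div_natE)
  then have "(real m)\<^sup>2 = 5 * (real n)\<^sup>2"
    by (metis abs_of_nonneg eq_divide_eq of_nat_eq_0_iff power_mult_distrib real_sqrt_ge_zero
        real_sqrt_pow2 zero_le_numeral)
  then have e: "m\<^sup>2 = 5 * n\<^sup>2"
    by (metis (mono_tags) of_nat_eq_iff of_nat_mult of_nat_numeral of_nat_power)
  have p5: "prime (5::nat)" by simp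
  have "5 dvd m\<^sup>2" using e by simp
  then have "5 dvd m" using p5 prime_dvd_power by blast
  then obtain k where k: "m = 5 * k" ..
  then have "n\<^sup>2 = 5 * k\<^sup>2" using e by (simp add: power2_eq_square)
  then have "5 dvd n\<^sup>2" by simp
  then have "5 dvd n" using p5 prime_dvd_power by blast
  with \<open>5 dvd m\<close> mn(3) show False
    by (metis coprime_common_divisor_nat p5 not_prime_1)
qed

lemma rat_sqrt5_eq_0:
  assumes "x \<in> \<rat>" "y \<in> \<rat>" "x + y * sqrt 5 = 0"
  shows "x = 0 \<and> y = 0"
proof (cases "y = 0")
  case False
  then have "sqrt 5 = - x / y" using assms(3) by (simp add: field_simps)
  then have "sqrt 5 \<in> \<rat>" using assms by simp
  then show ?thesis using sqrt5_irrational by simp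
qed (use assms in simp)

text \<open>The bound refers to the coefficients of \<open>x\<close> in the basis \<open>1, golden\<close>; the weight \<open>2\<close>
  makes it submultiplicative.\<close>

definition zgold :: "real \<Rightarrow> real \<Rightarrow> bool" where
  "zgold H x \<longleftrightarrow>
     (\<exists>u v :: int. x = of_int u + of_int v * golden \<and> \<bar>of_int u\<bar> + 2 * \<bar>of_int v\<bar> \<le> H)"

lemma zgoldI:
  "x = of_int u + of_int v * golden \<Longrightarrow> \<bar>of_int u\<bar> + 2 * \<bar>of_int v\<bar> \<le> H \<Longrightarrow> zgold H x"
  unfolding zgold_def by blast

lemma zgold_mono: "zgold H x \<Longrightarrow> H \<le> H' \<Longrightarrow> zgold H' x"
  unfolding zgold_def by force

lemma zgold_nonneg: "zgold H x \<Longrightarrow> 0 \<le> H"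
  unfolding zgold_def by (smt (verit))

lemma zgold_of_int: "\<bar>of_int n\<bar> \<le> H \<Longrightarrow> zgold H (of_int n)"
  by (rule zgoldI[of _ n 0]) simp_all

lemma zgold_golden: "zgold 2 golden"
  by (rule zgoldI[of _ 0 1]) simp_all

lemma zgold_0: "0 \<le> H \<Longrightarrow> zgold H 0"
  using zgold_of_int[of 0 H] by simp

lemma zgold_1: "1 \<le> H \<Longrightarrow> zgold H 1"
  using zgold_of_int[of 1 H] by simp

lemma zgold_add:
  assumes "zgold H x" "zgold H' y"
  shows "zgold (H + H') (x + y)"
proof -
  from assms obtain u v u' v' :: int where *:
    "x = of_int u + of_int v * golden" "\<bar>of_int u\<bar> + 2 * \<bar>of_int v\<bar> \<le> H"
    "y = of_int u' + of_int v' * golden" "\<bar>of_int u'\<bar> + 2 * \<bar>of_int v'\<bar> \<le> H'"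
    unfolding zgold_def by blast
  have "\<bar>real_of_int (u + u')\<bar> + 2 * \<bar>real_of_int (v + v')\<bar> \<le> H + H'"
    using * abs_triangle_ineq[of "real_of_int u" "real_of_int u'"]
      abs_triangle_ineq[of "real_of_int v" "real_of_int v'"] unfolding of_int_add by linarith
  then show ?thesis by (rule zgoldI[rotated]) (simp add: * algebra_simps)
qed

lemma zgold_minus: "zgold H x \<Longrightarrow> zgold H (- x)"
proof -
  assume "zgold H x"
  then obtain u v :: int where
    "x = of_int u + of_int v * golden" "\<bar>of_int u\<bar> + 2 * \<bar>of_int v\<bar> \<le> H"
    unfolding zgold_def by blast
  then show ?thesis by (intro zgoldI[of _ "- u" "- v"]) simp_all
qed

lemma zgold_mult:
  assumes "zgold H x" "zgold H' y"
  shows "zgold (H * H') (x * y)"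
proof -
  from assms obtain u v u' v' :: int where *:
    "x = of_int u + of_int v * golden" "\<bar>of_int u\<bar> + 2 * \<bar>of_int v\<bar> \<le> H"
    "y = of_int u' + of_int v' * golden" "\<bar>of_int u'\<bar> + 2 * \<bar>of_int v'\<bar> \<le> H'"
    unfolding zgold_def by blast
  let ?a = "\<bar>real_of_int u\<bar>" and ?b = "\<bar>real_of_int v\<bar>"
    and ?c = "\<bar>real_of_int u'\<bar>" and ?d = "\<bar>real_of_int v'\<bar>"
  have e: "x * y = of_int (u * u' + v * v') + of_int (u * v' + v * u' + v * v') * golden"
  proof -
    have "x * y = of_int u * of_int u' + of_int v * of_int v' * (golden * golden)
        + (of_int u * of_int v' + of_int v * of_int u') * golden"
      unfolding * by (simp add: algebra_simps)
    then show ?thesis unfolding golden_square by (simp add: algebra_simps)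
  qed
  have 1: "\<bar>of_int (u * u' + v * v')\<bar> \<le> ?a * ?c + ?b * ?d"
    by (simp flip: abs_mult add: abs_triangle_ineq)
  have 2: "\<bar>of_int (u * v' + v * u' + v * v')\<bar> \<le> ?a * ?d + ?b * ?c + ?b * ?d"
    using abs_triangle_ineq[of "real_of_int (u * v' + v * u')" "real_of_int (v * v')"]
      abs_triangle_ineq[of "real_of_int (u * v')" "real_of_int (v * u')"]
    by (simp add: abs_mult)
  have "?a * ?c + ?b * ?d + 2 * (?a * ?d + ?b * ?c + ?b * ?d) \<le> (?a + 2 * ?b) * (?c + 2 * ?d)"
    by (simp add: algebra_simps)
  also have "\<dots> \<le> H * H'"
    by (intro mult_mono) (use * in \<open>auto intro: order_trans[OF _ *(2)]\<close>)
  finally have 3: "?a * ?c + ?b * ?d + 2 * (?a * ?d + ?b * ?c + ?b * ?d) \<le> H * H'" .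
  show ?thesis by (rule zgoldI[OF e], rule order_trans[OF _ 3], intro add_mono mult_left_mono 1 2) simp
qed

lemma zgold_power: "zgold H x \<Longrightarrow> zgold (H ^ n) (x ^ n)"
  by (induction n) (auto intro: zgold_1 zgold_mult)

lemma zgold_sum: "(\<And>i. i \<in> A \<Longrightarrow> zgold (H i) (x i)) \<Longrightarrow> zgold (sum H A) (sum x A)"
  by (induction A rule: infinite_finite_induct) (auto intro: zgold_0 zgold_add)

lemma zgold_prod: "(\<And>i. i \<in> A \<Longrightarrow> zgold (H i) (x i)) \<Longrightarrow> zgold (prod H A) (prod x A)"
  by (induction A rule: infinite_finite_induct) (auto intro: zgold_1 zgold_mult)

lemma zgold_abs_le:
  assumes "zgold H x"
  shows "\<bar>x\<bar> \<le> H"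
proof -
  from assms obtain u v :: int where *:
    "x = of_int u + of_int v * golden" "\<bar>of_int u\<bar> + 2 * \<bar>of_int v\<bar> \<le> H"
    unfolding zgold_def by blast
  have "\<bar>x\<bar> \<le> \<bar>of_int u\<bar> + \<bar>of_int v\<bar> * golden"
    using golden_bounds abs_triangle_ineq[of "of_int u" "of_int v * golden"]
    by (simp add: * abs_mult)
  also have "\<dots> \<le> \<bar>of_int u\<bar> + \<bar>of_int v\<bar> * 2"
    using golden_bounds by (intro add_left_mono mult_left_mono) auto
  finally show ?thesis using * by simp
qed

lemma zgold_conj_nonzero:
  fixes u v :: int
  assumes "of_int u + of_int v * (1 - golden) = 0"
  shows "u = 0 \<and> v = 0"
proof -
  have "(of_int u + of_int v / 2) + (- of_int v / 2) * sqrt 5 = 0"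
    using assms by (simp add: golden_def field_simps)
  then show ?thesis using rat_sqrt5_eq_0[of "of_int u + of_int v / 2" "- of_int v / 2"] by auto
qed

text \<open>The product of \<open>x\<close> and its conjugate \<open>y\<close> is a nonzero rational
  integer, and \<open>H\<close> bounds \<open>y\<close> too.\<close>

lemma zgold_lower:
  assumes "zgold H x" "x \<noteq> 0"
  shows "1 \<le> \<bar>x\<bar> * H"
proof -
  from assms obtain u v :: int where *:
    "x = of_int u + of_int v * golden" "\<bar>of_int u\<bar> + 2 * \<bar>of_int v\<bar> \<le> H"
    unfolding zgold_def by blast
  define y where "y = of_int u + of_int v * (1 - golden)"
  have "x * y = (of_int u)\<^sup>2 + of_int u * of_int v + (of_int v)\<^sup>2 * (golden - golden * golden)"
    unfolding * y_def by (simp add: algebra_simps power2_eq_square)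
  then have "x * y = of_int (u\<^sup>2 + u * v - v\<^sup>2)"
    by (simp add: golden_square)
  moreover have "y \<noteq> 0" using zgold_conj_nonzero[of u v] assms(2) * unfolding y_def by auto
  ultimately have "1 \<le> \<bar>x * y\<bar>" using assms(2)
    by (metis mult_eq_0_iff of_int_0_eq_iff of_int_abs of_int_1_le_iff zabs_less_one_iff not_less)
  moreover have "\<bar>y\<bar> \<le> H"
  proof -
    have "\<bar>y\<bar> \<le> \<bar>of_int u\<bar> + \<bar>of_int v\<bar> * \<bar>1 - golden\<bar>"
      unfolding y_def by (metis abs_mult abs_triangle_ineq)
    also have "\<dots> \<le> \<bar>of_int u\<bar> + \<bar>of_int v\<bar> * 2"
      using golden_bounds by (intro add_left_mono mult_left_mono) auto
    finally show ?thesis using * by simp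
  qed
  ultimately show ?thesis
    using mult_left_mono[of "\<bar>y\<bar>" H "\<bar>x\<bar>"] by (simp add: abs_mult)
qed

section \<open>Adjoining square roots\<close>

definition Qsqrt5 :: "real set" where
  "Qsqrt5 = {x + y * sqrt 5 | x y. x \<in> \<rat> \<and> y \<in> \<rat>}"

definition is_subfield :: "real set \<Rightarrow> bool" where
  "is_subfield F \<longleftrightarrow> 1 \<in> F \<and> (\<forall>x\<in>F. \<forall>y\<in>F. x - y \<in> F \<and> x * y \<in> F \<and> inverse x \<in> F)"

lemma is_subfield_closed:
  assumes "is_subfield F"
  shows "1 \<in> F" "0 \<in> F" "x \<in> F \<Longrightarrow> y \<in> F \<Longrightarrow> x - y \<in> F" "x \<in> F \<Longrightarrow> y \<in> F \<Longrightarrow> x + y \<in> F"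
    "x \<in> F \<Longrightarrow> y \<in> F \<Longrightarrow> x * y \<in> F" "x \<in> F \<Longrightarrow> inverse x \<in> F" "x \<in> F \<Longrightarrow> - x \<in> F"
    "x \<in> F \<Longrightarrow> y \<in> F \<Longrightarrow> x / y \<in> F"
proof -
  note F = assms[unfolded is_subfield_def]
  show 1: "1 \<in> F" using F by simp
  then have "1 - 1 \<in> F" using F by blast
  then show 0: "0 \<in> F" by simp
  have m: "- x \<in> F" if "x \<in> F" for x
    using F 0 that by (metis diff_0)
  show "x \<in> F \<Longrightarrow> - x \<in> F" by (rule m)
  show "x \<in> F \<Longrightarrow> y \<in> F \<Longrightarrow> x + y \<in> F" using F m by (metis diff_minus_eq_add)
  show "x \<in> F \<Longrightarrow> y \<in> F \<Longrightarrow> x / y \<in> F" using F by (metis divide_inverse)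
qed (use assms[unfolded is_subfield_def] in auto)

definition adjoin_sqrt :: "real set \<Rightarrow> real \<Rightarrow> real set" where
  "adjoin_sqrt F a = {x + y * sqrt a | x y. x \<in> F \<and> y \<in> F}"

lemma adjoin_sqrt_trivial:
  assumes "is_subfield F" "sqrt a \<in> F"
  shows "adjoin_sqrt F a = F"
proof
  show "adjoin_sqrt F a \<subseteq> F"
    unfolding adjoin_sqrt_def
    using assms is_subfield_closed(4,5)[OF assms(1)] by blast
  show "F \<subseteq> adjoin_sqrt F a"
  proof
    fix x assume "x \<in> F"
    then show "x \<in> adjoin_sqrt F a"
      unfolding adjoin_sqrt_def using is_subfield_closed(2)[OF assms(1)]
      by (intro CollectI exI[of _ x] exI[of _ 0]) simp
  qed
qed

lemma adjoin_sqrt_superset: "is_subfield F \<Longrightarrow> F \<subseteq> adjoin_sqrt F a"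
  unfolding adjoin_sqrt_def using is_subfield_closed(2)[of F] by force

text \<open>When \<open>sqrt a\<close> is new, a nonzero x + y sqrt a has nonzero norm x^2 - a y^2,
  since otherwise \<open>sqrt a\<close> would be x / y; the conjugate divided by the norm is the
  inverse.\<close>

lemma is_subfield_adjoin_sqrt:
  assumes F: "is_subfield F" and a: "a \<in> F" "0 \<le> a"
  shows "is_subfield (adjoin_sqrt F a)"
proof (cases "sqrt a \<in> F")
  case True
  then show ?thesis using F by (simp add: adjoin_sqrt_trivial)
next
  case False
  note c = is_subfield_closed[OF F]
  have I: "x + y * sqrt a \<in> adjoin_sqrt F a" if "x \<in> F" "y \<in> F" for x y
    using that unfolding adjoin_sqrt_def by blast
  have nz: "x * x - y * y * a \<noteq> 0" if "x \<in> F" "y \<in> F" "x + y * sqrt a \<noteq> 0" for x y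
  proof
    assume "x * x - y * y * a = 0"
    then have "(x + y * sqrt a) * (x - y * sqrt a) = 0" using a by (simp add: algebra_simps)
    then have e: "x - y * sqrt a = 0" using that by simp
    show False
    proof (cases "y = 0")
      case False
      then have "sqrt a = x / y" using e by (simp add: field_simps)
      then show False using \<open>sqrt a \<notin> F\<close> c(8) that by simp
    qed (use e that in simp)
  qed
  have inv: "inverse (x + y * sqrt a) \<in> adjoin_sqrt F a" if "x \<in> F" "y \<in> F" for x y
  proof (cases "x + y * sqrt a = 0")
    case True
    then show ?thesis using I[OF c(2) c(2)] by simp
  next
    case nz0: False
    let ?d = "x * x - y * y * a"
    have "inverse (x + y * sqrt a) = x / ?d + (- y / ?d) * sqrt a"
    proof (rule inverse_unique)
      have "x / ?d + (- y / ?d) * sqrt a = (x - y * sqrt a) / ?d"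
        by (simp add: diff_divide_distrib)
      then have "(x + y * sqrt a) * (x / ?d + (- y / ?d) * sqrt a)
          = (x + y * sqrt a) * (x - y * sqrt a) / ?d"
        by simp
      also have "(x + y * sqrt a) * (x - y * sqrt a) = ?d"
        using a by (simp add: algebra_simps)
      finally show "(x + y * sqrt a) * (x / ?d + (- y / ?d) * sqrt a) = 1"
        using nz[OF that nz0] by simp
    qed
    moreover have "?d \<in> F" using that a by (intro c)
    ultimately show ?thesis using I[of "x / ?d" "- y / ?d"] c that by simp
  qed
  have mul: "(x + y * sqrt a) * (x' + y' * sqrt a) \<in> adjoin_sqrt F a"
    if "x \<in> F" "y \<in> F" "x' \<in> F" "y' \<in> F" for x y x' y'
  proof -
    have "(x + y * sqrt a) * (x' + y' * sqrt a)
        = (x * x' + y * y' * a) + (x * y' + y * x') * sqrt a"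
      using a by (simp add: algebra_simps)
    then show ?thesis using I c a that by metis
  qed
  have sub: "(x + y * sqrt a) - (x' + y' * sqrt a) \<in> adjoin_sqrt F a"
    if "x \<in> F" "y \<in> F" "x' \<in> F" "y' \<in> F" for x y x' y'
  proof -
    have "(x + y * sqrt a) - (x' + y' * sqrt a) = (x - x') + (y - y') * sqrt a"
      by (simp add: algebra_simps)
    then show ?thesis using I c that by metis
  qed
  show ?thesis unfolding is_subfield_def
  proof (intro conjI ballI)
    show "1 \<in> adjoin_sqrt F a" using I[OF c(1) c(2)] by simp
  qed (use sub mul inv in \<open>auto simp: adjoin_sqrt_def\<close>)
qed

lemma is_subfield_Rats: "is_subfield \<rat>"
  unfolding is_subfield_def by auto

lemma Qsqrt5_eq: "Qsqrt5 = adjoin_sqrt \<rat> 5"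
  unfolding Qsqrt5_def adjoin_sqrt_def ..

lemma is_subfield_Qsqrt5: "is_subfield Qsqrt5"
  unfolding Qsqrt5_eq by (rule is_subfield_adjoin_sqrt[OF is_subfield_Rats]) simp_all

lemma zgold_in_Qsqrt5: "zgold H x \<Longrightarrow> x \<in> Qsqrt5"
proof -
  assume "zgold H x"
  then obtain u v :: int where "x = of_int u + of_int v * golden" unfolding zgold_def by blast
  then have "x = (of_int u + of_int v / 2) + (of_int v / 2) * sqrt 5"
    by (simp add: golden_def field_simps)
  moreover have "real_of_int u + real_of_int v / 2 \<in> \<rat>" "real_of_int v / 2 \<in> \<rat>" by simp_all
  ultimately show ?thesis unfolding Qsqrt5_def by blast
qed

primrec sqrt_tower :: "('i \<Rightarrow> real) \<Rightarrow> 'i list \<Rightarrow> real set" where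
  "sqrt_tower a [] = Qsqrt5"
| "sqrt_tower a (v # vs) = adjoin_sqrt (sqrt_tower a vs) (a v)"

lemma sqrt_tower_subfield:
  assumes "\<forall>v\<in>set vs. a v \<in> Qsqrt5 \<and> 0 \<le> a v"
  shows "is_subfield (sqrt_tower a vs) \<and> Qsqrt5 \<subseteq> sqrt_tower a vs"
  using assms
proof (induction vs)
  case Nil
  show ?case using is_subfield_Qsqrt5 by simp
next
  case (Cons v vs)
  then have "is_subfield (sqrt_tower a vs)" "Qsqrt5 \<subseteq> sqrt_tower a vs" by auto
  with Cons.prems show ?case
    using is_subfield_adjoin_sqrt[of "sqrt_tower a vs" "a v"] adjoin_sqrt_superset by force
qed

text \<open>The quadratic case of Kummer theory. If \<open>sqrt b\<close> is x + y sqrt (a v) and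
  not in the lower field, squaring puts 2 x y sqrt (a v) into that field, which forces x = 0; then
  \<open>sqrt (b * a v)\<close> lies in the lower field and the induction continues with
  \<open>b * a v\<close>.\<close>

lemma sqrt_in_tower:
  assumes "distinct vs" "\<forall>v\<in>set vs. a v \<in> Qsqrt5 \<and> 0 < a v"
    and "b \<in> Qsqrt5" "0 \<le> b" "sqrt b \<in> sqrt_tower a vs"
  shows "\<exists>E\<subseteq>set vs. \<exists>k\<in>Qsqrt5. b * prod a E = k\<^sup>2"
  using assms
proof (induction vs arbitrary: b)
  case Nil
  then show ?case by (intro exI[of _ "{}"]) (auto intro!: bexI[of _ "sqrt b"])
next
  case (Cons v vs)
  let ?F = "sqrt_tower a vs"
  have F: "is_subfield ?F" "Qsqrt5 \<subseteq> ?F"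
    using sqrt_tower_subfield[of vs a] Cons.prems by (auto simp: less_imp_le)
  note c = is_subfield_closed[OF F(1)]
  have av: "a v \<in> Qsqrt5" "0 < a v" using Cons.prems by auto
  have IH: "\<exists>E\<subseteq>set vs. \<exists>k\<in>Qsqrt5. b * prod a E = k\<^sup>2"
    if "b \<in> Qsqrt5" "0 \<le> b" "sqrt b \<in> ?F" for b
    using Cons.IH[OF _ _ that] Cons.prems by auto
  from Cons.prems(5) obtain x y where xy: "sqrt b = x + y * sqrt (a v)" "x \<in> ?F" "y \<in> ?F"
    by (auto simp: adjoin_sqrt_def)
  show ?case
  proof (cases "sqrt b \<in> ?F")
    case True
    then show ?thesis using IH[OF Cons.prems(3,4)] by (meson set_subset_Cons subset_trans)
  next
    case False
    then have nin: "sqrt (a v) \<notin> ?F" and y: "y \<noteq> 0" using xy c by auto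
    have "b = (x + y * sqrt (a v))\<^sup>2" using xy(1) Cons.prems(4) by (metis real_sqrt_pow2)
    then have e: "b = x * x + y * y * a v + 2 * x * y * sqrt (a v)"
      using av by (simp add: power2_eq_square algebra_simps)
    have x: "x = 0"
    proof (rule ccontr)
      assume "x \<noteq> 0"
      then have "sqrt (a v) = (b - x * x - y * y * a v) / (x * y + x * y)"
        using e y by (simp add: field_simps)
      moreover have "(b - x * x - y * y * a v) / (x * y + x * y) \<in> ?F"
        using xy(2,3) av F(2) Cons.prems(3) by (intro c) auto
      ultimately show False using nin by simp
    qed
    then have "sqrt (b * a v) = y * a v" using xy(1) av by (simp add: real_sqrt_mult)
    moreover have "y * a v \<in> ?F" using xy av F(2) by (intro c) auto
    ultimately obtain E k where E: "E \<subseteq> set vs" "k \<in> Qsqrt5" "b * a v * prod a E = k\<^sup>2"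
      using IH[of "b * a v"] is_subfield_closed(5)[OF is_subfield_Qsqrt5] Cons.prems(3,4) av
      by auto
    have "finite E" "v \<notin> E" using E(1) Cons.prems(1) finite_subset by auto
    then show ?thesis using E
      by (intro exI[of _ "insert v E"]) (auto simp: mult.assoc intro!: bexI[of _ k])
  qed
qed

text \<open>Independence in the group of square classes of Q(sqrt 5). Exponents matter only modulo
  2, so a relation is a nonempty subset \<open>E\<close> whose product is a square.\<close>

definition sqrt_independent :: "('i \<Rightarrow> real) \<Rightarrow> 'i set \<Rightarrow> bool" where
  "sqrt_independent a V \<longleftrightarrow>
     (\<forall>E\<subseteq>V. E \<noteq> {} \<longrightarrow> \<not> (\<exists>k\<in>Qsqrt5. prod a E = k\<^sup>2))"

lemma sqrt_independent_tower:
  assumes "sqrt_independent a (set (v # vs))" "distinct (v # vs)"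
    "\<forall>v\<in>set (v # vs). a v \<in> Qsqrt5 \<and> 0 < a v"
  shows "sqrt (a v) \<notin> sqrt_tower a vs"
proof
  assume "sqrt (a v) \<in> sqrt_tower a vs"
  then obtain E k where E: "E \<subseteq> set vs" "k \<in> Qsqrt5" "a v * prod a E = k\<^sup>2"
    using sqrt_in_tower[of vs a "a v"] assms by auto
  have "finite E" "v \<notin> E" using E(1) assms(2) finite_subset by auto
  then have "prod a (insert v E) = k\<^sup>2" using E by simp
  then show False using assms(1) E unfolding sqrt_independent_def
    by (metis insert_mono insert_not_empty list.simps(15))
qed

section \<open>Linear independence of products of square roots\<close>

lemma sum_Pow_insert:
  fixes f :: "'i set \<Rightarrow> real"
  assumes "finite A" "v \<notin> A"
  shows "sum f (Pow (insert v A)) = sum f (Pow A) + (\<Sum>E\<in>Pow A. f (insert v E))"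
proof -
  have "inj_on (insert v) (Pow A)"
    using assms(2) by (intro inj_onI) (metis Diff_insert_absorb PowD subset_eq)
  then show ?thesis unfolding Pow_insert
    by (subst sum.union_disjoint) (use assms in \<open>auto simp: sum.reindex\<close>)
qed

lemma sum_Pow_sqrt_split:
  fixes a :: "'i \<Rightarrow> real"
  assumes "finite A" "v \<notin> A"
  shows "(\<Sum>E\<in>Pow (insert v A). u E * prod a E)
    = (\<Sum>E\<in>Pow A. u E * prod a E) + (\<Sum>E\<in>Pow A. u (insert v E) * prod a E) * a v"
proof -
  have "(\<Sum>E\<in>Pow A. u (insert v E) * prod a (insert v E))
    = (\<Sum>E\<in>Pow A. u (insert v E) * prod a E * a v)"
  proof (rule sum.cong[OF refl])
    fix E assume "E \<in> Pow A"
    then have "finite E" "v \<notin> E" using assms finite_subset by auto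
    then show "u (insert v E) * prod a (insert v E) = u (insert v E) * prod a E * a v"
      by (simp add: ac_simps)
  qed
  then show ?thesis using assms by (simp add: sum_Pow_insert sum_distrib_right)
qed

lemma sqrt_sum_in_tower:
  assumes "distinct vs" "\<forall>v\<in>set vs. a v \<in> Qsqrt5 \<and> 0 \<le> a v"
    "\<forall>E\<subseteq>set vs. u E \<in> Qsqrt5"
  shows "(\<Sum>E\<in>Pow (set vs). u E * (\<Prod>v\<in>E. sqrt (a v))) \<in> sqrt_tower a vs"
  using assms
proof (induction vs arbitrary: u)
  case (Cons v vs)
  have "(\<Sum>E\<in>Pow (set vs). u E * (\<Prod>v\<in>E. sqrt (a v))) \<in> sqrt_tower a vs"
    "(\<Sum>E\<in>Pow (set vs). u (insert v E) * (\<Prod>v\<in>E. sqrt (a v))) \<in> sqrt_tower a vs"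
    using Cons.prems by (auto intro!: Cons.IH simp: subset_insertI2 insert_mono)
  then show ?case using Cons.prems unfolding list.simps
    by (subst sum_Pow_sqrt_split) (auto simp: adjoin_sqrt_def)
qed simp

text \<open>Separating the subsets with and without \<open>v\<close> writes the sum as x + y sqrt (a
  v) with x and y in the tower below. As \<open>sqrt (a v)\<close> is not in that tower, both
  vanish.\<close>

lemma sqrt_sum_eq_0:
  assumes "sqrt_independent a (set vs)" "distinct vs" "\<forall>v\<in>set vs. a v \<in> Qsqrt5 \<and> 0 < a v"
    and "\<forall>E\<subseteq>set vs. u E \<in> Qsqrt5"
    and "(\<Sum>E\<in>Pow (set vs). u E * (\<Prod>v\<in>E. sqrt (a v))) = 0"
  shows "\<forall>E\<subseteq>set vs. u E = 0"
  using assms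
proof (induction vs arbitrary: u)
  case (Cons v vs)
  let ?F = "sqrt_tower a vs"
  define x where "x = (\<Sum>E\<in>Pow (set vs). u E * (\<Prod>v\<in>E. sqrt (a v)))"
  define y where "y = (\<Sum>E\<in>Pow (set vs). u (insert v E) * (\<Prod>v\<in>E. sqrt (a v)))"
  have F: "is_subfield ?F"
    using sqrt_tower_subfield[of vs a] Cons.prems by (auto simp: less_imp_le)
  have ind: "sqrt_independent a (set vs)" "distinct vs" "\<forall>v\<in>set vs. a v \<in> Qsqrt5 \<and> 0 < a v"
    using Cons.prems by (auto simp: sqrt_independent_def subset_insertI2)
  have xy: "x \<in> ?F" "y \<in> ?F"
    using Cons.prems(4) ind unfolding x_def y_def
    by (auto intro!: sqrt_sum_in_tower simp: less_imp_le subset_insertI2)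
  have e: "x + y * sqrt (a v) = 0"
    using Cons.prems(2,5) unfolding list.simps x_def y_def by (subst (asm) sum_Pow_sqrt_split) auto
  have "y = 0"
  proof (rule ccontr)
    assume "y \<noteq> 0"
    then have "sqrt (a v) = - x / y" using e by (simp add: field_simps)
    then have "sqrt (a v) \<in> ?F" using is_subfield_closed[OF F] xy by metis
    then show False using sqrt_independent_tower[OF Cons.prems(1-3)] by simp
  qed
  then have "x = 0" using e by simp
  have "\<forall>E\<subseteq>set vs. u E = 0"
    using Cons.IH[OF ind] \<open>x = 0\<close> Cons.prems(4) unfolding x_def
    by (simp add: subset_insertI2)
  moreover have "u (insert v E) \<in> Qsqrt5" if "E \<subseteq> set vs" for E
  proof -
    have "insert v E \<subseteq> set (v # vs)" using that by auto
    then show ?thesis using Cons.prems(4) by blast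
  qed
  then have "\<forall>E\<subseteq>set vs. u (insert v E) = 0"
    using Cons.IH[OF ind, of "\<lambda>E. u (insert v E)"] \<open>y = 0\<close> unfolding y_def by simp
  ultimately show ?case
    by (metis list.simps(15) insert_Diff_single insert_absorb subset_insert subset_insert_iff)
qed simp

text \<open>Liouville's inequality in the tower: conjugation with respect to the last square root
  squares the size and descends to the next lower stage.\<close>

primrec tower_bound :: "('i \<Rightarrow> real) \<Rightarrow> ('i \<Rightarrow> real) \<Rightarrow> 'i list \<Rightarrow> real \<Rightarrow> real \<Rightarrow> bool" where
  "tower_bound a A [] H x = zgold H x"
| "tower_bound a A (v # vs) H x = (\<exists>H1 H2 x1 x2. x = x1 + x2 * sqrt (a v) \<and>
     tower_bound a A vs H1 x1 \<and> tower_bound a A vs H2 x2 \<and> H1 + H2 * A v \<le> H)"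

lemma tower_bound_nonneg:
  "tower_bound a A vs H x \<Longrightarrow> \<forall>v\<in>set vs. 0 \<le> A v \<Longrightarrow> 0 \<le> H"
proof (induction vs arbitrary: H x)
  case (Cons v vs)
  then obtain H1 H2 x1 x2 where *: "tower_bound a A vs H1 x1" "tower_bound a A vs H2 x2"
    "H1 + H2 * A v \<le> H" by auto
  then have "0 \<le> H1" "0 \<le> H2" using Cons.IH Cons.prems(2) by (meson list.set_intros(2))+
  then have "0 \<le> H1 + H2 * A v" using Cons.prems(2) by simp
  then show ?case using * by linarith
qed (simp add: zgold_nonneg)

lemma tower_bound_mono: "tower_bound a A vs H x \<Longrightarrow> H \<le> H' \<Longrightarrow> tower_bound a A vs H' x"
proof (induction vs)
  case (Cons v vs)
  from Cons.prems(1) obtain H1 H2 x1 x2 where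
    "x = x1 + x2 * sqrt (a v)" "tower_bound a A vs H1 x1" "tower_bound a A vs H2 x2"
    "H1 + H2 * A v \<le> H" by auto
  then show ?case using Cons.prems(2) unfolding tower_bound.simps by force
qed (simp add: zgold_mono)

lemma tower_bound_0: "\<forall>v\<in>set vs. 0 \<le> A v \<Longrightarrow> tower_bound a A vs 0 0"
proof (induction vs)
  case (Cons v vs)
  then show ?case by (simp, intro exI[of _ 0] conjI) auto
qed (simp add: zgold_0)

lemma tower_bound_zgold:
  "zgold H x \<Longrightarrow> \<forall>v\<in>set vs. 0 \<le> A v \<Longrightarrow> tower_bound a A vs H x"
proof (induction vs)
  case (Cons v vs)
  then show ?case
    using tower_bound_0[of vs A a] by (simp, intro exI[of _ H] exI[of _ 0] exI[of _ x]) auto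
qed simp

lemma tower_bound_add:
  "tower_bound a A vs H x \<Longrightarrow> tower_bound a A vs H' y \<Longrightarrow> tower_bound a A vs (H + H') (x + y)"
proof (induction vs arbitrary: H x H' y)
  case (Cons v vs)
  then obtain H1 H2 x1 x2 H1' H2' y1 y2 where *:
    "x = x1 + x2 * sqrt (a v)" "tower_bound a A vs H1 x1" "tower_bound a A vs H2 x2"
    "H1 + H2 * A v \<le> H" "y = y1 + y2 * sqrt (a v)" "tower_bound a A vs H1' y1"
    "tower_bound a A vs H2' y2" "H1' + H2' * A v \<le> H'" by auto
  have "x + y = (x1 + y1) + (x2 + y2) * sqrt (a v)"
    "(H1 + H1') + (H2 + H2') * A v \<le> H + H'"
    using * by (simp_all add: algebra_simps)
  moreover have "tower_bound a A vs (H1 + H1') (x1 + y1)" "tower_bound a A vs (H2 + H2') (x2 + y2)"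
    using * Cons.IH by blast+
  ultimately show ?case unfolding tower_bound.simps by blast
qed (simp add: zgold_add)

lemma tower_bound_minus: "tower_bound a A vs H x \<Longrightarrow> tower_bound a A vs H (- x)"
proof (induction vs arbitrary: H x)
  case (Cons v vs)
  then obtain H1 H2 x1 x2 where *:
    "x = x1 + x2 * sqrt (a v)" "tower_bound a A vs H1 x1" "tower_bound a A vs H2 x2"
    "H1 + H2 * A v \<le> H" by auto
  then show ?case using Cons.IH unfolding tower_bound.simps
    by (intro exI[of _ H1] exI[of _ H2] exI[of _ "- x1"] exI[of _ "- x2"]) auto
qed (simp add: zgold_minus)

text \<open>\<open>A v\<close> stands for the size of \<open>sqrt (a v)\<close>. Asking
  \<open>a v\<close> itself to have size \<open>(A v)\<^sup>2\<close> makes the weighted size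
  submultiplicative, since replacing the square of the root by \<open>a v\<close> then costs
  nothing.\<close>

lemma tower_bound_mult:
  assumes "\<forall>v\<in>set vs. 0 \<le> A v \<and> 0 \<le> a v \<and> zgold ((A v)\<^sup>2) (a v)"
  shows "tower_bound a A vs H x \<Longrightarrow> tower_bound a A vs H' y \<Longrightarrow> tower_bound a A vs (H * H') (x * y)"
  using assms
proof (induction vs arbitrary: H x H' y)
  case (Cons v vs)
  then obtain H1 H2 x1 x2 H1' H2' y1 y2 where *:
    "x = x1 + x2 * sqrt (a v)" "tower_bound a A vs H1 x1" "tower_bound a A vs H2 x2"
    "H1 + H2 * A v \<le> H" "y = y1 + y2 * sqrt (a v)" "tower_bound a A vs H1' y1"
    "tower_bound a A vs H2' y2" "H1' + H2' * A v \<le> H'" by auto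
  have A: "\<forall>v\<in>set vs. 0 \<le> A v" "0 \<le> A v" "0 \<le> a v" using Cons.prems by auto
  have av: "tower_bound a A vs ((A v)\<^sup>2) (a v)"
    using Cons.prems A by (auto intro!: tower_bound_zgold)
  have nn: "0 \<le> H1" "0 \<le> H2" "0 \<le> H1'" "0 \<le> H2'" using * A tower_bound_nonneg by blast+
  have m: "tower_bound a A vs (H * H') (x * y)"
    if "tower_bound a A vs H x" "tower_bound a A vs H' y" for H H' x y
    using Cons.IH[OF that] Cons.prems by simp
  have 1: "tower_bound a A vs (H1 * H1' + H2 * H2' * (A v)\<^sup>2) (x1 * y1 + x2 * y2 * a v)"
    using * av by (intro tower_bound_add m)
  have 2: "tower_bound a A vs (H1 * H2' + H2 * H1') (x1 * y2 + x2 * y1)"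
    using * by (intro tower_bound_add m)
  have e: "x * y = (x1 * y1 + x2 * y2 * a v) + (x1 * y2 + x2 * y1) * sqrt (a v)"
    unfolding * using A by (simp add: algebra_simps)
  have "H1 * H1' + H2 * H2' * (A v)\<^sup>2 + (H1 * H2' + H2 * H1') * A v
      = (H1 + H2 * A v) * (H1' + H2' * A v)"
    by (simp add: algebra_simps power2_eq_square)
  also have "\<dots> \<le> H * H'"
    using * nn A by (intro mult_mono) (auto intro: order_trans[OF _ *(4)])
  finally show ?case unfolding tower_bound.simps using 1 2 e by blast
qed (simp add: zgold_mult)

lemma tower_bound_abs_le:
  assumes "tower_bound a A vs H x" "\<forall>v\<in>set vs. 0 \<le> A v \<and> 0 \<le> a v \<and> a v \<le> (A v)\<^sup>2"
  shows "\<bar>x\<bar> \<le> H"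
  using assms
proof (induction vs arbitrary: H x)
  case (Cons v vs)
  then obtain H1 H2 x1 x2 where *:
    "x = x1 + x2 * sqrt (a v)" "tower_bound a A vs H1 x1" "tower_bound a A vs H2 x2"
    "H1 + H2 * A v \<le> H" by auto
  have "\<bar>x1\<bar> \<le> H1" "\<bar>x2\<bar> \<le> H2" using * Cons by auto
  moreover have "sqrt (a v) \<le> A v" "0 \<le> sqrt (a v)"
    using Cons.prems(2) by (auto intro: real_le_lsqrt)
  ultimately have "\<bar>x1\<bar> + \<bar>x2\<bar> * sqrt (a v) \<le> H1 + H2 * A v"
    by (intro add_mono mult_mono) auto
  moreover have "\<bar>x\<bar> \<le> \<bar>x1\<bar> + \<bar>x2\<bar> * sqrt (a v)"
    unfolding * using \<open>0 \<le> sqrt (a v)\<close> abs_triangle_ineq[of x1 "x2 * sqrt (a v)"]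
    by (simp add: abs_mult)
  ultimately show ?case using *(4) by linarith
qed (simp add: zgold_abs_le)

lemma tower_bound_in_tower: "tower_bound a A vs H x \<Longrightarrow> x \<in> sqrt_tower a vs"
  by (induction vs arbitrary: H x) (auto simp: zgold_in_Qsqrt5 adjoin_sqrt_def)

text \<open>The tower has degree \<open>2 ^ Suc (length vs)\<close> over the rationals, and each
  conjugate other than \<open>x\<close> itself contributes a factor \<open>H\<close>. In the
  induction the exponent \<open>k\<close> becomes \<open>1 + 2 * k\<close>: one factor bounds the
  conjugate \<open>y\<close>, and \<open>x * y\<close> has size \<open>H\<^sup>2\<close> one stage
  lower.\<close>

lemma tower_bound_lower:
  assumes "sqrt_independent a (set vs)" "distinct vs"
    "\<forall>v\<in>set vs. 0 \<le> A v \<and> 0 < a v \<and> zgold ((A v)\<^sup>2) (a v)"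
    and "tower_bound a A vs H x" "x \<noteq> 0"
  shows "1 \<le> \<bar>x\<bar> * H ^ (2 ^ Suc (length vs) - 1)"
  using assms
proof (induction vs arbitrary: H x)
  case (Cons v vs)
  let ?F = "sqrt_tower a vs" and ?k = "2 ^ Suc (length vs) - 1 :: nat"
  have ind: "sqrt_independent a (set vs)" "distinct vs"
    "\<forall>v\<in>set vs. 0 \<le> A v \<and> 0 < a v \<and> zgold ((A v)\<^sup>2) (a v)"
    using Cons.prems by (auto simp: sqrt_independent_def subset_insertI2)
  have av: "0 < a v" "0 \<le> A v" "zgold ((A v)\<^sup>2) (a v)" using Cons.prems by auto
  from Cons.prems obtain H1 H2 x1 x2 where *:
    "x = x1 + x2 * sqrt (a v)" "tower_bound a A vs H1 x1" "tower_bound a A vs H2 x2"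
    "H1 + H2 * A v \<le> H" by auto
  have F: "is_subfield ?F" using sqrt_tower_subfield[of vs a] ind
    by (meson less_imp_le zgold_in_Qsqrt5)
  have nin: "sqrt (a v) \<notin> ?F"
    using sqrt_independent_tower[OF Cons.prems(1,2)] Cons.prems(3) zgold_in_Qsqrt5 by blast
  define y where "y = x1 - x2 * sqrt (a v)"
  have "y \<noteq> 0"
  proof
    assume "y = 0"
    show False
    proof (cases "x2 = 0")
      case True
      then show False using \<open>y = 0\<close> \<open>x \<noteq> 0\<close> * by (simp add: y_def)
    next
      case False
      then have "sqrt (a v) = x1 / x2" using \<open>y = 0\<close> by (simp add: y_def field_simps)
      then show False using nin tower_bound_in_tower[OF *(2)] tower_bound_in_tower[OF *(3)]
          is_subfield_closed(8)[OF F] by simp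
    qed
  qed
  have nn: "0 \<le> H1" "0 \<le> H2" using * tower_bound_nonneg ind by blast+
  have tb: "tower_bound a A (v # vs) H y"
    unfolding tower_bound.simps y_def using * tower_bound_minus
    by (intro exI[of _ H1] exI[of _ H2] exI[of _ x1] exI[of _ "- x2"]) auto
  have yH: "\<bar>y\<bar> \<le> H"
    using tower_bound_abs_le[OF tb] Cons.prems(3) zgold_abs_le by fastforce
  have e: "x * y = x1 * x1 + - (x2 * x2 * a v)"
    unfolding * y_def using av by (simp add: algebra_simps)
  have A: "\<forall>v\<in>set vs. 0 \<le> A v \<and> 0 \<le> a v \<and> zgold ((A v)\<^sup>2) (a v)"
    using ind by (auto simp: less_imp_le)
  have "tower_bound a A vs (H1 * H1 + H2 * H2 * (A v)\<^sup>2) (x1 * x1 + - (x2 * x2 * a v))"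
    using * A tower_bound_zgold[OF av(3), of vs A a]
    by (intro tower_bound_add tower_bound_minus tower_bound_mult[OF A]) auto
  moreover have "H1 * H1 + H2 * H2 * (A v)\<^sup>2 \<le> H\<^sup>2"
  proof -
    have "H1 * H1 + H2 * H2 * (A v)\<^sup>2 \<le> (H1 + H2 * A v)\<^sup>2"
      using nn av by (simp add: power2_eq_square algebra_simps)
    also have "\<dots> \<le> H\<^sup>2" using * nn av by (intro power_mono) auto
    finally show ?thesis .
  qed
  ultimately have "tower_bound a A vs (H\<^sup>2) (x * y)" unfolding e by (rule tower_bound_mono)
  then have "1 \<le> \<bar>x * y\<bar> * (H\<^sup>2) ^ ?k"
    using Cons.IH[OF ind] \<open>x \<noteq> 0\<close> \<open>y \<noteq> 0\<close> by auto
  also have "\<dots> \<le> \<bar>x\<bar> * H * (H\<^sup>2) ^ ?k"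
    unfolding abs_mult using yH by (intro mult_right_mono mult_left_mono) auto
  also have "\<dots> = \<bar>x\<bar> * H ^ (1 + 2 * ?k)"
    by (simp add: power_mult)
  also have "1 + 2 * ?k = 2 ^ Suc (length (v # vs)) - 1"
  proof -
    have X: "1 \<le> (2::nat) ^ Suc (length vs)" by (rule one_le_power) simp
    have "(2::nat) ^ Suc (length (v # vs)) = 2 * 2 ^ Suc (length vs)" by simp
    then show ?thesis using X by linarith
  qed
  finally show ?case .
qed (simp add: zgold_lower)

lemma tower_bound_sum:
  assumes "distinct vs" "\<forall>E\<subseteq>set vs. zgold (H E) (u E)"
  shows "tower_bound a A vs (\<Sum>E\<in>Pow (set vs). H E * prod A E)
    (\<Sum>E\<in>Pow (set vs). u E * (\<Prod>v\<in>E. sqrt (a v)))"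
  using assms
proof (induction vs arbitrary: H u)
  case (Cons v vs)
  have "tower_bound a A vs (\<Sum>E\<in>Pow (set vs). H E * prod A E)
      (\<Sum>E\<in>Pow (set vs). u E * (\<Prod>v\<in>E. sqrt (a v)))"
    "tower_bound a A vs (\<Sum>E\<in>Pow (set vs). H (insert v E) * prod A E)
      (\<Sum>E\<in>Pow (set vs). u (insert v E) * (\<Prod>v\<in>E. sqrt (a v)))"
    using Cons.prems by (auto intro!: Cons.IH simp: subset_insertI2 insert_mono)
  then show ?case using Cons.prems unfolding list.simps tower_bound.simps
    by (subst (1 2) sum_Pow_sqrt_split) auto
qed simp

lemma sqrt_sum_lower:
  assumes "sqrt_independent a V" "finite V"
    "\<forall>v\<in>V. 0 \<le> A v \<and> 0 < a v \<and> zgold ((A v)\<^sup>2) (a v)"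
    and "\<forall>E\<subseteq>V. zgold (H E) (u E)" "E \<subseteq> V" "u E \<noteq> 0"
  shows "1 \<le> \<bar>\<Sum>E\<in>Pow V. u E * (\<Prod>v\<in>E. sqrt (a v))\<bar> *
    (\<Sum>E\<in>Pow V. H E * prod A E) ^ (2 ^ Suc (card V) - 1)"
proof -
  obtain vs where vs: "set vs = V" "distinct vs" using finite_distinct_list[OF assms(2)] by blast
  then have l: "length vs = card V" using distinct_card by fastforce
  have "(\<Sum>E\<in>Pow V. u E * (\<Prod>v\<in>E. sqrt (a v))) \<noteq> 0"
    using sqrt_sum_eq_0[of a vs u] assms vs zgold_in_Qsqrt5 by blast
  moreover have "tower_bound a A vs (\<Sum>E\<in>Pow V. H E * prod A E)
      (\<Sum>E\<in>Pow V. u E * (\<Prod>v\<in>E. sqrt (a v)))"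
    using tower_bound_sum[of vs H u a A] assms vs by simp
  ultimately show ?thesis
    using tower_bound_lower[of a vs A] assms(1,3) vs l by simp
qed

section \<open>Siegel's lemma\<close>

text \<open>Pigeonhole principle for vectors with entries in \<open>{0..H}\<close>,
  \<open>H = card U * X\<close>. Each equation takes at most \<open>H * H + 1\<close> values on
  them, and \<open>H * H + 1 < (H + 1)\<^sup>2\<close> together with twice as many unknowns as
  equations gives two vectors with the same values; their difference is the solution.\<close>

lemma siegel:
  fixes c :: "'e \<Rightarrow> 'u \<Rightarrow> int"
  assumes fin: "finite E" "finite U" and U: "U \<noteq> {}"
    and c: "\<And>e u. e \<in> E \<Longrightarrow> u \<in> U \<Longrightarrow> \<bar>c e u\<bar> \<le> int X"
    and X: "1 \<le> X" and card: "2 * card E \<le> card U"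
  shows "\<exists>p :: 'u \<Rightarrow> int. (\<exists>u\<in>U. p u \<noteq> 0) \<and> (\<forall>u\<in>U. \<bar>p u\<bar> \<le> int (card U * X)) \<and>
    (\<forall>e\<in>E. (\<Sum>u\<in>U. c e u * p u) = 0)"
proof -
  define H where "H = card U * X"
  have H: "1 \<le> H" using X U fin by (simp add: H_def Suc_le_eq card_gt_0_iff)
  define P where "P = PiE U (\<lambda>_. {0..int H})"
  define F where "F p = restrict (\<lambda>e. \<Sum>u\<in>U. c e u * p u) E" for p
  \<comment> \<open>The least value of equation \<open>e\<close> on \<open>P\<close> allowed by the
    signs of its coefficients; all its values lie within \<open>card U * X * H = H * H\<close> of
    it.\<close>
  define lo where "lo e = - (\<Sum>u\<in>U. int H * max (- c e u) 0)" for e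
  define Q where "Q = PiE E (\<lambda>e. {lo e..lo e + int (H * H)})"
  have cP: "card P = (H + 1) ^ card U"
    unfolding P_def using fin by (simp add: card_PiE nat_add_distrib)
  have cQ: "card Q = (H * H + 1) ^ card E"
    unfolding Q_def using fin by (simp add: card_PiE nat_add_distrib nat_mult_distrib)
  have "F ` P \<subseteq> Q"
  proof
    fix y assume "y \<in> F ` P"
    then obtain p where p: "p \<in> P" "y = F p" by blast
    have "lo e \<le> (\<Sum>u\<in>U. c e u * p u) \<and> (\<Sum>u\<in>U. c e u * p u) \<le> lo e + int (H * H)"
      if e: "e \<in> E" for e
    proof
      have pu: "0 \<le> p u" "p u \<le> int H" if "u \<in> U" for u
        using p that unfolding P_def by (auto simp: PiE_iff)
      have 1: "- (int H * max (- c e u) 0) \<le> c e u * p u" if "u \<in> U" for u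
      proof (cases "c e u \<ge> 0")
        case False
        then have "c e u * int H \<le> c e u * p u" using pu[OF that] by (intro mult_left_mono_neg) auto
        then show ?thesis using False by (simp add: ac_simps)
      qed (use pu[OF that] in simp)
      show "lo e \<le> (\<Sum>u\<in>U. c e u * p u)"
        unfolding lo_def sum_negf[symmetric] by (rule sum_mono) (rule 1)
      have 2: "c e u * p u \<le> - (int H * max (- c e u) 0) + int H * int X" if "u \<in> U" for u
      proof (cases "c e u \<ge> 0")
        case True
        then have "c e u * p u \<le> int X * int H"
          using pu[OF that] c[OF e that] by (intro mult_mono) auto
        then show ?thesis using True by (simp add: ac_simps)
      next
        case False
        then have "c e u * p u \<le> 0" using pu[OF that] by (simp add: mult_nonpos_nonneg)
        moreover have "int H * (- c e u) \<le> int H * int X"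
          using c[OF e that] by (intro mult_left_mono) auto
        ultimately show ?thesis using False by simp
      qed
      have "(\<Sum>u\<in>U. c e u * p u) \<le> (\<Sum>u\<in>U. - (int H * max (- c e u) 0) + int H * int X)"
        by (rule sum_mono) (rule 2)
      also have "\<dots> = lo e + int (H * H)"
        unfolding sum.distrib lo_def sum_negf[symmetric] by (simp add: H_def)
      finally show "(\<Sum>u\<in>U. c e u * p u) \<le> lo e + int (H * H)" .
    qed
    then show "y \<in> Q" unfolding p Q_def F_def by auto
  qed
  moreover have "card Q < card P"
  proof (cases "card E = 0")
    case True
    then show ?thesis unfolding cP cQ using H U fin
      by (simp add: card_gt_0_iff) (metis One_nat_def card_gt_0_iff le_imp_less_Suc one_less_power)
  next
    case False
    have "H * H + 1 < (H + 1) ^ 2" using H by (simp add: power2_eq_square)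
    then have "(H * H + 1) ^ card E < ((H + 1) ^ 2) ^ card E"
      using False by (intro power_strict_mono) auto
    also have "\<dots> = (H + 1) ^ (2 * card E)" by (rule power_mult[symmetric])
    also have "\<dots> \<le> (H + 1) ^ card U" using card by (intro power_increasing) auto
    finally show ?thesis unfolding cP cQ .
  qed
  moreover have "finite Q" unfolding Q_def using fin by (auto intro: finite_PiE)
  ultimately have "\<not> inj_on F P"
    by (metis card_inj_on_le not_less)
  then obtain p q where pq: "p \<in> P" "q \<in> P" "F p = F q" "p \<noteq> q" by (auto simp: inj_on_def)
  have "\<exists>u\<in>U. p u \<noteq> q u"
    using pq(1,2,4) unfolding P_def by (meson PiE_ext)
  moreover have "\<bar>p u - q u\<bar> \<le> int H" if "u \<in> U" for u
    using pq(1,2) that unfolding P_def by (force simp: PiE_iff)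
  moreover have "(\<Sum>u\<in>U. c e u * (p u - q u)) = 0" if "e \<in> E" for e
    using fun_cong[OF pq(3), of e] that
    by (simp add: F_def right_diff_distrib sum_subtractf)
  ultimately show ?thesis unfolding H_def
    by (intro exI[of _ "\<lambda>u. p u - q u"]) auto
qed

section \<open>Zero estimates\<close>

text \<open>A Vandermonde argument in several variables. For each coordinate there is a polynomial
  of degree at most \<open>L\<close> that vanishes at all nodes \<open>w i a\<close> except the one
  with \<open>a = s0 i\<close>; expanding the product of these polynomials exhibits a nonzero
  multiple of \<open>q s0\<close> as a combination of the given sums.\<close>

lemma grid_sum_eq_0:
  fixes q :: "('i \<Rightarrow> nat) \<Rightarrow> real" and w :: "'i \<Rightarrow> nat \<Rightarrow> real"
  assumes I: "finite I" and inj: "\<And>i. i \<in> I \<Longrightarrow> inj_on (w i) {..L}"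
    and z: "\<And>t. t \<in> PiE I (\<lambda>_. {..L}) \<Longrightarrow>
      (\<Sum>s\<in>PiE I (\<lambda>_. {..L}). q s * (\<Prod>i\<in>I. w i (s i) ^ t i)) = 0"
    and s0: "s0 \<in> PiE I (\<lambda>_. {..L})"
  shows "q s0 = 0"
proof -
  let ?G = "PiE I (\<lambda>_. {..L})"
  define P where "P i = (\<Prod>a\<in>{..L} - {s0 i}. [:- w i a, 1:])" for i
  have deg: "degree (P i) \<le> L" if "i \<in> I" for i
  proof -
    have "degree (P i) \<le> sum (degree \<circ> (\<lambda>a. [:- w i a, 1:])) ({..L} - {s0 i})"
      unfolding P_def by (rule degree_prod_sum_le) simp
    also have "\<dots> = card ({..L} - {s0 i})" by simp
    also have "\<dots> = L" using s0 that by (auto simp: PiE_iff)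
    finally show ?thesis .
  qed
  have P0: "poly (P i) (w i a) = 0 \<longleftrightarrow> a \<noteq> s0 i" if "i \<in> I" "a \<le> L" for i a
  proof -
    have "s0 i \<le> L" using s0 that by auto
    then have "w i (s0 i) \<noteq> w i b" if "b \<in> {..L} - {s0 i}" for b
      using inj[OF \<open>i \<in> I\<close>] that unfolding inj_on_def by fastforce
    then show ?thesis using that unfolding P_def poly_prod by (auto simp: prod_zero_iff)
  qed
  have ev: "poly (P i) x = (\<Sum>k\<le>L. coeff (P i) k * x ^ k)" if "i \<in> I" for i x
  proof -
    have "(\<Sum>k\<le>degree (P i). coeff (P i) k * x ^ k) = (\<Sum>k\<le>L. coeff (P i) k * x ^ k)"
      using deg[OF that] by (intro sum.mono_neutral_left) (auto simp: coeff_eq_0)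
    then show ?thesis by (simp add: poly_altdef)
  qed
  have "(\<Sum>s\<in>?G. q s * (\<Prod>i\<in>I. poly (P i) (w i (s i))))
      = (\<Sum>s\<in>?G. q s * (\<Sum>t\<in>?G. \<Prod>i\<in>I. coeff (P i) (t i) * w i (s i) ^ t i))"
    using ev I by (intro sum.cong refl arg_cong2[of _ _ _ _ "(*)"])
      (subst prod_sum_PiE[symmetric], auto)
  also have "\<dots> = (\<Sum>s\<in>?G. \<Sum>t\<in>?G. (\<Prod>i\<in>I. coeff (P i) (t i)) * (q s * (\<Prod>i\<in>I. w i (s i) ^ t i)))"
    by (simp add: sum_distrib_left prod.distrib ac_simps)
  also have "\<dots> = (\<Sum>t\<in>?G. (\<Prod>i\<in>I. coeff (P i) (t i)) * (\<Sum>s\<in>?G. q s * (\<Prod>i\<in>I. w i (s i) ^ t i)))"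
    unfolding sum_distrib_left by (rule sum.swap)
  also have "\<dots> = 0" using z by simp
  finally have "(\<Sum>s\<in>?G. q s * (\<Prod>i\<in>I. poly (P i) (w i (s i)))) = 0" .
  moreover have "(\<Sum>s\<in>?G. q s * (\<Prod>i\<in>I. poly (P i) (w i (s i))))
      = (\<Sum>s\<in>{s0}. q s * (\<Prod>i\<in>I. poly (P i) (w i (s i))))"
  proof (rule sum.mono_neutral_right)
    show "finite ?G" using I by (auto intro: finite_PiE)
    show "\<forall>s\<in>?G - {s0}. q s * (\<Prod>i\<in>I. poly (P i) (w i (s i))) = 0"
    proof
      fix s assume s: "s \<in> ?G - {s0}"
      then obtain i where "i \<in> I" "s i \<noteq> s0 i" using s0 PiE_ext by (metis Diff_iff singletonI)
      then have "(\<Prod>i\<in>I. poly (P i) (w i (s i))) = 0"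
        using s I P0 by (intro prod_zero) (auto simp: PiE_iff)
      then show "q s * (\<Prod>i\<in>I. poly (P i) (w i (s i))) = 0" by simp
    qed
  qed (use s0 in auto)
  moreover have "(\<Prod>i\<in>I. poly (P i) (w i (s0 i))) \<noteq> 0"
    using P0 s0 I by (auto simp: PiE_iff)
  ultimately show ?thesis by simp
qed

lemma pcompose_pow: "pcompose (p ^ n) q = pcompose p q ^ n" for p q :: "real poly"
  by (induction n) (simp_all add: pcompose_mult pcompose_1)

lemma coeff_linear_pow:
  fixes z :: real
  shows "coeff ([:z, 1:] ^ n) i = real (n choose i) * z ^ (n - i)"
proof (cases "i \<le> n")
  case False
  have "degree ([:z, 1:] ^ n) \<le> n" using degree_power_le[of "[:z, 1:]" n] by simp
  then show ?thesis using False by (simp add: coeff_eq_0 binomial_eq_0)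
qed (simp add: coeff_linear_poly_power)

text \<open>The inner factors are the Taylor coefficients of order \<open>t\<close> of the monomials
  at \<open>z\<close>. So the polynomial with coefficients \<open>p\<close> vanishes to order
  \<open>T\<close> at each point of \<open>Z\<close>, which is too much for a degree below
  \<open>D\<close>.\<close>

lemma hasse_derivatives_eq_0:
  fixes p :: "nat \<Rightarrow> real"
  assumes Z: "finite Z"
    and z: "\<And>z t. z \<in> Z \<Longrightarrow> t < T \<Longrightarrow> (\<Sum>d<D. p d * (real (d choose t) * z ^ (d - t))) = 0"
    and D: "D \<le> card Z * T" and d: "d < D"
  shows "p d = 0"
proof -
  define P where "P = (\<Sum>d<D. monom (p d) d)"
  have cf: "coeff P d = (if d < D then p d else 0)" for d
    by (simp add: P_def coeff_sum)
  have "P = 0"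
  proof (rule ccontr)
    assume P: "P \<noteq> 0"
    have T: "0 < T" using D d by (cases T) auto
    have o: "T \<le> order z P" if "z \<in> Z" for z
    proof -
      have "coeff (pcompose P [:z, 1:]) t = (\<Sum>d<D. p d * (real (d choose t) * z ^ (d - t)))" for t
        unfolding P_def by (simp add: pcompose_sum coeff_sum monom_altdef pcompose_smult
            pcompose_pow pcompose_pCons coeff_linear_pow)
      then have "monom 1 T dvd pcompose P [:z, 1:]" using z[OF that] by (simp add: monom_1_dvd_iff')
      then obtain r where r: "pcompose P [:z, 1:] = [:0, 1:] ^ T * r"
        by (auto simp: monom_altdef)
      have "P = pcompose (pcompose P [:z, 1:]) [:- z, 1:]"
        by (simp add: pcompose_assoc[symmetric] pcompose_pCons)
      also have "\<dots> = [:- z, 1:] ^ T * pcompose r [:- z, 1:]"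
        unfolding r by (simp add: pcompose_mult pcompose_pow pcompose_pCons)
      finally have "[:- z, 1:] ^ T dvd P" by simp
      then show ?thesis using P by (simp add: order_divides)
    qed
    then have "Z \<subseteq> {x. poly P x = 0}" using T P by (force simp: order_root)
    then have "(\<Sum>z\<in>Z. order z P) \<le> (\<Sum>z | poly P z = 0. order z P)"
      using P by (intro sum_mono2) (auto simp: poly_roots_finite)
    also have "\<dots> \<le> degree P" using P by (rule sum_order_le_degree)
    also have "degree P < D" using d by (intro degree_lessI) (auto simp: cf)
    finally have "(\<Sum>z\<in>Z. order z P) < D" .
    moreover have "card Z * T \<le> (\<Sum>z\<in>Z. order z P)"
      using sum_mono[of Z "\<lambda>_. T" "\<lambda>z. order z P"] o by simp
    ultimately show False using D by simp
  qed
  then show ?thesis using cf[of d] d by simp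
qed

section \<open>Extrapolation\<close>

text \<open>Leibniz' rule for the factor \<open>z - y\<close>; it turns bounds for the derivatives
  of \<open>f\<close> into bounds for those of the divided difference \<open>g\<close>.\<close>

lemma higher_deriv_split:
  fixes f g :: "complex \<Rightarrow> complex"
  assumes g: "g holomorphic_on UNIV" and f: "\<And>z. f z = c + (z - y) * g z"
  shows "(deriv ^^ Suc k) f z = (z - y) * (deriv ^^ Suc k) g z + of_nat (Suc k) * (deriv ^^ k) g z"
proof (induction k arbitrary: z)
  case 0
  have "f = (\<lambda>z. c + (z - y) * g z)" using f by blast
  moreover have "g field_differentiable at z"
    using g by (simp add: holomorphic_on_imp_differentiable_at)
  then have "((\<lambda>z. c + (z - y) * g z) has_field_derivative (z - y) * deriv g z + g z) (at z)"
    by (auto intro!: derivative_eq_intros simp: field_differentiable_derivI)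
  ultimately show ?case by (simp add: DERIV_imp_deriv)
next
  case (Suc k)
  have d: "((deriv ^^ n) g has_field_derivative (deriv ^^ Suc n) g z) (at z)" for n
  proof -
    have "(deriv ^^ n) g holomorphic_on UNIV" using g by (intro holomorphic_higher_deriv) auto
    then show ?thesis
      by (simp add: field_differentiable_derivI holomorphic_on_imp_differentiable_at)
  qed
  have "(deriv ^^ Suc k) f =
      (\<lambda>z. (z - y) * (deriv ^^ Suc k) g z + of_nat (Suc k) * (deriv ^^ k) g z)"
    using Suc.IH by blast
  moreover have "((\<lambda>z. (z - y) * (deriv ^^ Suc k) g z + of_nat (Suc k) * (deriv ^^ k) g z)
      has_field_derivative (z - y) * (deriv ^^ Suc (Suc k)) g z
        + of_nat (Suc (Suc k)) * (deriv ^^ Suc k) g z) (at z)"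
    by (rule derivative_eq_intros d refl)+ (simp add: algebra_simps)
  ultimately show ?case
    by (metis (no_types, lifting) DERIV_imp_deriv comp_apply funpow.simps(2))
qed

text \<open>Newton's interpolation in which one node is split off at a time; the weights \<open>2 ^ k\<close> make
  the size of the interpolation data grow only by a constant factor in each step.\<close>

lemma extrapolation:
  fixes f :: "complex \<Rightarrow> complex" and m :: "complex \<Rightarrow> nat"
  assumes Y: "finite Y" "\<And>y. y \<in> Y \<Longrightarrow> cmod y \<le> S"
      "\<And>x y. x \<in> Y \<Longrightarrow> y \<in> Y \<Longrightarrow> x \<noteq> y \<Longrightarrow> 1 \<le> cmod (x - y)"
    and SR: "1 \<le> S" "S < R" and x: "cmod x \<le> S"
    and "f holomorphic_on UNIV" "\<And>z. cmod z \<le> R \<Longrightarrow> cmod (f z) \<le> A"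
      "\<And>y k. y \<in> Y \<Longrightarrow> k < m y \<Longrightarrow> cmod ((deriv ^^ k) f y) \<le> \<epsilon> * 2 ^ k * fact k" "0 \<le> \<epsilon>"
      "N = (\<Sum>y\<in>Y. m y)"
  shows "cmod (f x) \<le> \<epsilon> * (16 * S) ^ N + (4 * S / (R - S)) ^ N * A"
  using assms(7-)
proof (induction N arbitrary: f m A \<epsilon>)
  case 0
  then show ?case using x SR by (simp add: add_increasing)
next
  case (Suc n)
  then obtain y where y: "y \<in> Y" "0 < m y"
    by (metis bot_nat_0.not_eq_extremum nat.distinct(1) sum.neutral)
  \<comment> \<open>The divided difference at the node \<open>y\<close>, entire because the
    singularity is removable.\<close>
  define g where "g z = (if z = y then deriv f y else (f z - f y) / (z - y))" for z
  have g: "g holomorphic_on UNIV"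
    unfolding g_def by (rule pole_lemma) (use Suc.prems in auto)
  have fg: "f z = f y + (z - y) * g z" for z by (simp add: g_def)
  note split = higher_deriv_split[of g f "f y" y, OF g fg]
  have dy: "cmod ((deriv ^^ k) f w) \<le> \<epsilon> * 2 ^ k * fact k" if "w \<in> Y" "k < m w" for k w
    using Suc.prems(3) that by blast
  have gy: "cmod ((deriv ^^ k) g y) \<le> 4 * \<epsilon> * 2 ^ k * fact k" if "Suc k < m y" for k
  proof -
    have "of_nat (Suc k) * (deriv ^^ k) g y = (deriv ^^ Suc k) f y" using split[of k y] by simp
    then have "real (Suc k) * cmod ((deriv ^^ k) g y) \<le> \<epsilon> * 2 ^ Suc k * fact (Suc k)"
      using dy[OF y(1) that] by (metis norm_mult norm_of_nat)
    also have "\<dots> = real (Suc k) * (2 * \<epsilon> * 2 ^ k * fact k)" by (simp add: algebra_simps)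
    finally have "cmod ((deriv ^^ k) g y) \<le> 2 * \<epsilon> * 2 ^ k * fact k" by simp
    also have "\<dots> \<le> 4 * \<epsilon> * 2 ^ k * fact k"
      using Suc.prems(4) by (intro mult_right_mono) auto
    finally show ?thesis .
  qed
  \<comment> \<open>For positive order, Leibniz' formula at another node is solved for the top
    derivative of \<open>g\<close>. The two terms contribute 1 and 2 units of
    \<open>\<epsilon> * 2 ^ Suc k * fact (Suc k)\<close>, which the factor 4 accommodates.\<close>
  have gw: "cmod ((deriv ^^ k) g w) \<le> 4 * \<epsilon> * 2 ^ k * fact k"
    if w: "w \<in> Y" "w \<noteq> y" and k: "k < m w" for k w
    using k
  proof (induction k)
    case 0
    have 1: "1 \<le> cmod (w - y)" using Y(3) w y by blast
    have "cmod (f w) \<le> \<epsilon>" "cmod (f y) \<le> \<epsilon>" using dy[OF w(1) 0] dy[OF y] by simp_all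
    then have "cmod (f w - f y) \<le> 4 * \<epsilon>"
      using norm_triangle_ineq4[of "f w" "f y"] Suc.prems(4) by linarith
    moreover have "cmod (f w - f y) / cmod (w - y) \<le> cmod (f w - f y) / 1"
      using 1 by (intro divide_left_mono) auto
    ultimately show ?case using w by (simp add: g_def norm_divide)
  next
    case (Suc k)
    have 1: "1 \<le> cmod (w - y)" using Y(3) w y by blast
    have IH: "cmod ((deriv ^^ k) g w) \<le> 4 * \<epsilon> * 2 ^ k * fact k" using Suc by simp
    have "(w - y) * (deriv ^^ Suc k) g w = (deriv ^^ Suc k) f w - of_nat (Suc k) * (deriv ^^ k) g w"
      using split[of k w] by simp
    then have "cmod (w - y) * cmod ((deriv ^^ Suc k) g w)
        \<le> cmod ((deriv ^^ Suc k) f w) + real (Suc k) * cmod ((deriv ^^ k) g w)"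
      by (metis norm_mult norm_of_nat norm_triangle_ineq4)
    also have "\<dots> \<le> \<epsilon> * 2 ^ Suc k * fact (Suc k) + real (Suc k) * (4 * \<epsilon> * 2 ^ k * fact k)"
      using dy[OF w(1) Suc.prems] IH by (intro add_mono mult_left_mono) auto
    also have "\<dots> = 3 * \<epsilon> * 2 ^ Suc k * fact (Suc k)" by (simp add: algebra_simps)
    also have "\<dots> \<le> 4 * \<epsilon> * 2 ^ Suc k * fact (Suc k)"
      using \<open>0 \<le> \<epsilon>\<close> by (intro mult_right_mono) auto
    finally have 2: "cmod (w - y) * cmod ((deriv ^^ Suc k) g w) \<le> 4 * \<epsilon> * 2 ^ Suc k * fact (Suc k)" .
    have "1 * cmod ((deriv ^^ Suc k) g w) \<le> cmod (w - y) * cmod ((deriv ^^ Suc k) g w)"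
      using 1 by (intro mult_right_mono) auto
    then show ?case using 2 by linarith
  qed
  \<comment> \<open>By the maximum principle it suffices to look at the circle of radius
    \<open>R\<close>, where the denominator is at least \<open>R - S\<close>.\<close>
  have gb: "cmod (g z) \<le> 2 * A / (R - S)" if z: "cmod z \<le> R" for z
  proof (rule maximum_modulus_frontier[where f = g and \<xi> = z and S = "cball 0 R"])
    fix w :: complex assume "w \<in> frontier (cball 0 R)"
    then have w: "cmod w = R" using SR by simp
    have "R - S \<le> cmod (w - y)"
      using w Y(2)[OF y(1)] norm_triangle_ineq2[of w y] by linarith
    moreover from this have "w \<noteq> y" using SR by auto
    moreover have "cmod (f w - f y) \<le> 2 * A"
      using Suc.prems(2)[of w] Suc.prems(2)[of y] w Y(2)[OF y(1)] SR
        norm_triangle_ineq4[of "f w" "f y"] by linarith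
    ultimately show "cmod (g w) \<le> 2 * A / (R - S)"
      unfolding g_def using SR norm_ge_zero[of "f w - f y"]
      by (simp add: norm_divide frac_le order_trans[of 0 "cmod (f w - f y)" "2 * A"])
  qed (use g z in \<open>auto intro: holomorphic_on_subset holomorphic_on_imp_continuous_on\<close>)
  \<comment> \<open>Dividing by \<open>z - y\<close> uses up one order at \<open>y\<close> and
    nowhere else.\<close>
  define m' where "m' = m(y := m y - 1)"
  have "(\<Sum>w\<in>Y. m' w) = (m y - 1) + (\<Sum>w\<in>Y - {y}. m w)"
    unfolding m'_def using Y(1) y(1) by (simp add: sum.remove)
  moreover have "Suc n = m y + (\<Sum>w\<in>Y - {y}. m w)"
    using Suc.prems(5) Y(1) y(1) by (simp add: sum.remove)
  ultimately have n: "n = (\<Sum>w\<in>Y. m' w)" using y(2) by simp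
  have IH: "cmod (g x) \<le> 4 * \<epsilon> * (16 * S) ^ n + (4 * S / (R - S)) ^ n * (2 * A / (R - S))"
  proof (rule Suc.IH[of g "2 * A / (R - S)" m' "4 * \<epsilon>"])
    fix w k assume "w \<in> Y" "k < m' w"
    then show "cmod ((deriv ^^ k) g w) \<le> 4 * \<epsilon> * 2 ^ k * fact k"
      using gy[of k] gw[of w k] by (cases "w = y") (auto simp: m'_def)
  qed (use g gb n Suc.prems(4) in auto)
  have "cmod (f x) \<le> cmod (f y) + cmod (x - y) * cmod (g x)"
    using fg[of x] norm_triangle_ineq[of "f y" "(x - y) * g x"] by (simp add: norm_mult)
  also have "\<dots> \<le> \<epsilon> + (2 * S) * cmod (g x)"
    using dy[OF y] x Y(2)[OF y(1)] norm_triangle_ineq4[of x y]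
    by (intro add_mono mult_right_mono) auto
  also have "\<dots> \<le> \<epsilon> + (2 * S) * (4 * \<epsilon> * (16 * S) ^ n + (4 * S / (R - S)) ^ n * (2 * A / (R - S)))"
    using IH SR by (intro add_left_mono mult_left_mono) auto
  also have "\<dots> = \<epsilon> * (1 + 8 * S * (16 * S) ^ n) + (4 * S / (R - S)) ^ Suc n * A"
    by (simp add: algebra_simps)
  also have "\<dots> \<le> \<epsilon> * (16 * S) ^ Suc n + (4 * S / (R - S)) ^ Suc n * A"
  proof -
    have "1 * 1 \<le> 8 * S * (16 * S) ^ n" using SR by (intro mult_mono one_le_power) auto
    moreover have "(16 * S) ^ Suc n = 8 * S * (16 * S) ^ n + 8 * S * (16 * S) ^ n" by simp
    ultimately have "1 + 8 * S * (16 * S) ^ n \<le> (16 * S) ^ Suc n" by linarith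
    then show ?thesis using Suc.prems(4) by (intro add_right_mono mult_left_mono) auto
  qed
  finally show ?case .
qed

section \<open>The auxiliary function\<close>

lemma Suc_times_binomial_Suc: "Suc k * (n choose Suc k) = (n - k) * (n choose k)"
proof (cases "k \<le> n")
  case True
  have "Suc n * (n choose k) = Suc k * (n choose k) + Suc k * (n choose Suc k)"
    unfolding Suc_times_binomial_eq by (simp add: algebra_simps)
  moreover have "Suc n * (n choose k) = Suc k * (n choose k) + (n - k) * (n choose k)"
    using True by (simp add: add_mult_distrib[symmetric])
  ultimately show ?thesis by simp
qed (simp add: binomial_eq_0)

lemma higher_deriv_lincomb:
  fixes f :: "'i \<Rightarrow> complex \<Rightarrow> complex"
  assumes "finite I" "\<And>i. i \<in> I \<Longrightarrow> f i holomorphic_on UNIV"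
  shows "(deriv ^^ k) (\<lambda>z. \<Sum>i\<in>I. c i * f i z) z = (\<Sum>i\<in>I. c i * (deriv ^^ k) (f i) z)"
  using assms
proof (induction I rule: finite_induct)
  case (insert i I)
  have "(deriv ^^ k) (\<lambda>z. c i * f i z + (\<Sum>i\<in>I. c i * f i z)) z
      = (deriv ^^ k) (\<lambda>z. c i * f i z) z + (deriv ^^ k) (\<lambda>z. \<Sum>i\<in>I. c i * f i z) z"
    using insert by (intro higher_deriv_add[of _ UNIV]) (auto intro!: holomorphic_intros)
  moreover have "(deriv ^^ k) (\<lambda>z. c i * f i z) z = c i * (deriv ^^ k) (f i) z"
    using insert by (intro higher_deriv_cmult[of _ UNIV]) auto
  ultimately show ?case using insert by simp
qed simp

lemma exp_minus_one_le:
  fixes x :: real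
  assumes "\<bar>x\<bar> \<le> 1"
  shows "\<bar>exp x - 1\<bar> \<le> 3 * \<bar>x\<bar>"
proof -
  have 1: "1 - x \<le> exp (- x)" using exp_ge_add_one_self[of "- x"] by simp
  then have "(1 - x) * exp x \<le> exp (- x) * exp x" by (intro mult_right_mono) auto
  then have "exp x - 1 \<le> x * exp x" by (simp add: exp_minus algebra_simps)
  also have "\<dots> \<le> \<bar>x\<bar> * 3"
  proof -
    have "exp x \<le> exp 1" using assms by simp
    then have "exp x \<le> 3" using exp_le by linarith
    then have "\<bar>x\<bar> * exp x \<le> \<bar>x\<bar> * 3" by (intro mult_left_mono) auto
    moreover have "x * exp x \<le> \<bar>x\<bar> * exp x" by (intro mult_right_mono) auto
    ultimately show ?thesis by linarith
  qed
  finally have "exp x - 1 \<le> \<bar>x\<bar> * 3" .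
  moreover have "1 - exp x \<le> \<bar>x\<bar> * 3" using exp_ge_add_one_self[of x] by linarith
  ultimately show ?thesis by linarith
qed

text \<open>\<open>a v0\<close> is the number whose logarithm is eliminated, hence the positive
  coefficient. Its exponents run up to \<open>c\<close>, those of the other numbers up to
  \<open>L\<close>, and the degrees in \<open>z\<close> stay below \<open>D\<close>.\<close>

locale log_form =
  fixes V :: "'i set" and v0 :: 'i and a A :: "'i \<Rightarrow> real" and b :: "'i \<Rightarrow> int"
    and D L c :: nat
  assumes finV: "finite V" and v0: "v0 \<in> V" and bv0: "0 < b v0"
    and a1: "\<And>i. i \<in> V \<Longrightarrow> 1 \<le> a i" and zA: "\<And>i. i \<in> V \<Longrightarrow> zgold (A i) (a i)"
    and indep: "sqrt_independent a V"
begin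

abbreviation "V1 \<equiv> V - {v0}"

text \<open>On the hyperplane \<open>Lam = 0\<close> the logarithm of \<open>a v0\<close> is the sum
  of the \<open>b i / b v0 * ln (a i)\<close>. Substituting this gives \<open>ln (a i)\<close> a new
  coefficient; multiplied by \<open>b v0\<close> it is the integer defined here.\<close>

definition wt :: "'i \<Rightarrow> ('i \<Rightarrow> nat) \<Rightarrow> int" where
  "wt i s = b v0 * int (s i) + int (s v0) * b i"

definition box :: "('i \<Rightarrow> nat) set" where
  "box = PiE V (\<lambda>i. {..(if i = v0 then c else L)})"

definition coef :: "('i \<Rightarrow> nat) \<Rightarrow> ('i \<Rightarrow> nat) \<Rightarrow> int" where
  "coef t s = (\<Prod>i\<in>V1. wt i s ^ t i)"

definition e1 :: "('i \<Rightarrow> nat) \<Rightarrow> real" where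
  "e1 s = (\<Sum>i\<in>V. real (s i) * ln (a i))"

text \<open>With \<open>e1\<close> the exponentials are algebraic at integers; with
  \<open>e0\<close> differentiation brings down the integers \<open>wt i s\<close>. Both properties
  are needed, and the two exponents differ only by a multiple of \<open>Lam\<close>.\<close>

definition e0 :: "('i \<Rightarrow> nat) \<Rightarrow> real" where
  "e0 s = (\<Sum>i\<in>V1. real_of_int (wt i s) / real_of_int (b v0) * ln (a i))"

definition Lam :: real where
  "Lam = of_int (b v0) * ln (a v0) - (\<Sum>i\<in>V1. of_int (b i) * ln (a i))"

text \<open>The entry \<open>t v0\<close> of a multi-index counts (normalised) derivatives of the monomial in \<open>z\<close>,
  the other entries count derivatives along the hyperplane \<open>Lam = 0\<close>.\<close>

definition F :: "(nat \<Rightarrow> ('i \<Rightarrow> nat) \<Rightarrow> int) \<Rightarrow> (('i \<Rightarrow> nat) \<Rightarrow> real) \<Rightarrow> ('i \<Rightarrow> nat) set \<Rightarrow>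
    ('i \<Rightarrow> nat) \<Rightarrow> complex \<Rightarrow> complex" where
  "F p e Q t z = (\<Sum>s\<in>Q. \<Sum>d<D. of_int (p d s * coef t s) *
     (of_nat (d choose t v0) * z ^ (d - t v0)) * exp (z * of_real (e s)))"

lemma finite_box: "finite box"
  unfolding box_def using finV by (intro finite_PiE) auto

lemma A1: "i \<in> V \<Longrightarrow> 1 \<le> A i \<and> a i \<le> A i"
  using zgold_abs_le[OF zA] a1 by force

lemma e1_e0: "e1 s - e0 s = real (s v0) * Lam / of_int (b v0)"
proof -
  have "of_int (b v0) * e0 s
      = (\<Sum>i\<in>V1. of_int (b v0) * (real (s i) * ln (a i)) + real (s v0) * (of_int (b i) * ln (a i)))"
    unfolding e0_def sum_distrib_left wt_def using bv0
    by (intro sum.cong) (auto simp: field_simps)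
  also have "\<dots> = of_int (b v0) * (\<Sum>i\<in>V1. real (s i) * ln (a i))
      + real (s v0) * (\<Sum>i\<in>V1. of_int (b i) * ln (a i))"
    by (simp add: sum.distrib sum_distrib_left)
  finally have "of_int (b v0) * (e1 s - e0 s) = real (s v0) * Lam"
    unfolding e1_def Lam_def using finV v0 by (simp add: sum.remove algebra_simps)
  then show ?thesis using bv0 by (simp add: field_simps)
qed

lemma F_holomorphic: "F p e Q t holomorphic_on UNIV"
  unfolding F_def by (intro holomorphic_intros)

lemma coef_upd: "coef (t(v0 := n)) s = coef t s"
  unfolding coef_def by (rule prod.cong) auto

lemma coef_Suc: "i \<in> V1 \<Longrightarrow> coef (t(i := Suc (t i))) s = wt i s * coef t s"
proof -
  assume i: "i \<in> V1"
  have "(\<Prod>j\<in>V1 - {i}. wt j s ^ (t(i := Suc (t i))) j) = (\<Prod>j\<in>V1 - {i}. wt j s ^ t j)"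
    by (rule prod.cong) auto
  then show ?thesis unfolding coef_def using finV i by (simp add: prod.remove[of V1 i])
qed

definition dcoef :: "('i \<Rightarrow> nat) \<Rightarrow> 'i \<Rightarrow> real" where
  "dcoef t i = (if i = v0 then real (Suc (t v0)) else ln (a i) / of_int (b v0))"

text \<open>Differentiating the exponential brings down \<open>e0 s\<close>, whose summands are
  multiples of \<open>wt i s\<close> and so raise one exponent in \<open>coef\<close>;
  differentiating the normalised power of \<open>z\<close> raises the entry at \<open>v0\<close>.
  Thus the functions \<open>F p e0 Q t\<close> are closed under differentiation up to the scalars
  \<open>dcoef\<close>.\<close>

lemma F_deriv:
  "(F p e0 Q t has_field_derivative
     (\<Sum>i\<in>V. of_real (dcoef t i) * F p e0 Q (t(i := Suc (t i))) z)) (at z)"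
proof -
  let ?m = "\<lambda>s d. of_int (p d s * coef t s) :: complex"
  let ?E = "\<lambda>s. exp (z * of_real (e0 s)) :: complex"
  let ?z = "\<lambda>d. of_nat (d choose t v0) * z ^ (d - t v0)"
  let ?T1 = "\<lambda>s d. ?m s d * (of_nat (Suc (t v0) * (d choose Suc (t v0))) * z ^ (d - Suc (t v0))) * ?E s"
  let ?T2 = "\<lambda>s d. ?m s d * ?z d * ?E s * of_real (e0 s)"
  have zd: "((\<lambda>z. of_nat (d choose t v0) * z ^ (d - t v0)) has_field_derivative
      of_nat (Suc (t v0) * (d choose Suc (t v0))) * z ^ (d - Suc (t v0))) (at z)" for d
  proof -
    have "((\<lambda>z. of_nat (d choose t v0) * z ^ (d - t v0)) has_field_derivative
        of_nat (d choose t v0) * (of_nat (d - t v0) * z ^ (d - t v0 - 1))) (at z)"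
      by (auto intro!: derivative_eq_intros)
    moreover have "of_nat (Suc (t v0) * (d choose Suc (t v0)))
        = (of_nat (d choose t v0) * of_nat (d - t v0) :: complex)"
      unfolding Suc_times_binomial_Suc by (simp add: mult.commute)
    ultimately show ?thesis by (simp add: mult.assoc)
  qed
  have te: "((\<lambda>z. ?m s d * (of_nat (d choose t v0) * z ^ (d - t v0)) * exp (z * of_real (e0 s)))
      has_field_derivative ?T1 s d + ?T2 s d) (at z)" for s d
  proof -
    have "((\<lambda>z. exp (z * of_real (e0 s)) :: complex) has_field_derivative ?E s * of_real (e0 s)) (at z)"
      by (auto intro!: derivative_eq_intros)
    from DERIV_mult[OF DERIV_cmult[OF zd[of d], of "?m s d"] this] show ?thesis
      by (rule DERIV_cong) (simp only: mult.assoc mult.commute mult.left_commute add.commute)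
  qed
  have "(F p e0 Q t has_field_derivative (\<Sum>s\<in>Q. \<Sum>d<D. ?T1 s d + ?T2 s d)) (at z)"
    unfolding F_def by (intro DERIV_sum te)
  moreover have "(\<Sum>s\<in>Q. \<Sum>d<D. ?T1 s d + ?T2 s d)
      = (\<Sum>i\<in>V. of_real (dcoef t i) * F p e0 Q (t(i := Suc (t i))) z)"
  proof -
    have 1: "of_real (dcoef t v0) * F p e0 Q (t(v0 := Suc (t v0))) z = (\<Sum>s\<in>Q. \<Sum>d<D. ?T1 s d)"
      unfolding F_def coef_upd dcoef_def sum_distrib_left
      by (intro sum.cong refl) (simp add: algebra_simps)
    have 2: "of_real (dcoef t i) * F p e0 Q (t(i := Suc (t i))) z
      = (\<Sum>s\<in>Q. \<Sum>d<D. ?m s d * ?z d * ?E s * of_real (of_int (wt i s) / of_int (b v0) * ln (a i)))"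
      if "i \<in> V1" for i
    proof -
      have "v0 \<noteq> i" using that by auto
      then show ?thesis
        unfolding F_def coef_Suc[OF that] dcoef_def sum_distrib_left
        by (intro sum.cong refl) (simp add: algebra_simps)
    qed
    have "(\<Sum>i\<in>V1. of_real (dcoef t i) * F p e0 Q (t(i := Suc (t i))) z)
      = (\<Sum>i\<in>V1. \<Sum>s\<in>Q. \<Sum>d<D. ?m s d * ?z d * ?E s * of_real (of_int (wt i s) / of_int (b v0) * ln (a i)))"
      using 2 by (rule sum.cong[OF refl])
    also have "\<dots> = (\<Sum>s\<in>Q. \<Sum>d<D. \<Sum>i\<in>V1. ?m s d * ?z d * ?E s * of_real (of_int (wt i s) / of_int (b v0) * ln (a i)))"
      by (subst sum.swap, rule sum.cong[OF refl], rule sum.swap)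
    also have "\<dots> = (\<Sum>s\<in>Q. \<Sum>d<D. ?T2 s d)"
      unfolding e0_def of_real_sum sum_distrib_left ..
    finally show ?thesis using 1 finV v0
      by (simp add: sum.remove[of V v0] sum.distrib)
  qed
  ultimately show ?thesis by simp
qed

section \<open>Bounds for values and derivatives of the auxiliary function\<close>

definition G1 :: real where
  "G1 = (\<Sum>i\<in>V. ln (A i))"

lemma lnA: "i \<in> V \<Longrightarrow> 0 \<le> ln (a i) \<and> ln (a i) \<le> ln (A i)"
  using A1[of i] a1[of i] by (auto intro: ln_mono)

lemma G1_nonneg: "0 \<le> G1"
  unfolding G1_def using lnA by (force intro: sum_nonneg)

lemma dcoef_sum: "t v0 < T \<Longrightarrow> (\<Sum>i\<in>V. \<bar>dcoef t i\<bar>) \<le> real T + G1"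
proof -
  assume t: "t v0 < T"
  have "\<bar>dcoef t i\<bar> \<le> ln (A i)" if "i \<in> V1" for i
  proof -
    have "ln (a i) / of_int (b v0) \<le> ln (a i) / 1"
      using lnA[of i] that bv0 by (intro divide_left_mono) auto
    then show ?thesis using lnA[of i] that bv0 by (auto simp: dcoef_def)
  qed
  then have "(\<Sum>i\<in>V1. \<bar>dcoef t i\<bar>) \<le> (\<Sum>i\<in>V1. ln (A i))" by (rule sum_mono)
  also have "\<dots> \<le> G1" unfolding G1_def using finV lnA by (intro sum_mono2) (auto, force)
  finally have "(\<Sum>i\<in>V1. \<bar>dcoef t i\<bar>) \<le> G1" .
  moreover have "\<bar>dcoef t v0\<bar> \<le> real T" using t by (simp add: dcoef_def)
  ultimately show ?thesis using finV v0 by (simp add: sum.remove[of V v0])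
qed

text \<open>Each differentiation replaces the function by a combination of total weight at most
  \<open>T + G1\<close> of functions with one entry of \<open>t\<close> raised; all indices that
  occur stay below \<open>T\<close>, where smallness is known.\<close>

lemma F_higher_deriv_le:
  assumes small: "\<And>u. \<forall>i\<in>V. u i < T \<Longrightarrow> cmod (F p e0 Q u z) \<le> \<epsilon>"
    and "\<forall>i\<in>V. t i + k < T"
  shows "cmod ((deriv ^^ k) (F p e0 Q t) z) \<le> (real T + G1) ^ k * \<epsilon>"
  using assms(2)
proof (induction k arbitrary: t)
  case 0
  then show ?case using small by simp
next
  case (Suc k)
  have "(deriv ^^ Suc k) (F p e0 Q t) z = (deriv ^^ k) (deriv (F p e0 Q t)) z"
    by (simp add: funpow_Suc_right del: funpow.simps)
  also have "deriv (F p e0 Q t) = (\<lambda>z. \<Sum>i\<in>V. of_real (dcoef t i) * F p e0 Q (t(i := Suc (t i))) z)"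
    using F_deriv by (intro ext DERIV_imp_deriv)
  also have "(deriv ^^ k) \<dots> z
      = (\<Sum>i\<in>V. of_real (dcoef t i) * (deriv ^^ k) (F p e0 Q (t(i := Suc (t i)))) z)"
    by (rule higher_deriv_lincomb[OF finV F_holomorphic])
  finally have "cmod ((deriv ^^ Suc k) (F p e0 Q t) z)
      \<le> (\<Sum>i\<in>V. \<bar>dcoef t i\<bar> * cmod ((deriv ^^ k) (F p e0 Q (t(i := Suc (t i)))) z))"
    by (simp add: norm_mult order_trans[OF norm_sum] del: funpow.simps)
  also have "\<dots> \<le> (\<Sum>i\<in>V. \<bar>dcoef t i\<bar> * ((real T + G1) ^ k * \<epsilon>))"
    using Suc.prems by (intro sum_mono mult_left_mono Suc.IH) (auto simp: fun_upd_def)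
  also have "\<dots> \<le> (real T + G1) * ((real T + G1) ^ k * \<epsilon>)"
  proof -
    have "t v0 < T" using Suc.prems v0 by auto
    moreover from this have "cmod (F p e0 Q (\<lambda>_. 0) z) \<le> \<epsilon>" by (intro small) auto
    then have "0 \<le> \<epsilon>" using norm_ge_zero order_trans by blast
    ultimately show ?thesis unfolding sum_distrib_right[symmetric]
      using dcoef_sum G1_nonneg by (intro mult_right_mono) auto
  qed
  finally show ?case by (simp add: mult.assoc)
qed

lemma F_term_bound:
  assumes "\<bar>of_int (p d s)\<bar> \<le> P" "\<bar>of_int (coef t s)\<bar> \<le> Co" "d < D"
    and "cmod z \<le> R" "1 \<le> R" "\<bar>e s\<bar> \<le> W"
  shows "cmod (of_int (p d s * coef t s) * (of_nat (d choose t v0) * z ^ (d - t v0)) *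
      exp (z * of_real (e s))) \<le> P * Co * (2 ^ D * R ^ D) * exp (W * R)"
proof -
  have 1: "cmod (of_int (p d s * coef t s)) \<le> P * Co"
  proof -
    have "\<bar>of_int (p d s)\<bar> * \<bar>of_int (coef t s)\<bar> \<le> P * Co"
      using assms by (intro mult_mono) (auto intro: order_trans[OF abs_ge_zero])
    then show ?thesis by (simp add: norm_mult)
  qed
  have 2: "cmod (of_nat (d choose t v0) * z ^ (d - t v0)) \<le> 2 ^ D * R ^ D"
  proof -
    have "(d choose t v0) \<le> 2 ^ d" by (rule binomial_le_pow2)
    also have "(2::nat) ^ d \<le> 2 ^ D" using assms(3) by (intro power_increasing) auto
    finally have "real (d choose t v0) \<le> real (2 ^ D)" by (rule of_nat_mono)
    then have "real (d choose t v0) \<le> 2 ^ D" by simp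
    moreover have "cmod z ^ (d - t v0) \<le> R ^ D"
    proof -
      have "cmod z ^ (d - t v0) \<le> R ^ (d - t v0)" using assms by (intro power_mono) auto
      also have "\<dots> \<le> R ^ D" using assms by (intro power_increasing) auto
      finally show ?thesis .
    qed
    ultimately show ?thesis unfolding norm_mult norm_power norm_of_nat
      by (intro mult_mono) auto
  qed
  have "cmod (exp (z * of_real (e s))) \<le> exp (cmod (z * of_real (e s)))" by (rule norm_exp)
  also have "cmod (z * of_real (e s)) \<le> R * W"
    unfolding norm_mult using assms by (intro mult_mono) auto
  finally have 3: "cmod (exp (z * of_real (e s))) \<le> exp (W * R)" by (simp add: mult.commute)
  have "0 \<le> P * Co" "0 \<le> 2 ^ D * R ^ D" using 1 2 norm_ge_zero order_trans by blast+
  then show ?thesis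
    unfolding norm_mult[of "_ * _" "exp _"] norm_mult[of "of_int _"]
    using 1 2 3 by (intro mult_mono mult_nonneg_nonneg[of "P * Co"] norm_ge_zero mult_nonneg_nonneg[of "cmod _"])
qed

lemma F_bound:
  assumes "Q \<subseteq> box" "\<And>d s. d < D \<Longrightarrow> s \<in> box \<Longrightarrow> \<bar>of_int (p d s)\<bar> \<le> P"
    and "\<And>s. s \<in> box \<Longrightarrow> \<bar>of_int (coef t s)\<bar> \<le> Co" "\<And>s. s \<in> box \<Longrightarrow> \<bar>e s\<bar> \<le> W"
    and "0 \<le> P" "0 \<le> Co" "cmod z \<le> R" "1 \<le> R"
  shows "cmod (F p e Q t z) \<le> real (card box) * real D * (P * Co * (2 ^ D * R ^ D) * exp (W * R))"
    (is "_ \<le> _ * _ * ?B")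
proof -
  have "cmod (F p e Q t z) \<le> (\<Sum>s\<in>Q. \<Sum>d<D. ?B)"
    unfolding F_def using assms
    by (intro order_trans[OF norm_sum] sum_mono order_trans[OF norm_sum] F_term_bound) auto
  also have "\<dots> = real (card Q) * (real D * ?B)" by simp
  also have "\<dots> \<le> real (card box) * (real D * ?B)"
    using assms finite_box by (intro mult_right_mono of_nat_mono card_mono mult_nonneg_nonneg) auto
  finally show ?thesis by (simp add: mult.assoc)
qed

text \<open>The two exponents differ by at most \<open>c * \<bar>Lam\<bar>\<close>, so exchanging
  them changes each term by a relative error of at most \<open>3 * \<eta>\<close>.\<close>

lemma F_diff:
  assumes "Q \<subseteq> box" "\<And>d s. d < D \<Longrightarrow> s \<in> box \<Longrightarrow> \<bar>of_int (p d s)\<bar> \<le> P"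
    and "\<And>s. s \<in> box \<Longrightarrow> \<bar>of_int (coef t s)\<bar> \<le> Co" "\<And>s. s \<in> box \<Longrightarrow> \<bar>e1 s\<bar> \<le> W"
    and "0 \<le> P" "0 \<le> Co" "0 \<le> x" "x \<le> R" "1 \<le> R"
    and \<eta>: "R * (real c * \<bar>Lam\<bar>) \<le> \<eta>" "\<eta> \<le> 1"
  shows "cmod (F p e1 Q t (of_real x) - F p e0 Q t (of_real x))
    \<le> real (card box) * real D * (P * Co * (2 ^ D * R ^ D) * exp (W * R)) * (3 * \<eta>)"
    (is "_ \<le> _ * _ * ?B * _")
proof -
  have \<eta>0: "0 \<le> \<eta>" using \<eta> assms(9) by (smt (verit) mult_nonneg_nonneg of_nat_0_le_iff abs_ge_zero)
  let ?m = "\<lambda>s d. of_int (p d s * coef t s) * (of_nat (d choose t v0) * of_real x ^ (d - t v0)) :: complex"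
  have tm: "cmod (?m s d * exp (of_real x * of_real (e1 s)) - ?m s d * exp (of_real x * of_real (e0 s)))
      \<le> ?B * (3 * \<eta>)" if s: "s \<in> box" and d: "d < D" for s d
  proof -
    define y where "y = x * (e0 s - e1 s)"
    have "s v0 \<le> c" using s v0 unfolding box_def by (auto simp: PiE_iff)
    have "\<bar>e0 s - e1 s\<bar> \<le> real c * \<bar>Lam\<bar>"
    proof -
      have "\<bar>e0 s - e1 s\<bar> = real (s v0) * \<bar>Lam\<bar> / of_int (b v0)"
        using e1_e0[of s] bv0 by (simp add: abs_mult abs_minus_commute)
      also have "\<dots> \<le> real (s v0) * \<bar>Lam\<bar> / 1"
        using bv0 by (intro divide_left_mono) auto
      also have "\<dots> \<le> real c * \<bar>Lam\<bar>" using \<open>s v0 \<le> c\<close> by (simp add: mult_right_mono)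
      finally show ?thesis .
    qed
    then have y: "\<bar>y\<bar> \<le> \<eta>"
      unfolding y_def abs_mult using assms by (intro order_trans[OF mult_mono \<eta>(1)]) auto
    have "exp (of_real x * of_real (e0 s)) = exp (of_real x * of_real (e1 s)) * (of_real (exp y) :: complex)"
      unfolding y_def exp_of_real[symmetric] by (simp add: exp_add[symmetric] algebra_simps)
    then have "cmod (?m s d * exp (of_real x * of_real (e1 s)) - ?m s d * exp (of_real x * of_real (e0 s)))
        = cmod ((?m s d * exp (of_real x * of_real (e1 s))) * of_real (1 - exp y))"
      by (simp add: algebra_simps)
    also have "\<dots> = cmod (?m s d * exp (of_real x * of_real (e1 s))) * \<bar>1 - exp y\<bar>"
      by (metis norm_mult norm_of_real)
    also have "\<dots> \<le> ?B * (3 * \<eta>)"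
    proof (intro mult_mono)
      show "cmod (?m s d * exp (of_real x * of_real (e1 s))) \<le> ?B"
        using assms s d by (intro F_term_bound) auto
      show "\<bar>1 - exp y\<bar> \<le> 3 * \<eta>" using exp_minus_one_le[of y] y \<eta> by linarith
    qed (use assms in auto)
    finally show ?thesis .
  qed
  define B where "B = ?B * (3 * \<eta>)"
  have B: "0 \<le> B" unfolding B_def using assms \<eta>0 by simp
  define h where "h s d = ?m s d * exp (of_real x * of_real (e1 s))
    - ?m s d * exp (of_real x * of_real (e0 s))" for s d
  have e: "F p e1 Q t (of_real x) - F p e0 Q t (of_real x) = (\<Sum>s\<in>Q. \<Sum>d<D. h s d)"
    unfolding F_def h_def by (simp add: sum_subtractf)
  have "cmod (\<Sum>d<D. h s d) \<le> (\<Sum>d<D. B)" if "s \<in> Q" for s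
    using tm[of s] that assms(1) unfolding B_def h_def
    by (intro order_trans[OF norm_sum] sum_mono) auto
  then have "cmod (F p e1 Q t (of_real x) - F p e0 Q t (of_real x)) \<le> (\<Sum>s\<in>Q. \<Sum>d<D. B)"
    unfolding e by (rule order_trans[OF norm_sum sum_mono])
  then have "cmod (F p e1 Q t (of_real x) - F p e0 Q t (of_real x)) \<le> real (card Q) * (real D * B)"
    by simp
  moreover have "real (card Q) * (real D * B) \<le> real (card box) * (real D * B)"
    using assms(1) finite_box B by (intro mult_right_mono of_nat_mono card_mono mult_nonneg_nonneg) auto
  ultimately have "cmod (F p e1 Q t (of_real x) - F p e0 Q t (of_real x)) \<le> real (card box) * (real D * B)"
    by linarith
  then show ?thesis unfolding B_def by (simp add: mult.assoc)
qed

end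

section \<open>Extrapolation and descent modulo powers of two\<close>

text \<open>An odd factor preserves parity. Hence at \<open>l / 2 ^ Suc m\<close> exactly those
  numbers contribute a square root whose exponent has an odd quotient by
  \<open>2 ^ m\<close>.\<close>

definition odds :: "nat \<Rightarrow> nat set" where
  "odds n = {l. odd l \<and> l < 2 * n}"

lemma odds_eq: "odds n = (\<lambda>i. 2 * i + 1) ` {..<n}"
proof
  show "odds n \<subseteq> (\<lambda>i. 2 * i + 1) ` {..<n}"
  proof
    fix l assume "l \<in> odds n"
    then have "l = 2 * (l div 2) + 1" "l div 2 < n" by (auto simp: odds_def)
    then show "l \<in> (\<lambda>i. 2 * i + 1) ` {..<n}" by blast
  qed
qed (auto simp: odds_def)

lemma finite_odds [simp]: "finite (odds n)"
  by (simp add: odds_eq)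

lemma card_odds [simp]: "card (odds n) = n"
  by (simp add: odds_eq card_image inj_on_def)

lemma power_div_fact_le_exp:
  fixes x :: real
  assumes "0 \<le> x"
  shows "x ^ k \<le> exp x * fact k"
proof -
  have "(\<Sum>n\<in>{k}. inverse (fact n) * x ^ n) \<le> (\<Sum>n. inverse (fact n) * x ^ n)"
    using assms summable_exp[of x] by (intro sum_le_suminf) auto
  then have "x ^ k / fact k \<le> exp x"
    unfolding exp_def by (simp add: divide_inverse_commute scaleR_conv_of_real)
  then show ?thesis by (simp add: divide_le_eq)
qed

context log_form
begin

text \<open>The trivial bound on the disc of radius \<open>66 * n\<close>; \<open>W + 1\<close> in
  place of \<open>W\<close> allows for the passage from \<open>e1\<close> to
  \<open>e0\<close>.\<close>

definition majorant :: "real \<Rightarrow> real \<Rightarrow> real \<Rightarrow> nat \<Rightarrow> real" where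
  "majorant P Co W n = real (card box) * real D *
     (P * Co * (2 ^ D * (66 * real n) ^ D) * exp ((W + 1) * (66 * real n)))"

text \<open>The first summand stems from replacing \<open>e1\<close> by \<open>e0\<close> and is
  proportional to \<open>Lam\<close>; the second is the decay produced by \<open>n * T'\<close>
  zeros counted with multiplicity.\<close>

definition gain :: "nat \<Rightarrow> nat \<Rightarrow> nat \<Rightarrow> real" where
  "gain n T T' = 12 * (2 * real n * (real c * \<bar>Lam\<bar>)) * exp (real T + G1) * (32 * real n) ^ (n * T')
     + (1 / 8) ^ (n * T')"

text \<open>Exact zeros for \<open>e1\<close> are small values for \<open>e0\<close>, where
  derivatives lead back into the family. Interpolation bounds the function at the halved points, and
  a second exchange of exponents returns to \<open>e1\<close>. The orders drop by \<open>T'\<close>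
  because up to \<open>T' - 1\<close> derivatives are spent at each node.\<close>

lemma F_extrapolate:
  assumes Q: "Q \<subseteq> box" and P: "\<And>d s. d < D \<Longrightarrow> s \<in> box \<Longrightarrow> \<bar>of_int (p d s)\<bar> \<le> P"
    and Co: "\<And>u s. \<forall>i\<in>V. u i < T \<Longrightarrow> s \<in> box \<Longrightarrow> \<bar>of_int (coef u s)\<bar> \<le> Co"
    and W: "\<And>s. s \<in> box \<Longrightarrow> \<bar>e1 s\<bar> \<le> W"
    and nn: "0 \<le> P" "0 \<le> Co" "1 \<le> n" and Lam: "66 * real n * (real c * \<bar>Lam\<bar>) \<le> 1"
    and van: "\<And>l u. l \<in> odds n \<Longrightarrow> \<forall>i\<in>V. u i < T \<Longrightarrow> F p e1 Q u (of_real (real l / 2 ^ m)) = 0"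
    and t: "\<forall>i\<in>V. t i + T' \<le> T" "0 < T'" and l: "l \<in> odds n"
  shows "cmod (F p e1 Q t (of_real (real l / 2 ^ Suc m))) \<le> majorant P Co W n * gain n T T'"
proof -
  define \<eta> where "\<eta> = 2 * real n * (real c * \<bar>Lam\<bar>)"
  have \<eta>: "0 \<le> \<eta>" "\<eta> \<le> 1" using Lam by (auto simp: \<eta>_def)
  define M0 where "M0 = majorant P Co W n"
  have M0: "0 \<le> M0" unfolding M0_def majorant_def using nn by simp
  have W0: "0 \<le> W" if "box \<noteq> {}" using that W abs_ge_zero order_trans by blast
  have cL: "real c * \<bar>Lam\<bar> \<le> 1"
  proof -
    have "1 * (real c * \<bar>Lam\<bar>) \<le> 66 * real n * (real c * \<bar>Lam\<bar>)"
      using nn by (intro mult_right_mono) auto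
    then show ?thesis using Lam by linarith
  qed
  have W': "\<bar>e0 s\<bar> \<le> W + 1" if s: "s \<in> box" for s
  proof -
    have "s v0 \<le> c" using s v0 unfolding box_def by (auto simp: PiE_iff)
    have "\<bar>e1 s - e0 s\<bar> = real (s v0) * \<bar>Lam\<bar> / of_int (b v0)"
      using e1_e0[of s] bv0 by (simp add: abs_mult)
    also have "\<dots> \<le> real (s v0) * \<bar>Lam\<bar> / 1" using bv0 by (intro divide_left_mono) auto
    also have "\<dots> \<le> real c * \<bar>Lam\<bar>" using \<open>s v0 \<le> c\<close> by (simp add: mult_right_mono)
    finally show ?thesis using W[OF s] cL by linarith
  qed
  have tT: "\<forall>i\<in>V. t i < T" using t by fastforce
  have sup: "cmod (F p e0 Q t z) \<le> M0" if "cmod z \<le> 66 * real n" for z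
    unfolding M0_def majorant_def using nn that P Co tT W'
    by (intro F_bound[OF Q]) auto
  have diff: "cmod (F p e1 Q u (of_real x) - F p e0 Q u (of_real x)) \<le> M0 * (3 * \<eta>)"
    if x: "0 \<le> x" "x \<le> 2 * real n" and u: "\<forall>i\<in>V. u i < T" for x u
  proof -
    have "cmod (F p e1 Q u (of_real x) - F p e0 Q u (of_real x))
      \<le> real (card box) * real D * (P * Co * (2 ^ D * (2 * real n) ^ D) * exp (W * (2 * real n))) * (3 * \<eta>)"
      using nn P Co u W x \<eta> by (intro F_diff[OF Q]) (auto simp: \<eta>_def)
    also have "\<dots> \<le> M0 * (3 * \<eta>)"
    proof (cases "box = {}")
      case False
      have "exp (W * (2 * real n)) \<le> exp ((W + 1) * (66 * real n))"
        using W0[OF False] nn by (intro iffD2[OF exp_le_cancel_iff] mult_mono) auto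
      moreover have "(2 * real n) ^ D \<le> (66 * real n) ^ D" by (intro power_mono) auto
      ultimately show ?thesis unfolding M0_def majorant_def using nn \<eta>
        by (intro mult_mono mult_left_mono) auto
    qed (simp add: M0_def majorant_def)
    finally show ?thesis .
  qed
  \<comment> \<open>The factor \<open>exp (T + G1)\<close> turns the powers
    \<open>(T + G1) ^ k\<close> into the \<open>fact k\<close> that the interpolation data
    require.\<close>
  define \<epsilon> where "\<epsilon> = M0 * (3 * \<eta>) * exp (real T + G1)"
  have eps: "M0 * (3 * \<eta>) \<le> \<epsilon>" "0 \<le> \<epsilon>"
  proof -
    have "M0 * (3 * \<eta>) * 1 \<le> M0 * (3 * \<eta>) * exp (real T + G1)"
      using M0 \<eta> G1_nonneg by (intro mult_left_mono) auto
    then show "M0 * (3 * \<eta>) \<le> \<epsilon>" "0 \<le> \<epsilon>" unfolding \<epsilon>_def using M0 \<eta> by auto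
  qed
  define q :: complex where "q = 1 / 2 ^ m"
  have q: "cmod q \<le> 1" unfolding q_def by (simp add: norm_divide norm_power)
  \<comment> \<open>Rescaling moves the nodes \<open>l / 2 ^ m\<close> to the odd integers, which
    are at mutual distance at least 1, and the new point to \<open>l / 2\<close>.\<close>
  define f where "f w = F p e0 Q t (q * w)" for w
  define Y :: "complex set" where "Y = of_nat ` odds n"
  have Yl: "\<exists>l\<in>odds n. y = of_nat l" if "y \<in> Y" for y using that by (auto simp: Y_def)
  have data: "cmod ((deriv ^^ k) f y) \<le> \<epsilon> * 2 ^ k * fact k" if y: "y \<in> Y" and k: "k < T'" for y k
  proof -
    from Yl[OF y] obtain l where l: "l \<in> odds n" "y = of_nat l" by blast
    have qy: "q * y = of_real (real l / 2 ^ m)" by (simp add: q_def l)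
    have "real l / 2 ^ m \<le> real l / 1" by (intro divide_left_mono) auto
    then have lm: "0 \<le> real l / 2 ^ m" "real l / 2 ^ m \<le> 2 * real n"
      using l by (auto simp: odds_def)
    have "cmod (F p e0 Q u (q * y)) \<le> M0 * (3 * \<eta>)" if "\<forall>i\<in>V. u i < T" for u
      using diff[OF lm that] van[OF l(1) that] unfolding qy by simp
    moreover have "\<forall>i\<in>V. t i + k < T" using t k by fastforce
    ultimately have "cmod ((deriv ^^ k) (F p e0 Q t) (q * y)) \<le> (real T + G1) ^ k * (M0 * (3 * \<eta>))"
      by (rule F_higher_deriv_le)
    also have "\<dots> \<le> (exp (real T + G1) * fact k) * (M0 * (3 * \<eta>))"
      using G1_nonneg M0 \<eta> by (intro mult_right_mono power_div_fact_le_exp) auto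
    also have "\<dots> = \<epsilon> * 1 * fact k" by (simp add: \<epsilon>_def)
    also have "\<dots> \<le> \<epsilon> * 2 ^ k * fact k"
      using eps by (intro mult_right_mono mult_left_mono) auto
    finally have 1: "cmod ((deriv ^^ k) (F p e0 Q t) (q * y)) \<le> \<epsilon> * 2 ^ k * fact k" .
    have "(deriv ^^ k) f y = q ^ k * (deriv ^^ k) (F p e0 Q t) (q * y)"
      unfolding f_def by (rule higher_deriv_compose_linear[OF F_holomorphic, where S = UNIV]) auto
    then have "cmod ((deriv ^^ k) f y) = cmod q ^ k * cmod ((deriv ^^ k) (F p e0 Q t) (q * y))"
      by (simp add: norm_mult norm_power)
    also have "\<dots> \<le> 1 * cmod ((deriv ^^ k) (F p e0 Q t) (q * y))"
      using q by (intro mult_right_mono power_le_one) auto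
    finally show ?thesis using 1 by linarith
  qed
  define x :: complex where "x = of_real (real l / 2)"
  have ex: "cmod (f x) \<le> \<epsilon> * (16 * (2 * real n)) ^ (n * T')
      + (4 * (2 * real n) / (66 * real n - 2 * real n)) ^ (n * T') * M0"
  proof (rule extrapolation[where Y = Y and m = "\<lambda>_. T'" and f = f and R = "66 * real n"])
    show "finite Y" by (simp add: Y_def)
    show "cmod y \<le> 2 * real n" if "y \<in> Y" for y
      using Yl[OF that] by (auto simp: odds_def simp flip: of_nat_less_iff)
    show "1 \<le> cmod (y - y')" if "y \<in> Y" "y' \<in> Y" "y \<noteq> y'" for y y'
    proof -
      from Yl[OF that(1)] Yl[OF that(2)] obtain k k'
        where k: "y = of_nat k" "y' = of_nat k'" by blast
      then have "y - y' = of_int (int k - int k')" by simp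
      moreover have "int k - int k' \<noteq> 0" using that k by auto
      then have "1 \<le> \<bar>int k - int k'\<bar>" by linarith
      ultimately show ?thesis
        by (metis norm_of_int of_int_1_le_iff of_int_abs)
    qed
    show "cmod x \<le> 2 * real n" unfolding x_def norm_of_real
      using l by (auto simp: odds_def simp flip: of_nat_less_iff)
    show "f holomorphic_on UNIV"
      unfolding f_def F_def by (intro holomorphic_intros)
    show "cmod (f z) \<le> M0" if "cmod z \<le> 66 * real n" for z
    proof -
      have "cmod q * cmod z \<le> 1 * (66 * real n)" using q that by (intro mult_mono) auto
      then show ?thesis unfolding f_def by (intro sup) (simp add: norm_mult)
    qed
    show "n * T' = (\<Sum>y\<in>Y. T')"
      unfolding Y_def by (simp add: card_image inj_on_def)
  qed (use data eps nn in auto)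
  \<comment> \<open>The radius \<open>66 * n\<close> was chosen for this quotient: nodes of size at
    most \<open>2 * n\<close> leave \<open>64 * n\<close> in the denominator.\<close>
  have q8: "4 * (2 * real n) / (66 * real n - 2 * real n) = 1 / 8" using nn by (simp add: field_simps)
  have "16 * (2 * real n) = 32 * real n" by simp
  then have ex': "cmod (f x) \<le> \<epsilon> * (32 * real n) ^ (n * T') + (1 / 8) ^ (n * T') * M0"
    using ex unfolding q8 by metis
  have qx: "q * x = of_real (real l / 2 ^ Suc m)" by (simp add: q_def x_def)
  have "real l / 2 ^ Suc m \<le> real l / 1"
    using one_le_power[of "2::real" "Suc m"] by (intro divide_left_mono) auto
  then have lm: "0 \<le> real l / 2 ^ Suc m" "real l / 2 ^ Suc m \<le> 2 * real n"
    using l by (auto simp: odds_def simp flip: of_nat_less_iff)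
  have "cmod (F p e1 Q t (of_real (real l / 2 ^ Suc m))) \<le> cmod (f x) + M0 * (3 * \<eta>)"
    using diff[OF lm tT] norm_triangle_sub[of "F p e1 Q t (of_real (real l / 2 ^ Suc m))"
        "F p e0 Q t (of_real (real l / 2 ^ Suc m))"] unfolding f_def qx by linarith
  also have "M0 * (3 * \<eta>) \<le> \<epsilon> * (32 * real n) ^ (n * T')"
  proof -
    have "\<epsilon> * 1 \<le> \<epsilon> * (32 * real n) ^ (n * T')"
      using nn eps by (intro mult_left_mono one_le_power) auto
    then show ?thesis using eps by linarith
  qed
  finally have "cmod (F p e1 Q t (of_real (real l / 2 ^ Suc m)))
      \<le> 2 * (\<epsilon> * (32 * real n) ^ (n * T')) + (1 / 8) ^ (n * T') * M0"
    using ex' by linarith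
  also have "\<dots> = M0 * (6 * \<eta> * exp (real T + G1) * (32 * real n) ^ (n * T') + (1 / 8) ^ (n * T'))"
    by (simp add: \<epsilon>_def algebra_simps)
  also have "\<dots> \<le> M0 * gain n T T'"
    unfolding gain_def \<eta>_def[symmetric] using M0 \<eta> nn
    by (intro mult_left_mono add_right_mono mult_right_mono) auto
  finally show ?thesis unfolding M0_def .
qed


section \<open>Residue classes of exponent vectors and one step of the descent\<close>

definition cls :: "nat \<Rightarrow> ('i \<Rightarrow> nat) \<Rightarrow> ('i \<Rightarrow> nat) set" where
  "cls m s0 = {s \<in> box. \<forall>i\<in>V. s i mod 2 ^ m = s0 i mod 2 ^ m}"

text \<open>The coordinates whose binary digit of weight \<open>2 ^ m\<close> is 1; they index the
  square roots that appear at points with denominator \<open>2 ^ Suc m\<close>.\<close>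

definition par :: "nat \<Rightarrow> ('i \<Rightarrow> nat) \<Rightarrow> 'i set" where
  "par m s = {i \<in> V. odd (s i div 2 ^ m)}"

lemma cls_Suc: "cls (Suc m) s0 = {s \<in> cls m s0. par m s = par m s0}"
proof -
  have *: "x mod 2 ^ Suc m = y mod 2 ^ Suc m \<longleftrightarrow>
      x mod 2 ^ m = y mod 2 ^ m \<and> (odd (x div 2 ^ m) \<longleftrightarrow> odd (y div 2 ^ m))" for x y :: nat
  proof -
    have e: "z mod 2 ^ Suc m = 2 ^ m * (z div 2 ^ m mod 2) + z mod 2 ^ m" for z :: nat
      using mod_mult2_eq[of z "2 ^ m" 2] by (simp add: mult.commute)
    have lt: "z mod 2 ^ m < 2 ^ m" for z :: nat by simp
    show ?thesis
    proof
      assume a: "x mod 2 ^ Suc m = y mod 2 ^ Suc m"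
      have "z mod 2 ^ Suc m mod 2 ^ m = z mod 2 ^ m" "z mod 2 ^ Suc m div 2 ^ m = z div 2 ^ m mod 2"
        for z :: nat unfolding e using lt[of z] by simp_all
      then show "x mod 2 ^ m = y mod 2 ^ m \<and> (odd (x div 2 ^ m) \<longleftrightarrow> odd (y div 2 ^ m))"
        using a by (metis odd_iff_mod_2_eq_one)
    next
      assume a: "x mod 2 ^ m = y mod 2 ^ m \<and> (odd (x div 2 ^ m) \<longleftrightarrow> odd (y div 2 ^ m))"
      then have "x div 2 ^ m mod 2 = y div 2 ^ m mod 2" by (simp add: mod2_eq_if)
      then show "x mod 2 ^ Suc m = y mod 2 ^ Suc m" using a unfolding e by simp
    qed
  qed
  have "(\<forall>i\<in>V. s i mod 2 ^ Suc m = s0 i mod 2 ^ Suc m) \<longleftrightarrow>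
      (\<forall>i\<in>V. s i mod 2 ^ m = s0 i mod 2 ^ m) \<and> par m s = par m s0" for s
    unfolding * par_def by blast
  then show ?thesis unfolding cls_def by (auto simp del: power_Suc)
qed

text \<open>Bounds the coefficients in Z[golden] of the products of square roots that make up the
  value at \<open>l / 2 ^ m\<close>, up to a common factor, once \<open>2 ^ (m * D)\<close> has
  cleared the denominators of the powers of \<open>z\<close>.\<close>

definition height :: "real \<Rightarrow> real \<Rightarrow> real \<Rightarrow> nat \<Rightarrow> nat \<Rightarrow> real" where
  "height P Co W n m = real (card box) * real D *
     (P * Co * (2 ^ D * (2 * real n) ^ D * 2 ^ (m * D)) * exp (W * (2 * real n)))"

text \<open>Up to a common factor \<open>K\<close> the value is a combination of the products of
  square roots over the parity sets \<open>E\<close>, with coefficients \<open>u E\<close> in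
  Z[golden] after clearing denominators. A nonzero coefficient would contradict Liouville's
  inequality, so all vanish, and the one for \<open>par m s0\<close> is the contribution of the next
  class.\<close>

lemma F_cls_Suc_eq_0:
  assumes P: "\<And>d s. d < D \<Longrightarrow> s \<in> box \<Longrightarrow> \<bar>of_int (p d s)\<bar> \<le> P"
    and Co: "\<And>s. s \<in> box \<Longrightarrow> \<bar>of_int (coef t s)\<bar> \<le> Co"
    and W: "\<And>s. s \<in> box \<Longrightarrow> (\<Sum>i\<in>V. real (s i) * ln (A i)) \<le> W"
    and nn: "0 \<le> P" "0 \<le> Co" and l: "l \<in> odds n"
    and small: "cmod (F p e1 (cls m s0) t (of_real (real l / 2 ^ Suc m))) * 2 ^ (Suc m * D) *
      (2 ^ card V * height P Co W n (Suc m) * prod A V) ^ (2 ^ Suc (card V) - 1) < 1"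
  shows "F p e1 (cls (Suc m) s0) t (of_real (real l / 2 ^ Suc m)) = 0"
proof -
  define x where "x = real l / 2 ^ Suc m"
  have x0: "0 \<le> x" by (simp add: x_def)
  \<comment> \<open>\<open>x * s i\<close> splits into the contribution of the residue, collected in
    \<open>K\<close>, an integral exponent \<open>\<nu> s i\<close>, and one half when
    \<open>s i div 2 ^ m\<close> is odd.\<close>
  define \<nu> where "\<nu> s i = (s i div 2 ^ m * l) div 2" for s :: "'i \<Rightarrow> nat" and i
  define K where "K = exp (\<Sum>i\<in>V. x * real (s0 i mod 2 ^ m) * ln (a i))"
  define \<tau> where "\<tau> = t v0"
  \<comment> \<open>The integer that \<open>(d choose \<tau>) * x ^ (d - \<tau>)\<close> becomes on
    multiplication by \<open>2 ^ (Suc m * D)\<close>.\<close>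
  define Z where "Z d = (d choose \<tau>) * l ^ (d - \<tau>) * 2 ^ (Suc m * (D - (d - \<tau>)))" for d
  define g where "g s = (\<Sum>d<D. of_int (p d s * coef t s) * real (Z d) * (\<Prod>i\<in>V. a i ^ \<nu> s i))" for s
  define u where "u E = (\<Sum>s\<in>{s \<in> cls m s0. par m s = E}. g s)" for E
  have finc: "finite (cls m s0)" unfolding cls_def using finite_box by simp
  have lo: "odd l" and ln: "real l \<le> 2 * real n"
    using l by (auto simp: odds_def simp flip: of_nat_less_iff)
  have ex: "exp (x * e1 s) = K * (\<Prod>i\<in>V. a i ^ \<nu> s i) * (\<Prod>i\<in>par m s. sqrt (a i))"
    if s: "s \<in> cls m s0" for s
  proof -
    have "exp (x * (real (s i) * ln (a i))) = exp (x * real (s0 i mod 2 ^ m) * ln (a i)) *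
        a i ^ \<nu> s i * (if i \<in> par m s then sqrt (a i) else 1)" if i: "i \<in> V" for i
    proof -
      define \<mu> where "\<mu> = s i div 2 ^ m"
      have ai: "0 < a i" using a1[OF i] by simp
      have "s i mod 2 ^ m = s0 i mod 2 ^ m" using s i by (simp add: cls_def)
      then have si: "s i = s0 i mod 2 ^ m + 2 ^ m * \<mu>"
        unfolding \<mu>_def by (metis add.commute mult_div_mod_eq)
      have "\<mu> * l = 2 * \<nu> s i + (\<mu> * l) mod 2" unfolding \<nu>_def \<mu>_def by simp
      moreover have "(\<mu> * l) mod 2 = (if i \<in> par m s then 1 else 0)"
        using lo i by (auto simp: par_def \<mu>_def even_mult_iff mod_2_eq_odd)
      ultimately have ml': "\<mu> * l = 2 * \<nu> s i + (if i \<in> par m s then 1 else 0)" by simp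
      then have ml: "real \<mu> * real l = 2 * real (\<nu> s i) + (if i \<in> par m s then 1 else 0)"
      proof -
        have "real (\<mu> * l) = real (2 * \<nu> s i + (if i \<in> par m s then 1 else 0))"
          using ml' by (rule arg_cong)
        then show ?thesis by simp
      qed
      have "x * real (s i) = x * real (s0 i mod 2 ^ m) + real \<mu> * real l / 2"
        unfolding si x_def by (simp add: field_simps)
      then have "x * (real (s i) * ln (a i)) = x * real (s0 i mod 2 ^ m) * ln (a i)
          + real (\<nu> s i) * ln (a i) + (if i \<in> par m s then ln (a i) / 2 else 0)"
        unfolding ml mult.assoc[symmetric] by (simp add: algebra_simps add_divide_distrib)
      moreover have "exp (real (\<nu> s i) * ln (a i)) = a i ^ \<nu> s i"
        using ai by (simp add: exp_of_nat_mult)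
      moreover have "exp (ln (a i) / 2) = sqrt (a i)"
        using exp_ln[of "sqrt (a i)"] ai by (simp add: ln_sqrt)
      ultimately show ?thesis by (simp add: exp_add)
    qed
    then have "exp (x * e1 s) = (\<Prod>i\<in>V. exp (x * real (s0 i mod 2 ^ m) * ln (a i)) *
        a i ^ \<nu> s i * (if i \<in> par m s then sqrt (a i) else 1))"
      unfolding e1_def sum_distrib_left exp_sum[OF finV] by (rule prod.cong[OF refl])
    also have "\<dots> = K * (\<Prod>i\<in>V. a i ^ \<nu> s i) * (\<Prod>i\<in>V. if i \<in> par m s then sqrt (a i) else 1)"
      unfolding K_def exp_sum[OF finV] by (simp add: prod.distrib)
    also have "(\<Prod>i\<in>V. if i \<in> par m s then sqrt (a i) else 1) = (\<Prod>i\<in>par m s. sqrt (a i))"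
      using finV by (subst prod.inter_filter[symmetric]) (auto simp: par_def intro: prod.cong)
    finally show ?thesis .
  qed
  have Fg: "(\<Sum>d<D. of_int (p d s * coef t s) * (of_nat (d choose t v0) * of_real x ^ (d - t v0))
      * exp (of_real x * of_real (e1 s)) :: complex) * 2 ^ (Suc m * D)
    = of_real (K * (g s * (\<Prod>i\<in>par m s. sqrt (a i))))" if s: "s \<in> cls m s0" for s
  proof -
    have Zd: "real (d choose \<tau>) * x ^ (d - \<tau>) * 2 ^ (Suc m * D) = real (Z d)" if "d < D" for d
    proof -
      have "Suc m * D = Suc m * (d - \<tau>) + Suc m * (D - (d - \<tau>))"
        using that by (metis diff_le_self le_add_diff_inverse less_imp_le order_trans add_mult_distrib2)
      then have "(2::real) ^ (Suc m * D) = (2 ^ Suc m) ^ (d - \<tau>) * 2 ^ (Suc m * (D - (d - \<tau>)))"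
        by (metis power_add power_mult)
      moreover have "x ^ (d - \<tau>) * (2 ^ Suc m) ^ (d - \<tau>) = real l ^ (d - \<tau>)"
        unfolding x_def power_mult_distrib[symmetric] by simp
      ultimately show ?thesis unfolding Z_def by (simp add: ac_simps del: power_Suc)
    qed
    have "(\<Sum>d<D. of_int (p d s * coef t s) * (real (d choose \<tau>) * x ^ (d - \<tau>))
        * exp (x * e1 s)) * 2 ^ (Suc m * D)
      = (\<Sum>d<D. of_int (p d s * coef t s) * (real (d choose \<tau>) * x ^ (d - \<tau>) * 2 ^ (Suc m * D))
          * exp (x * e1 s))"
      by (simp add: sum_distrib_right sum_distrib_left ac_simps)
    also have "\<dots> = (\<Sum>d<D. of_int (p d s * coef t s) * real (Z d) * exp (x * e1 s))"
      using Zd by (intro sum.cong refl) simp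
    also have "\<dots> = K * (g s * (\<Prod>i\<in>par m s. sqrt (a i)))"
      unfolding ex[OF s] g_def by (simp add: sum_distrib_right sum_distrib_left ac_simps)
    finally have "of_real ((\<Sum>d<D. of_int (p d s * coef t s) * (real (d choose \<tau>) * x ^ (d - \<tau>))
        * exp (x * e1 s)) * 2 ^ (Suc m * D)) = (of_real (K * (g s * (\<Prod>i\<in>par m s. sqrt (a i)))) :: complex)"
      by (rule arg_cong)
    then show ?thesis by (simp add: \<tau>_def exp_of_real[symmetric])
  qed
  have FE: "F p e1 {s \<in> cls m s0. par m s = E} t (of_real x) * 2 ^ (Suc m * D)
      = of_real (K * (u E * (\<Prod>i\<in>E. sqrt (a i))))" for E
  proof -
    have "F p e1 {s \<in> cls m s0. par m s = E} t (of_real x) * 2 ^ (Suc m * D)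
      = (\<Sum>s\<in>{s \<in> cls m s0. par m s = E}. of_real (K * (g s * (\<Prod>i\<in>par m s. sqrt (a i)))))"
      unfolding F_def sum_distrib_right[of _ "{s \<in> cls m s0. par m s = E}"]
      by (rule sum.cong[OF refl], rule Fg) simp
    also have "\<dots> = (\<Sum>s\<in>{s \<in> cls m s0. par m s = E}. of_real (K * (g s * (\<Prod>i\<in>E. sqrt (a i)))))"
      by (rule sum.cong) auto
    finally show ?thesis unfolding u_def by (simp add: sum_distrib_right sum_distrib_left)
  qed
  have sumE: "F p e1 (cls m s0) t (of_real x) * 2 ^ (Suc m * D)
      = of_real (K * (\<Sum>E\<in>Pow V. u E * (\<Prod>i\<in>E. sqrt (a i))))"
  proof -
    have "F p e1 (cls m s0) t (of_real x) = (\<Sum>E\<in>Pow V. F p e1 {s \<in> cls m s0. par m s = E} t (of_real x))"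
      unfolding F_def using finV finc
      by (intro sum.group[symmetric]) (auto simp: par_def)
    then show ?thesis by (simp add: sum_distrib_right sum_distrib_left FE del: mult_Suc)
  qed
  have K1: "1 \<le> K"
    unfolding K_def using x0 lnA by (auto intro!: sum_nonneg)
  define He where "He = height P Co W n (Suc m)"
  have zg: "zgold (real D * (P * Co * (2 ^ D * (2 * real n) ^ D * 2 ^ (Suc m * D)) * exp (W * (2 * real n)))) (g s)"
    if s: "s \<in> box" for s
  proof -
    have zt: "zgold (P * Co * (2 ^ D * (2 * real n) ^ D * 2 ^ (Suc m * D)) * exp (W * (2 * real n)))
      (of_int (p d s * coef t s) * real (Z d) * (\<Prod>i\<in>V. a i ^ \<nu> s i))" if d: "d < D" for d
    proof -
      have "\<bar>real_of_int (p d s)\<bar> * \<bar>real_of_int (coef t s)\<bar> \<le> P * Co"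
        using P[OF d s] Co[OF s] nn by (intro mult_mono) auto
      then have 1: "zgold (P * Co) (of_int (p d s * coef t s))"
        by (intro zgold_of_int) (simp add: abs_mult)
      have 2: "zgold (2 ^ D * (2 * real n) ^ D * 2 ^ (Suc m * D)) (real (Z d))"
      proof -
        have "(d choose \<tau>) \<le> 2 ^ d" by (rule binomial_le_pow2)
        also have "(2::nat) ^ d \<le> 2 ^ D" using d by (intro power_increasing) auto
        finally have c1: "(d choose \<tau>) \<le> 2 ^ D" .
        have n1: "1 \<le> 2 * n" using l by (auto simp: odds_def)
        have "l ^ (d - \<tau>) \<le> (2 * n) ^ (d - \<tau>)" using l by (intro power_mono) (auto simp: odds_def)
        also have "\<dots> \<le> (2 * n) ^ D" using d n1 by (intro power_increasing) auto
        finally have c2: "l ^ (d - \<tau>) \<le> (2 * n) ^ D" .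
        have c3: "(2::nat) ^ (Suc m * (D - (d - \<tau>))) \<le> 2 ^ (Suc m * D)"
          by (intro power_increasing mult_le_mono2) auto
        have "Z d \<le> 2 ^ D * (2 * n) ^ D * 2 ^ (Suc m * D)"
          unfolding Z_def by (intro mult_le_mono c1 c2 c3)
        then have "real (Z d) \<le> real (2 ^ D * (2 * n) ^ D * 2 ^ (Suc m * D))"
          by (rule of_nat_mono)
        then have "\<bar>real_of_int (int (Z d))\<bar> \<le> 2 ^ D * (2 * real n) ^ D * 2 ^ (Suc m * D)" by simp
        then have "zgold (2 ^ D * (2 * real n) ^ D * 2 ^ (Suc m * D)) (of_int (int (Z d)))"
          by (rule zgold_of_int)
        then show ?thesis by simp
      qed
      have 3: "zgold (exp (W * (2 * real n))) (\<Prod>i\<in>V. a i ^ \<nu> s i)"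
      proof (rule zgold_mono)
        show "zgold (\<Prod>i\<in>V. A i ^ \<nu> s i) (\<Prod>i\<in>V. a i ^ \<nu> s i)"
          by (intro zgold_prod zgold_power zA)
        have "(\<Prod>i\<in>V. A i ^ \<nu> s i) = exp (\<Sum>i\<in>V. real (\<nu> s i) * ln (A i))"
          unfolding exp_sum[OF finV] using A1
          by (intro prod.cong refl) (simp add: exp_of_nat_mult less_le_trans[OF zero_less_one])
        also have "(\<Sum>i\<in>V. real (\<nu> s i) * ln (A i)) \<le> (\<Sum>i\<in>V. 2 * real n * (real (s i) * ln (A i)))"
        proof (rule sum_mono)
          fix i assume i: "i \<in> V"
          have "\<nu> s i \<le> s i div 2 ^ m * l" unfolding \<nu>_def by simp
          also have "\<dots> \<le> s i * l" by (intro mult_le_mono1) simp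
          finally have "real (\<nu> s i) \<le> real (s i * l)" by (rule of_nat_mono)
          also have "\<dots> \<le> real (s i) * (2 * real n)" using ln by (simp add: mult_left_mono)
          finally show "real (\<nu> s i) * ln (A i) \<le> 2 * real n * (real (s i) * ln (A i))"
            using lnA[OF i] mult_right_mono[of "real (\<nu> s i)" "real (s i) * (2 * real n)" "ln (A i)"]
            by (simp add: mult_ac)
        qed
        also have "\<dots> = 2 * real n * (\<Sum>i\<in>V. real (s i) * ln (A i))" by (simp add: sum_distrib_left)
        also have "\<dots> \<le> 2 * real n * W" using W[OF s] by (intro mult_left_mono) auto
        finally show "(\<Prod>i\<in>V. A i ^ \<nu> s i) \<le> exp (W * (2 * real n))" by (simp add: mult.commute)
      qed
      show ?thesis using zgold_mult[OF zgold_mult[OF 1 2] 3] .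
    qed
    have "zgold (\<Sum>d<D. P * Co * (2 ^ D * (2 * real n) ^ D * 2 ^ (Suc m * D)) * exp (W * (2 * real n))) (g s)"
      unfolding g_def using zt by (intro zgold_sum) simp
    then show ?thesis by simp
  qed
  have zu: "zgold He (u E)" for E
  proof (rule zgold_mono)
    let ?B = "real D * (P * Co * (2 ^ D * (2 * real n) ^ D * 2 ^ (Suc m * D)) * exp (W * (2 * real n)))"
    show "zgold (\<Sum>s\<in>{s \<in> cls m s0. par m s = E}. ?B) (u E)"
      unfolding u_def using zg by (intro zgold_sum) (auto simp: cls_def)
    have "(\<Sum>s\<in>{s \<in> cls m s0. par m s = E}. ?B) = real (card {s \<in> cls m s0. par m s = E}) * ?B"
      by simp
    also have "\<dots> \<le> real (card box) * ?B"
      using nn finite_box by (intro mult_right_mono of_nat_mono card_mono mult_nonneg_nonneg)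
        (auto simp: cls_def)
    finally show "(\<Sum>s\<in>{s \<in> cls m s0. par m s = E}. ?B) \<le> He"
      unfolding He_def height_def by (simp add: mult.assoc)
  qed
  have "u E = 0" if "E \<subseteq> V" for E
  proof (rule ccontr)
    assume nz: "u E \<noteq> 0"
    have AV: "\<forall>v\<in>V. 0 \<le> A v \<and> 0 < a v \<and> zgold ((A v)\<^sup>2) (a v)"
    proof
      fix v assume v: "v \<in> V"
      have "A v * 1 \<le> A v * A v" using A1[OF v] by (intro mult_left_mono) auto
      then have "zgold ((A v)\<^sup>2) (a v)" by (intro zgold_mono[OF zA[OF v]]) (simp add: power2_eq_square)
      then show "0 \<le> A v \<and> 0 < a v \<and> zgold ((A v)\<^sup>2) (a v)" using A1[OF v] a1[OF v] by auto
    qed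
    have He0: "0 \<le> He" using zu zgold_nonneg by blast
    have "1 \<le> \<bar>\<Sum>E\<in>Pow V. u E * (\<Prod>v\<in>E. sqrt (a v))\<bar> *
        (\<Sum>E\<in>Pow V. He * prod A E) ^ (2 ^ Suc (card V) - 1)"
      by (rule sqrt_sum_lower[where u = u and E = E, OF indep finV AV]) (use zu that nz in auto)
    also have "\<dots> \<le> (cmod (F p e1 (cls m s0) t (of_real x)) * 2 ^ (Suc m * D)) *
        (2 ^ card V * He * prod A V) ^ (2 ^ Suc (card V) - 1)"
    proof (intro mult_mono power_mono)
      have "1 * \<bar>\<Sum>E\<in>Pow V. u E * (\<Prod>v\<in>E. sqrt (a v))\<bar> \<le> K * \<bar>\<Sum>E\<in>Pow V. u E * (\<Prod>v\<in>E. sqrt (a v))\<bar>"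
        using K1 by (intro mult_right_mono) auto
      also have "\<dots> = cmod (of_real (K * (\<Sum>E\<in>Pow V. u E * (\<Prod>v\<in>E. sqrt (a v)))))"
        using K1 unfolding norm_of_real by (simp add: abs_mult)
      also have "\<dots> = cmod (F p e1 (cls m s0) t (of_real x)) * 2 ^ (Suc m * D)"
        unfolding sumE[symmetric] by (simp add: norm_mult norm_power)
      finally show "\<bar>\<Sum>E\<in>Pow V. u E * (\<Prod>v\<in>E. sqrt (a v))\<bar>
        \<le> cmod (F p e1 (cls m s0) t (of_real x)) * 2 ^ (Suc m * D)" by simp
      have "prod A E \<le> prod A V" if "E \<in> Pow V" for E
        using that finV A1 by (intro prod_mono2) (auto intro: order_trans[OF zero_le_one])
      then have "(\<Sum>E\<in>Pow V. He * prod A E) \<le> (\<Sum>E\<in>Pow V. He * prod A V)"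
        using He0 by (intro sum_mono mult_left_mono) auto
      then show "(\<Sum>E\<in>Pow V. He * prod A E) \<le> 2 ^ card V * He * prod A V"
        using finV by (simp add: card_Pow mult.assoc)
      show sn: "0 \<le> (\<Sum>E\<in>Pow V. He * prod A E)"
        using He0 A1 by (intro sum_nonneg mult_nonneg_nonneg prod_nonneg)
          (auto intro: order_trans[OF zero_le_one])
      then show "0 \<le> (\<Sum>E\<in>Pow V. He * prod A E) ^ (2 ^ Suc (card V) - 1)" by simp
    qed auto
    also have "\<dots> < 1" using small unfolding He_def x_def .
    finally show False by simp
  qed
  then have "F p e1 {s \<in> cls m s0. par m s = par m s0} t (of_real x) * 2 ^ (Suc m * D) = 0"
    unfolding FE by (simp add: par_def)
  then show ?thesis unfolding cls_Suc x_def by (simp del: mult_Suc)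
qed

end

section \<open>Construction of the auxiliary function and conclusion of the descent\<close>

lemma zgold_coords:
  assumes "\<And>e u. e \<in> E \<Longrightarrow> u \<in> U \<Longrightarrow> zgold (real X) (f e u)"
  shows "\<exists>x y :: 'e \<Rightarrow> 'u \<Rightarrow> int. \<forall>e\<in>E. \<forall>u\<in>U. f e u = of_int (x e u) + of_int (y e u) * golden \<and>
    \<bar>x e u\<bar> \<le> int X \<and> \<bar>y e u\<bar> \<le> int X"
proof -
  have "\<exists>xy :: int \<times> int. f e u = of_int (fst xy) + of_int (snd xy) * golden \<and>
    \<bar>fst xy\<bar> \<le> int X \<and> \<bar>snd xy\<bar> \<le> int X" if "e \<in> E" "u \<in> U" for e u
  proof -
    from assms[OF that] obtain x y :: int where xy: "f e u = of_int x + of_int y * golden"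
      "\<bar>real_of_int x\<bar> + 2 * \<bar>real_of_int y\<bar> \<le> real X"
      unfolding zgold_def by blast
    have "real_of_int \<bar>x\<bar> \<le> real_of_int (int X)" "real_of_int \<bar>y\<bar> \<le> real_of_int (int X)"
      using xy(2) by auto
    then have "\<bar>x\<bar> \<le> int X" "\<bar>y\<bar> \<le> int X" by (simp_all only: of_int_le_iff)
    then show ?thesis using xy(1) by (intro exI[of _ "(x, y)"]) simp
  qed
  then obtain xy where xy: "\<And>e u. e \<in> E \<Longrightarrow> u \<in> U \<Longrightarrow>
      f e u = of_int (fst (xy e u)) + of_int (snd (xy e u)) * golden \<and>
      \<bar>fst (xy e u)\<bar> \<le> int X \<and> \<bar>snd (xy e u)\<bar> \<le> int X"
    by metis
  show ?thesis
    by (intro exI[of _ "\<lambda>e u. fst (xy e u)"] exI[of _ "\<lambda>e u. snd (xy e u)"]) (use xy in blast)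
qed

text \<open>Each equation is split into its coordinates with respect to 1 and \<open>golden\<close>;
  this doubles the number of equations, whence the factor 4 instead of 2.\<close>

lemma siegel_zgold:
  fixes f :: "'e \<Rightarrow> 'u \<Rightarrow> real"
  assumes fin: "finite E" "finite U" and U: "U \<noteq> {}" and X: "1 \<le> X"
    and f: "\<And>e u. e \<in> E \<Longrightarrow> u \<in> U \<Longrightarrow> zgold (real X) (f e u)"
    and card: "4 * card E \<le> card U"
  shows "\<exists>p :: 'u \<Rightarrow> int. (\<exists>u\<in>U. p u \<noteq> 0) \<and> (\<forall>u\<in>U. \<bar>p u\<bar> \<le> int (card U * X)) \<and>
    (\<forall>e\<in>E. (\<Sum>u\<in>U. of_int (p u) * f e u) = 0)"
proof -
  obtain x y :: "'e \<Rightarrow> 'u \<Rightarrow> int" where xy: "\<And>e u. e \<in> E \<Longrightarrow> u \<in> U \<Longrightarrow>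
      f e u = of_int (x e u) + of_int (y e u) * golden \<and> \<bar>x e u\<bar> \<le> int X \<and> \<bar>y e u\<bar> \<le> int X"
    using zgold_coords[of E U X f] f by blast
  define c where "c eb u = (if snd eb then x (fst eb) u else y (fst eb) u)" for eb :: "'e \<times> bool" and u
  have "\<exists>p :: 'u \<Rightarrow> int. (\<exists>u\<in>U. p u \<noteq> 0) \<and> (\<forall>u\<in>U. \<bar>p u\<bar> \<le> int (card U * X)) \<and>
    (\<forall>eb\<in>E \<times> UNIV. (\<Sum>u\<in>U. c eb u * p u) = 0)"
    using fin U X card xy by (intro siegel) (auto simp: c_def card_cartesian_product)
  then obtain p :: "'u \<Rightarrow> int" where p: "\<exists>u\<in>U. p u \<noteq> 0" "\<forall>u\<in>U. \<bar>p u\<bar> \<le> int (card U * X)"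
    "\<And>e b. e \<in> E \<Longrightarrow> (\<Sum>u\<in>U. c (e, b) u * p u) = 0" by blast
  have "(\<Sum>u\<in>U. of_int (p u) * f e u) = 0" if e: "e \<in> E" for e
  proof -
    have "(\<Sum>u\<in>U. of_int (p u) * f e u)
        = (\<Sum>u\<in>U. of_int (c (e, True) u * p u) + of_int (c (e, False) u * p u) * golden)"
      using xy e by (intro sum.cong refl) (simp add: c_def algebra_simps)
    also have "\<dots> = of_int (\<Sum>u\<in>U. c (e, True) u * p u) + of_int (\<Sum>u\<in>U. c (e, False) u * p u) * golden"
      by (simp add: sum.distrib sum_distrib_right)
    also have "\<dots> = 0" using p(3)[OF e, of True] p(3)[OF e, of False] by simp
    finally show ?thesis .
  qed
  then show ?thesis using p(1,2) by blast
qed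

context log_form
begin

text \<open>At integers the exponentials are products of powers of the \<open>a i\<close>, so the
  conditions are linear equations over Z[golden]. Only the entries of \<open>u\<close> on
  \<open>V\<close> matter, which leaves \<open>n * T ^ card V\<close> equations for
  \<open>D * card box\<close> unknowns.\<close>

lemma auxiliary_function:
  assumes Co: "\<And>u s. \<forall>i\<in>V. u i < T \<Longrightarrow> s \<in> box \<Longrightarrow> \<bar>of_int (coef u s)\<bar> \<le> Co"
    and W: "\<And>s. s \<in> box \<Longrightarrow> (\<Sum>i\<in>V. real (s i) * ln (A i)) \<le> W"
    and X: "Co * (2 ^ D * (2 * real n) ^ D) * exp (W * (2 * real n)) \<le> real X" "1 \<le> X"
    and card: "4 * (n * T ^ card V) \<le> D * card box" and D: "1 \<le> D" and Co0: "0 \<le> Co"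
  shows "\<exists>p. (\<exists>d<D. \<exists>s\<in>box. p d s \<noteq> 0) \<and>
    (\<forall>d<D. \<forall>s\<in>box. \<bar>p d s\<bar> \<le> int (D * card box * X)) \<and>
    (\<forall>l\<in>odds n. \<forall>u. (\<forall>i\<in>V. u i < T) \<longrightarrow> F p e1 box u (of_nat l) = 0)"
proof -
  let ?U = "{..<D} \<times> box" and ?E = "odds n \<times> PiE V (\<lambda>_. {..<T})"
  define f where "f lt ds = of_int (coef (snd lt) (snd ds)) *
    (real (fst ds choose snd lt v0) * real (fst lt) ^ (fst ds - snd lt v0)) *
    (\<Prod>i\<in>V. (a i ^ snd ds i) ^ fst lt)" for lt :: "nat \<times> ('i \<Rightarrow> nat)" and ds :: "nat \<times> ('i \<Rightarrow> nat)"
  have zf: "zgold (real X) (f (l, u) (d, s))"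
    if l: "l \<in> odds n" and u: "\<forall>i\<in>V. u i < T" and d: "d < D" and s: "s \<in> box" for l u d s
  proof (rule zgold_mono[OF _ X(1)])
    have ln: "l < 2 * n" "1 \<le> 2 * n" using l by (auto simp: odds_def)
    have 1: "zgold Co (of_int (coef u s))" using Co[OF u s] by (rule zgold_of_int)
    have 2: "zgold (2 ^ D * (2 * real n) ^ D) (real (d choose u v0) * real l ^ (d - u v0))"
    proof -
      have "(d choose u v0) \<le> 2 ^ d" by (rule binomial_le_pow2)
      also have "(2::nat) ^ d \<le> 2 ^ D" using d by (intro power_increasing) auto
      finally have c1: "(d choose u v0) \<le> 2 ^ D" .
      have "l ^ (d - u v0) \<le> (2 * n) ^ (d - u v0)" using ln by (intro power_mono) auto
      also have "\<dots> \<le> (2 * n) ^ D" using d ln by (intro power_increasing) auto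
      finally have "(d choose u v0) * l ^ (d - u v0) \<le> 2 ^ D * (2 * n) ^ D"
        by (intro mult_le_mono c1)
      then have "real ((d choose u v0) * l ^ (d - u v0)) \<le> real (2 ^ D * (2 * n) ^ D)"
        by (rule of_nat_mono)
      then have "zgold (2 ^ D * (2 * real n) ^ D) (of_int (int ((d choose u v0) * l ^ (d - u v0))))"
        by (intro zgold_of_int) simp
      then show ?thesis by simp
    qed
    have 3: "zgold (exp (W * (2 * real n))) (\<Prod>i\<in>V. (a i ^ s i) ^ l)"
    proof (rule zgold_mono)
      show "zgold (\<Prod>i\<in>V. (A i ^ s i) ^ l) (\<Prod>i\<in>V. (a i ^ s i) ^ l)"
        by (intro zgold_prod zgold_power zA)
      have "(\<Prod>i\<in>V. (A i ^ s i) ^ l) = (\<Prod>i\<in>V. A i ^ s i) ^ l" by (simp add: prod_power_distrib)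
      also have "(\<Prod>i\<in>V. A i ^ s i) = exp (\<Sum>i\<in>V. real (s i) * ln (A i))"
        unfolding exp_sum[OF finV] using A1
        by (intro prod.cong refl) (simp add: exp_of_nat_mult less_le_trans[OF zero_less_one])
      also have "\<dots> ^ l = exp (real l * (\<Sum>i\<in>V. real (s i) * ln (A i)))"
        by (simp add: exp_of_nat_mult)
      also have "real l * (\<Sum>i\<in>V. real (s i) * ln (A i)) \<le> (2 * real n) * W"
      proof (intro mult_mono)
        have "0 \<le> ln (A i)" if "i \<in> V" for i using lnA[OF that] by linarith
        then show "0 \<le> (\<Sum>i\<in>V. real (s i) * ln (A i))" by (intro sum_nonneg) simp
      qed (use ln W[OF s] in auto)
      finally show "(\<Prod>i\<in>V. (A i ^ s i) ^ l) \<le> exp (W * (2 * real n))" by (simp add: mult.commute)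
    qed
    show "zgold (Co * (2 ^ D * (2 * real n) ^ D) * exp (W * (2 * real n))) (f (l, u) (d, s))"
      unfolding f_def using zgold_mult[OF zgold_mult[OF 1 2] 3] by simp
  qed
  have cardE: "card ?E = n * T ^ card V"
    using finV by (simp add: card_cartesian_product card_PiE)
  have "box \<noteq> {}" unfolding box_def by (simp add: PiE_eq_empty_iff)
  then have "\<exists>p :: nat \<times> ('i \<Rightarrow> nat) \<Rightarrow> int. (\<exists>u\<in>?U. p u \<noteq> 0) \<and> (\<forall>u\<in>?U. \<bar>p u\<bar> \<le> int (card ?U * X)) \<and>
    (\<forall>e\<in>?E. (\<Sum>u\<in>?U. of_int (p u) * f e u) = 0)"
  proof (intro siegel_zgold)
    show "finite ?E" using finV by (auto intro: finite_PiE)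
    show "4 * card ?E \<le> card ?U" unfolding cardE using card by (simp add: card_cartesian_product)
    show "?U \<noteq> {}" using D \<open>box \<noteq> {}\<close> by (auto simp: lessThan_empty_iff)
  qed (use finite_box D X zf in \<open>auto simp: PiE_iff\<close>)
  then obtain p :: "nat \<times> ('i \<Rightarrow> nat) \<Rightarrow> int" where p: "\<exists>u\<in>?U. p u \<noteq> 0"
    "\<And>u. u \<in> ?U \<Longrightarrow> \<bar>p u\<bar> \<le> int (card ?U * X)"
    "\<And>e. e \<in> ?E \<Longrightarrow> (\<Sum>u\<in>?U. of_int (p u) * f e u) = 0" by blast
  define p' where "p' d s = p (d, s)" for d s
  have van: "F p' e1 box u (of_nat l) = 0" if l: "l \<in> odds n" and u: "\<forall>i\<in>V. u i < T" for l u
  proof -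
    let ?u = "restrict u V"
    have "(l, ?u) \<in> ?E" using l u by auto
    then have z: "(\<Sum>ds\<in>?U. of_int (p ds) * f (l, ?u) ds) = 0" by (rule p(3))
    have cu: "coef ?u s = coef u s" for s unfolding coef_def by (rule prod.cong) auto
    have ex: "exp (of_nat l * of_real (e1 s)) = (of_real (\<Prod>i\<in>V. (a i ^ s i) ^ l) :: complex)" for s
    proof -
      have "exp (real l * e1 s) = (\<Prod>i\<in>V. (a i ^ s i) ^ l)"
        unfolding e1_def exp_of_nat_mult exp_sum[OF finV] prod_power_distrib
        using a1 by (intro prod.cong refl) (simp add: less_le_trans[OF zero_less_one])
      then show ?thesis by (metis exp_of_real of_real_mult of_real_of_nat_eq)
    qed
    have "F p' e1 box u (of_nat l) = (\<Sum>s\<in>box. \<Sum>d<D. of_real (of_int (p (d, s)) * f (l, ?u) (d, s)))"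
      unfolding F_def ex p'_def f_def using v0 cu
      by (intro sum.cong refl) (simp add: mult.assoc)
    also have "\<dots> = of_real (\<Sum>d<D. \<Sum>s\<in>box. of_int (p (d, s)) * f (l, ?u) (d, s))"
      unfolding of_real_sum by (rule sum.swap)
    also have "(\<Sum>d<D. \<Sum>s\<in>box. of_int (p (d, s)) * f (l, ?u) (d, s)) = (\<Sum>ds\<in>?U. of_int (p ds) * f (l, ?u) ds)"
      by (simp add: sum.cartesian_product)
    finally show ?thesis using z by simp
  qed
  show ?thesis
  proof (intro exI[of _ p'] conjI ballI allI impI)
    show "\<exists>d<D. \<exists>s\<in>box. p' d s \<noteq> 0" using p(1) by (auto simp: p'_def)
    show "\<bar>p' d s\<bar> \<le> int (D * card box * X)" if "d < D" "s \<in> box" for d s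
      using p(2)[of "(d, s)"] that by (simp add: p'_def card_cartesian_product)
  qed (use van in auto)
qed

text \<open>As \<open>c < 2 ^ m\<close>, the exponent of \<open>a v0\<close> is constant on the
  class, so \<open>wt i s\<close> depends on \<open>s i\<close> alone, and injectively.
  Multi-indices up to \<open>L\<close> then separate the exponent vectors, and what remains for
  \<open>s0\<close> is a polynomial in \<open>z\<close> of degree below \<open>D\<close> with zeros
  of order \<open>T\<close> at \<open>n\<close> points.\<close>

lemma F_vanish_imp_coefficient_0:
  assumes van: "\<And>l u. l \<in> odds n \<Longrightarrow> \<forall>i\<in>V. u i < T \<Longrightarrow> F p e1 (cls m s0) u (of_real (real l / 2 ^ m)) = 0"
    and s0: "s0 \<in> box" and c: "c < 2 ^ m" and LT: "L < T" and DT: "D \<le> n * T" and d: "d < D"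
  shows "p d s0 = 0"
proof -
  let ?Q = "cls m s0" and ?j = "s0 v0"
  let ?G = "PiE V1 (\<lambda>_. {..L})"
  have sv0: "s v0 = ?j" if "s \<in> ?Q" for s
  proof -
    have "s v0 \<le> c" "?j \<le> c" using that s0 v0 unfolding cls_def box_def by (auto simp: PiE_iff)
    moreover have "s v0 mod 2 ^ m = ?j mod 2 ^ m" using that v0 by (simp add: cls_def)
    ultimately show ?thesis using c by simp
  qed
  have z: "(\<Sum>d<D. of_int (p d s0) * (real (d choose \<tau>) * x ^ (d - \<tau>))) = 0"
    if \<tau>: "\<tau> < T" and l: "l \<in> odds n" and x: "x = real l / 2 ^ m" for \<tau> l x
  proof -
    define q where "q s = (\<Sum>d<D. of_int (p d s) * (real (d choose \<tau>) * x ^ (d - \<tau>))) * exp (x * e1 s)" for s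
    define q' where "q' \<sigma> = (if \<sigma>(v0 := ?j) \<in> ?Q then q (\<sigma>(v0 := ?j)) else 0)" for \<sigma>
    define w where "w i k = real_of_int (b v0 * int k + int ?j * b i)" for i k
    have Qx: "s \<in> extensional V" "\<And>i. i \<in> V1 \<Longrightarrow> s i \<le> L" if "s \<in> ?Q" for s
      using that unfolding cls_def box_def by (auto simp: PiE_iff)
    have rs: "(restrict s V1)(v0 := ?j) = s" if "s \<in> ?Q" for s
    proof
      fix i show "((restrict s V1)(v0 := ?j)) i = s i"
        using sv0[OF that] Qx(1)[OF that] by (auto simp: extensional_def)
    qed
    have "q' (restrict s0 V1) = 0"
    proof (rule grid_sum_eq_0[where I = V1 and w = w and L = L and q = q'])
      show "finite V1" using finV by simp
      show "inj_on (w i) {..L}" for i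
        using bv0 unfolding w_def inj_on_def by simp
      have "s0 \<in> ?Q" using s0 by (simp add: cls_def)
      then show "restrict s0 V1 \<in> ?G" using Qx(2)[of s0] by auto
      fix t assume t: "t \<in> ?G"
      define u where "u = t(v0 := \<tau>)"
      have u: "\<forall>i\<in>V. u i < T"
      proof
        fix i assume "i \<in> V"
        then show "u i < T"
          using PiE_mem[OF t, of i] \<tau> LT by (cases "i = v0") (auto simp: u_def)
      qed
      have co: "real_of_int (coef u s) = (\<Prod>i\<in>V1. w i (s i) ^ t i)" if "s \<in> ?Q" for s
        unfolding coef_def of_int_prod w_def wt_def sv0[OF that]
        by (intro prod.cong refl) (auto simp: u_def)
      have "0 = F p e1 ?Q u (of_real x)" using van[OF l u] x by simp
      also have "\<dots> = of_real (\<Sum>s\<in>?Q. q s * of_int (coef u s))"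
        unfolding F_def q_def
        by (simp add: u_def exp_of_real[symmetric] sum_distrib_right sum_distrib_left mult_ac)
      finally have "(\<Sum>s\<in>?Q. q s * of_int (coef u s)) = 0" by (metis of_real_eq_0_iff)
      then have "(\<Sum>s\<in>?Q. q s * (\<Prod>i\<in>V1. w i (s i) ^ t i)) = 0" using co by simp
      moreover have "(\<Sum>s\<in>?Q. q s * (\<Prod>i\<in>V1. w i (s i) ^ t i))
          = (\<Sum>\<sigma>\<in>{\<sigma>\<in>?G. \<sigma>(v0 := ?j) \<in> ?Q}. q' \<sigma> * (\<Prod>i\<in>V1. w i (\<sigma> i) ^ t i))"
      proof (rule sum.reindex_bij_witness[where i = "\<lambda>\<sigma>. \<sigma>(v0 := ?j)" and j = "\<lambda>s. restrict s V1"])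
        show "restrict s V1 \<in> {\<sigma>\<in>?G. \<sigma>(v0 := ?j) \<in> ?Q}" if "s \<in> ?Q" for s
          using Qx[OF that] rs[OF that] that by auto
        show "restrict (\<sigma>(v0 := ?j)) V1 = \<sigma>" if "\<sigma> \<in> {\<sigma>\<in>?G. \<sigma>(v0 := ?j) \<in> ?Q}" for \<sigma>
          using that by (auto simp: PiE_iff extensional_def restrict_def fun_eq_iff)
        show "q' (restrict s V1) * (\<Prod>i\<in>V1. w i (restrict s V1 i) ^ t i)
            = q s * (\<Prod>i\<in>V1. w i (s i) ^ t i)" if "s \<in> ?Q" for s
          using that rs[OF that] by (simp add: q'_def)
      qed (use rs in auto)
      moreover have "\<dots> = (\<Sum>\<sigma>\<in>?G. q' \<sigma> * (\<Prod>i\<in>V1. w i (\<sigma> i) ^ t i))"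
        using finV by (intro sum.mono_neutral_left) (auto simp: q'_def intro: finite_PiE)
      ultimately show "(\<Sum>\<sigma>\<in>?G. q' \<sigma> * (\<Prod>i\<in>V1. w i (\<sigma> i) ^ t i)) = 0" by simp
    qed
    moreover have "s0 \<in> ?Q" using s0 by (simp add: cls_def)
    ultimately have "q s0 = 0" unfolding q'_def rs[OF \<open>s0 \<in> ?Q\<close>] by simp
    then show ?thesis by (simp add: q_def)
  qed
  have "real_of_int (p d s0) = 0"
  proof (rule hasse_derivatives_eq_0[where Z = "(\<lambda>l. real l / 2 ^ m) ` odds n" and T = T and D = D
        and p = "\<lambda>d. of_int (p d s0)"])
    have "card ((\<lambda>l. real l / 2 ^ m) ` odds n) = n"
      by (subst card_image) (auto simp: inj_on_def)
    then show "D \<le> card ((\<lambda>l. real l / 2 ^ m) ` odds n) * T" using DT by simp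
  qed (use z d in auto)
  then show ?thesis by simp
qed

text \<open>Each halving gives away \<open>T'\<close> orders of vanishing. Of the initial
  \<open>2 * J * T'\<close> orders, \<open>J * T'\<close> are left when the denominator reaches
  \<open>2 ^ J\<close> and the exponent of \<open>a v0\<close> is frozen; these already force a
  coefficient that is nonzero to vanish.\<close>

lemma linear_form_contradiction:
  assumes Co: "\<And>u s. \<forall>i\<in>V. u i < 2 * J * T' \<Longrightarrow> s \<in> box \<Longrightarrow> \<bar>of_int (coef u s)\<bar> \<le> Co"
    and W: "\<And>s. s \<in> box \<Longrightarrow> (\<Sum>i\<in>V. real (s i) * ln (A i)) \<le> W"
    and X: "Co * (2 ^ D * (2 * real n) ^ D) * exp (W * (2 * real n)) \<le> real X" "1 \<le> X"
    and card: "4 * (n * (2 * J * T') ^ card V) \<le> D * card box" and D: "1 \<le> D" and Co0: "0 \<le> Co"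
    and n: "1 \<le> n" and Lam: "66 * real n * (real c * \<bar>Lam\<bar>) \<le> 1" and T': "0 < T'"
    and c: "c < 2 ^ J" and LT: "L < J * T'" and DT: "D \<le> n * (J * T')"
    and P: "P = real (D * card box * X)"
    and small: "majorant P Co W n * gain n (2 * J * T') T' * 2 ^ (J * D) *
      (2 ^ card V * height P Co W n J * prod A V) ^ (2 ^ Suc (card V) - 1) < 1"
  shows False
proof -
  obtain p d0 s0 where p: "d0 < D" "s0 \<in> box" "p d0 s0 \<noteq> 0"
    "\<And>d s. d < D \<Longrightarrow> s \<in> box \<Longrightarrow> \<bar>p d s\<bar> \<le> int (D * card box * X)"
    "\<And>l u. l \<in> odds n \<Longrightarrow> \<forall>i\<in>V. u i < 2 * J * T' \<Longrightarrow> F p e1 box u (of_nat l) = 0"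
    using auxiliary_function[OF Co W X card D Co0] by blast
  have pP: "\<bar>of_int (p d s)\<bar> \<le> P" if "d < D" "s \<in> box" for d s
    using p(4)[OF that] unfolding P by (metis of_int_abs of_int_le_iff of_int_of_nat_eq)
  have P0: "0 \<le> P" by (simp add: P)
  have W1: "\<bar>e1 s\<bar> \<le> W" if s: "s \<in> box" for s
  proof -
    have "0 \<le> e1 s" unfolding e1_def using lnA by (auto intro!: sum_nonneg)
    moreover have "e1 s \<le> (\<Sum>i\<in>V. real (s i) * ln (A i))"
      unfolding e1_def using lnA by (intro sum_mono mult_left_mono) auto
    ultimately show ?thesis using W[OF s] by linarith
  qed
  have AV: "0 \<le> prod A V" using A1 by (intro prod_nonneg) (auto intro: order_trans[OF zero_le_one])
  have van: "F p e1 (cls m s0) u (of_real (real l / 2 ^ m)) = 0"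
    if "m \<le> J" "l \<in> odds n" "\<forall>i\<in>V. u i < 2 * J * T' - m * T'" for m l u
    using that
  proof (induction m arbitrary: l u)
    case 0
    have "cls 0 s0 = box" by (auto simp: cls_def)
    then show ?case using p(5) 0 by simp
  next
    case (Suc m)
    let ?T = "2 * J * T' - m * T'"
    have u: "\<forall>i\<in>V. u i + T' \<le> ?T"
    proof
      fix i assume "i \<in> V"
      then have "u i < 2 * J * T' - Suc m * T'" using Suc.prems by auto
      then show "u i + T' \<le> ?T" by simp
    qed
    have uJ: "\<forall>i\<in>V. u i < 2 * J * T'" using u T' by fastforce
    let ?y = "F p e1 (cls m s0) u (of_real (real l / 2 ^ Suc m))"
    have "cmod ?y \<le> majorant P Co W n * gain n ?T T'"
    proof (rule F_extrapolate)
      show "cls m s0 \<subseteq> box" by (auto simp: cls_def)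
      show "\<bar>of_int (coef u s)\<bar> \<le> Co" if "\<forall>i\<in>V. u i < ?T" "s \<in> box" for u s
      proof (rule Co)
        show "\<forall>i\<in>V. u i < 2 * J * T'" using that(1) by fastforce
      qed (rule that(2))
    qed (use pP W1 P0 Co0 n Lam Suc u T' in auto)
    also have "\<dots> \<le> majorant P Co W n * gain n (2 * J * T') T'"
    proof (rule mult_left_mono)
      show "gain n ?T T' \<le> gain n (2 * J * T') T'"
      proof -
        have "real ?T \<le> real (2 * J * T')" by (intro of_nat_mono) simp
        then show ?thesis unfolding gain_def
          by (intro add_right_mono mult_right_mono mult_left_mono) (simp_all del: of_nat_mult)
      qed
      show "0 \<le> majorant P Co W n" unfolding majorant_def using P0 Co0 by simp
    qed
    finally have y: "cmod ?y \<le> majorant P Co W n * gain n (2 * J * T') T'" .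
    have h: "height P Co W n (Suc m) \<le> height P Co W n J" "0 \<le> height P Co W n (Suc m)"
    proof -
      have "(2::real) ^ (Suc m * D) \<le> 2 ^ (J * D)"
        using Suc.prems by (intro power_increasing mult_le_mono1) auto
      then show "height P Co W n (Suc m) \<le> height P Co W n J" unfolding height_def
        using P0 Co0 by (intro mult_left_mono mult_right_mono mult_nonneg_nonneg) auto
    qed (use P0 Co0 in \<open>simp add: height_def\<close>)
    show ?case
    proof (rule F_cls_Suc_eq_0)
      have "cmod ?y * 2 ^ (Suc m * D) *
          (2 ^ card V * height P Co W n (Suc m) * prod A V) ^ (2 ^ Suc (card V) - 1)
        \<le> majorant P Co W n * gain n (2 * J * T') T' * 2 ^ (J * D) *
          (2 ^ card V * height P Co W n J * prod A V) ^ (2 ^ Suc (card V) - 1)"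
        using y h AV Suc.prems(1)
        by (intro mult_mono power_mono power_increasing mult_le_mono1 mult_nonneg_nonneg
            zero_le_power order_trans[OF norm_ge_zero y]) (auto simp del: mult_Suc)
      then show "cmod ?y * 2 ^ (Suc m * D) *
          (2 ^ card V * height P Co W n (Suc m) * prod A V) ^ (2 ^ Suc (card V) - 1) < 1"
        using small by linarith
      show "\<bar>of_int (coef u s)\<bar> \<le> Co" if "s \<in> box" for s using Co[OF uJ that] .
    qed (use pP W P0 Co0 Suc.prems in auto)
  qed
  have "p d0 s0 = 0"
  proof (rule F_vanish_imp_coefficient_0[where m = J and T = "J * T'" and n = n])
    show "F p e1 (cls J s0) u (of_real (real l / 2 ^ J)) = 0"
      if "l \<in> odds n" "\<forall>i\<in>V. u i < J * T'" for l u
      using van[of J l u] that by (simp add: algebra_simps)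
  qed (use p c LT DT in auto)
  then show False using p(3) by simp
qed

end

section \<open>A lower bound for linear forms in logarithms\<close>

lemma le_exp_mult: "0 \<le> x \<Longrightarrow> 0 \<le> y \<Longrightarrow> x \<le> exp p \<Longrightarrow> y \<le> exp q \<Longrightarrow> x * y \<le> exp (p + q)" for x y :: real
  unfolding exp_add by (intro mult_mono) auto

lemma le_exp_of_nat: "real n \<le> exp (real n)"
  using exp_ge_add_one_self[of "real n"] by linarith

context log_form
begin

lemma card_box: "card box = (c + 1) * (L + 1) ^ (card V - 1)"
proof -
  have "card box = (\<Prod>i\<in>V. card {..(if i = v0 then c else L)})"
    unfolding box_def using finV by (rule card_PiE)
  also have "\<dots> = (c + 1) * (\<Prod>i\<in>V1. card {..(if i = v0 then c else L)})"
    using finV v0 by (simp add: prod.remove)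
  also have "(\<Prod>i\<in>V1. card {..(if i = v0 then c else L)}) = (\<Prod>i\<in>V1. L + 1)"
    by (rule prod.cong) auto
  also have "\<dots> = (L + 1) ^ (card V - 1)" using finV v0 by simp
  finally show ?thesis .
qed

text \<open>With \<open>n = J\<^sup>2 h\<close> points and orders up to \<open>T = 2 J\<^sup>2 L\<close>, each of the \<open>J\<close> descent steps gains
  \<open>n J L\<close>; the derivatives, the exponentials and the powers of \<open>z\<close> cost at most \<open>h T\<close>, \<open>L n\<close>
  and \<open>D J\<close> up to constants, which \<open>J\<close> dominates.  The size of \<open>c\<close> is what Siegel's lemma needs.\<close>

lemma linear_form_lower_aux:
  fixes r G M h J B :: nat
  assumes r: "card V = Suc r"
    and AG: "\<And>i. i \<in> V1 \<Longrightarrow> A i \<le> exp (real G)" and AM: "A v0 \<le> exp (real M)"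
    and B: "\<And>i. i \<in> V \<Longrightarrow> \<bar>b i\<bar> \<le> int B" and M: "1 \<le> M" and G: "1 \<le> G" and h: "1 \<le> h"
    and c: "c = J ^ (3 * r + 4)" and L: "L = c * M" and D: "D = 2 * h * (J * L)"
    and hB: "ln (2 * real L * real B) \<le> real h" and Jh: "ln (real h) \<le> real J"
    and J: "160 * 2 ^ (r + 2) * (r * G + 2) \<le> J" and J2: "J ^ (3 * r + 4) < 2 ^ J"
  shows "exp (- real (J ^ (3 * r + 9) * h * M)) < \<bar>Lam\<bar>"
proof (rule ccontr)
  assume "\<not> exp (- real (J ^ (3 * r + 9) * h * M)) < \<bar>Lam\<bar>"
  then have LamZ: "\<bar>Lam\<bar> \<le> exp (- real (J ^ (3 * r + 9) * h * M))" by simp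
  define n where "n = J ^ 2 * h"
  define T' where "T' = J * L"
  define Q where "Q = r * G + 2"
  \<comment> \<open>The unit in which all logarithmic sizes are measured: \<open>n * L = y\<close>
    and \<open>J * D = 2 * y\<close>, while the number \<open>n * T'\<close> of zeros is
    \<open>J * y\<close>.\<close>
  define y where "y = real J * (real h * real T')"
  have J1280: "1280 \<le> J"
  proof -
    have "160 * 2 ^ 2 * 2 \<le> 160 * 2 ^ (r + 2) * (r * G + 2)"
      by (intro mult_le_mono power_increasing) auto
    then show ?thesis using J by simp
  qed
  then have J1: "1 \<le> J" by simp
  have c1: "1 \<le> c" unfolding c using J1 by simp
  have L1: "1 \<le> L" unfolding L using c1 M by simp
  have T1: "1280 \<le> T'" "L \<le> T'" "J \<le> T'" unfolding T'_def using J1280 L1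
    by (auto intro: order_trans[OF J1280])
  have cL: "c \<le> L" "M \<le> L" unfolding L using M c1 by auto
  have n1: "1 \<le> n" unfolding n_def using J1 h by simp
  have hr: "1 \<le> real h" using h by simp
  have B1: "1 \<le> B" using B[OF v0] bv0 by simp
  have y1: "1 \<le> y" "real h \<le> y" "real T' \<le> y" "real J \<le> y" "real h * real T' \<le> y"
      "real J * real T' \<le> y"
  proof -
    have a: "1 \<le> real J" "1 \<le> real h" "1 \<le> real T'" using J1 h T1 by auto
    have m: "x \<le> u * x" "x \<le> x * u" if "1 \<le> u" "0 \<le> x" for x u :: real
      using that mult_right_mono[of 1 u x] by (auto simp: mult.commute)
    show 5: "real h * real T' \<le> y" unfolding y_def using a by (intro m) auto
    show "real h \<le> y" using m(2)[of "real T'" "real h"] a 5 by linarith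
    show "real T' \<le> y" using m(1)[of "real h" "real T'"] a 5 by linarith
    then show "1 \<le> y" using a by linarith
    show "real J \<le> y" unfolding y_def using a mult_mono[of 1 "real h" 1 "real T'"] by (intro m) auto
    have "real J * (1 * real T') \<le> y" unfolding y_def using a by (intro mult_mono) auto
    then show "real J * real T' \<le> y" by simp
  qed
  have Q2: "2 \<le> real Q" "real r * real G + 2 = real Q" unfolding Q_def by auto
  have DE: "real D = 2 * (real h * real T')" unfolding D T'_def by simp
  have Jy: "real J * (real h * real T') = y" by (simp add: y_def)
  have nL: "real n * real L = y" unfolding n_def y_def T'_def by (simp add: power2_eq_square)
  define N where "N = n * T'"
  have nT: "real N = real J * y"
    unfolding N_def n_def y_def by (simp add: power2_eq_square)
  have rQ: "real r \<le> real Q" "real r * real G \<le> real Q"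
  proof -
    have "r \<le> Q" unfolding Q_def using mult_le_mono2[OF G, of r] by linarith
    then show "real r \<le> real Q" by simp
    show "real r * real G \<le> real Q" unfolding Q_def by simp
  qed
  have Qy: "y \<le> real Q * y / 2" "real Q \<le> real Q * y"
    using mult_right_mono[of 2 "real Q" y] mult_left_mono[of 1 y "real Q"] Q2 y1 by simp_all
  have lin: "exp (u * y) \<le> exp (v * y)" if "u \<le> v" for u v
    using that y1 by (simp add: mult_right_mono)
  have QJ: "160 * real Q * 2 ^ (r + 2) \<le> real J"
  proof -
    have "real (160 * 2 ^ (r + 2) * (r * G + 2)) \<le> real J" using J by (rule of_nat_mono)
    then show ?thesis unfolding Q_def by (simp add: algebra_simps)
  qed
  have J14: "real Q + 14 \<le> real J"
  proof -
    have "(2::real) ^ 2 \<le> 2 ^ (r + 2)" by (intro power_increasing) auto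
    then have "160 * real Q * 4 \<le> 160 * real Q * 2 ^ (r + 2)"
      by (intro mult_left_mono) auto
    then show ?thesis using QJ Q2 by linarith
  qed
  have LB: "2 * real L * real B \<le> exp (real h)"
  proof -
    have "exp (ln (2 * real L * real B)) \<le> exp (real h)" using hB by simp
    then show ?thesis using L1 B1 by simp
  qed
  have L2: "2 * real L \<le> exp (real h)"
  proof -
    have "2 * real L * 1 \<le> 2 * real L * real B" using B1 by (intro mult_left_mono) auto
    then show ?thesis using LB by linarith
  qed
  have n132: "132 * real n \<le> exp (4 * real J)"
  proof -
    have "real h \<le> exp (real J)" using Jh hr by (metis exp_ln exp_le_cancel_iff less_le_trans zero_less_one)
    moreover have "real J ^ 2 \<le> exp (real J) ^ 2" using le_exp_of_nat[of J] by (intro power_mono) auto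
    ultimately have "real n \<le> exp (real J) ^ 2 * exp (real J)" unfolding n_def
      by (auto intro!: mult_mono)
    also have "\<dots> = exp (3 * real J)" by (simp add: exp_of_nat_mult[symmetric] mult_exp_exp)
    finally have "real n \<le> exp (3 * real J)" .
    moreover have "132 \<le> exp (real J)"
      using exp_ge_add_one_self[of "real J"] of_nat_mono[OF J1280, where 'a = real]
      by (simp only: of_nat_numeral)
    ultimately have "132 * real n \<le> exp (real J) * exp (3 * real J)" by (intro mult_mono) auto
    then show ?thesis by (simp add: mult_exp_exp)
  qed
  have pow_n: "(w * real n) ^ k \<le> exp (4 * real J * real k)" if "0 \<le> w" "w \<le> 132" for w k
  proof -
    have "w * real n \<le> 132 * real n" using that by (intro mult_right_mono) auto
    then have "(w * real n) ^ k \<le> exp (4 * real J) ^ k"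
      using n132 that by (intro power_mono) auto
    then show ?thesis by (simp add: exp_of_nat_mult[symmetric] mult_ac)
  qed
  have powD: "2 ^ D * (w * real n) ^ D \<le> exp (8 * y)" if "0 \<le> w" "w \<le> 66" for w
  proof -
    have "2 ^ D * (w * real n) ^ D = (2 * w * real n) ^ D" by (simp add: power_mult_distrib mult_ac)
    also have "\<dots> \<le> exp (4 * real J * real D)" using that by (intro pow_n) auto
    also have "4 * real J * real D = 8 * y" unfolding DE by (simp add: y_def)
    finally show ?thesis .
  qed
  have pow2: "2 ^ k \<le> exp (real k)" for k
    using power_mono[of 2 "exp 1 :: real" k] exp_ge_add_one_self[of "1::real"]
    by (simp add: exp_of_nat_mult[symmetric])
  have pJD: "2 ^ (J * D) \<le> exp (2 * y)"
    using pow2[of "J * D"] by (simp add: DE y_def mult_ac)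
  define Co where "Co = exp (2 * real r * y)"
  have Co: "\<bar>of_int (coef u s)\<bar> \<le> Co" if u: "\<forall>i\<in>V. u i < 2 * J * T'" and s: "s \<in> box" for u s
  proof -
    have sv: "s v0 \<le> L" using s v0 cL unfolding box_def by (auto simp: PiE_iff)
    have wt: "\<bar>real_of_int (wt i s)\<bar> \<le> exp (real h)" if i: "i \<in> V1" for i
    proof -
      have si: "s i \<le> L" using s i unfolding box_def by (auto simp: PiE_iff)
      have "\<bar>wt i s\<bar> \<le> \<bar>b v0 * int (s i)\<bar> + \<bar>int (s v0) * b i\<bar>"
        unfolding wt_def by (rule abs_triangle_ineq)
      also have "\<dots> \<le> int B * int L + int L * int B"
        unfolding abs_mult using B[OF v0] B[of i] i si sv by (intro add_mono mult_mono) auto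
      also have "\<dots> = int (2 * L * B)" by simp
      finally have "\<bar>real_of_int (wt i s)\<bar> \<le> real (2 * L * B)"
        by (metis of_int_abs of_int_le_iff of_int_of_nat_eq)
      then show ?thesis using LB by simp
    qed
    have "\<bar>real_of_int (coef u s)\<bar> = (\<Prod>i\<in>V1. \<bar>real_of_int (wt i s)\<bar> ^ u i)"
      unfolding coef_def by (simp add: abs_prod power_abs)
    also have "\<dots> \<le> (\<Prod>i\<in>V1. exp (real h * real (2 * J * T')))"
    proof (rule prod_mono, rule conjI)
      fix i assume i: "i \<in> V1"
      have "\<bar>real_of_int (wt i s)\<bar> ^ u i \<le> exp (real h) ^ u i" using wt[OF i] by (intro power_mono) auto
      also have "\<dots> \<le> exp (real h) ^ (2 * J * T')" using u i by (intro power_increasing) (auto simp: less_imp_le)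
      also have "\<dots> = exp (real h * real (2 * J * T'))" by (simp add: exp_of_nat_mult[symmetric] mult.commute)
      finally show "\<bar>real_of_int (wt i s)\<bar> ^ u i \<le> exp (real h * real (2 * J * T'))" .
    qed simp
    also have "\<dots> = exp (real h * real (2 * J * T')) ^ r" using finV v0 r by simp
    also have "\<dots> = Co" unfolding Co_def y_def by (simp add: exp_of_nat_mult[symmetric] mult_ac)
    finally show ?thesis .
  qed
  have Co0: "0 \<le> Co" by (simp add: Co_def)
  have lnA: "0 \<le> ln (A i)" if "i \<in> V" for i using A1[OF that] by simp
  have lnG: "ln (A i) \<le> real G" if "i \<in> V1" for i
    using AG[OF that] A1[of i] that ln_le_cancel_iff[of "A i" "exp (real G)"] by simp
  have lnM: "ln (A v0) \<le> real M"
    using AM A1[OF v0] ln_le_cancel_iff[of "A v0" "exp (real M)"] by simp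
  define W where "W = (real r * real G + 1) * real L"
  have W: "(\<Sum>i\<in>V. real (s i) * ln (A i)) \<le> W" if s: "s \<in> box" for s
  proof -
    have "real (s i) * ln (A i) \<le> real L * real G" if i: "i \<in> V1" for i
      using s i lnG[OF i] lnA[of i] unfolding box_def by (intro mult_mono) (auto simp: PiE_iff)
    then have "(\<Sum>i\<in>V1. real (s i) * ln (A i)) \<le> real r * (real L * real G)"
      using sum_mono[of V1 "\<lambda>i. real (s i) * ln (A i)" "\<lambda>_. real L * real G"] finV v0 r by simp
    moreover have "real (s v0) * ln (A v0) \<le> real c * real M"
      using s v0 lnM lnA[OF v0] unfolding box_def by (intro mult_mono) (auto simp: PiE_iff)
    ultimately show ?thesis using finV v0 unfolding W_def L
      by (simp add: sum.remove algebra_simps)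
  qed
  have W0: "0 \<le> W" by (simp add: W_def)
  have W66: "(W + 1) * (66 * real n) \<le> 66 * real Q * y"
  proof -
    have "W + 1 \<le> real Q * real L" unfolding W_def Q_def using L1 by (simp add: algebra_simps)
    then have "(W + 1) * (66 * real n) \<le> real Q * real L * (66 * real n)"
      by (intro mult_right_mono) auto
    also have "\<dots> = 66 * real Q * y" unfolding nL[symmetric] by simp
    finally show ?thesis .
  qed
  have W2: "W * (2 * real n) \<le> 66 * real Q * y"
  proof -
    have "W * (2 * real n) \<le> (W + 1) * (66 * real n)" using W0 by (intro mult_mono) auto
    then show ?thesis using W66 by linarith
  qed
  have box: "real (card box) * real D \<le> exp (3 * real Q * y)"
  proof -
    have "card box = (c + 1) * (L + 1) ^ r" by (simp add: card_box r)
    also have "\<dots> \<le> (2 * L) * (2 * L) ^ r"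
      using cL L1 by (intro mult_le_mono power_mono) auto
    finally have "real (card box) \<le> real ((2 * L) ^ Suc r)" unfolding power_Suc by (rule of_nat_mono)
    also have "\<dots> = (2 * real L) ^ Suc r" by simp
    also have "\<dots> \<le> exp (real h) ^ Suc r" using L2 by (intro power_mono) auto
    also have "\<dots> = exp (real (Suc r) * real h)" by (rule exp_of_nat_mult[symmetric])
    also have "\<dots> \<le> exp (real (Suc r) * y)" using y1 by (simp add: mult_left_mono del: of_nat_Suc)
    finally have 1: "real (card box) \<le> exp (real (Suc r) * y)" .
    have "real D \<le> exp (real D)" by (rule le_exp_of_nat)
    also have "\<dots> \<le> exp (2 * y)" using y1 by (simp add: DE)
    finally have "real (card box) * real D \<le> exp (real (Suc r) * y + 2 * y)"
      using 1 by (intro le_exp_mult) auto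
    also have "\<dots> = exp ((real r + 3) * y)" by (simp add: algebra_simps)
    also have "\<dots> \<le> exp (3 * real Q * y)" using rQ Q2 by (intro lin) linarith
    finally show ?thesis .
  qed
  have main: "Co * (2 ^ D * (w * real n) ^ D) * exp v \<le> exp (72 * real Q * y)"
    if "0 \<le> w" "w \<le> 66" "v \<le> 66 * real Q * y" for w v
  proof -
    have "Co * (2 ^ D * (w * real n) ^ D) * exp v \<le> exp (2 * real r * y + 8 * y + 66 * real Q * y)"
      using powD[of w] that unfolding Co_def by (intro le_exp_mult mult_nonneg_nonneg) auto
    also have "\<dots> = exp ((2 * real r + 8 + 66 * real Q) * y)" by (simp add: algebra_simps)
    also have "\<dots> \<le> exp (72 * real Q * y)" using rQ Q2 by (intro lin) linarith
    finally show ?thesis .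
  qed
  define X where "X = nat \<lceil>exp (72 * real Q * y)\<rceil>"
  have X: "Co * (2 ^ D * (2 * real n) ^ D) * exp (W * (2 * real n)) \<le> real X"
    using main[of 2 "W * (2 * real n)"] W2 unfolding X_def by linarith
  have e1: "1 \<le> exp (72 * real Q * y)" using Q2 y1 by simp
  have X1: "1 \<le> X" unfolding X_def using e1 by linarith
  have Xle: "real X \<le> exp (73 * real Q * y)"
  proof -
    have "real X = of_int \<lceil>exp (72 * real Q * y)\<rceil>"
      unfolding X_def using e1 by (intro of_nat_nat) linarith
    also have "\<dots> \<le> exp (72 * real Q * y) + 1" by (rule of_int_ceiling_le_add_one)
    finally have "real X \<le> exp (72 * real Q * y) + 1" .
    also have "\<dots> \<le> 2 * exp (72 * real Q * y)" using e1 by simp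
    also have "\<dots> \<le> exp (real Q * y + 72 * real Q * y)"
    proof (intro le_exp_mult)
      show "2 \<le> exp (real Q * y)"
        using exp_ge_add_one_self[of "real Q * y"] Qy y1 by linarith
    qed auto
    finally show ?thesis by (simp add: algebra_simps)
  qed
  define P where "P = real (D * card box * X)"
  have P: "P \<le> exp (76 * real Q * y)"
  proof -
    have "P = (real (card box) * real D) * real X" by (simp add: P_def)
    also have "\<dots> \<le> exp (3 * real Q * y + 73 * real Q * y)" using box Xle by (intro le_exp_mult) auto
    finally show ?thesis by (simp add: algebra_simps)
  qed
  have P0: "0 \<le> P" by (simp add: P_def)
  have maj: "majorant P Co W n \<le> exp (151 * real Q * y)"
  proof -
    have "majorant P Co W n = (real (card box) * real D) *
        (P * (Co * (2 ^ D * (66 * real n) ^ D) * exp ((W + 1) * (66 * real n))))"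
      by (simp add: majorant_def mult_ac)
    also have "\<dots> \<le> exp (3 * real Q * y + (76 * real Q * y + 72 * real Q * y))"
      using box P main[of 66 "(W + 1) * (66 * real n)"] W66 P0 Co0
      by (intro le_exp_mult mult_nonneg_nonneg) auto
    finally show ?thesis by (simp add: algebra_simps)
  qed
  have hei: "height P Co W n J \<le> exp (152 * real Q * y)"
  proof -
    have "height P Co W n J = (real (card box) * real D) *
        (P * ((Co * (2 ^ D * (2 * real n) ^ D) * exp (W * (2 * real n))) * 2 ^ (J * D)))"
      by (simp add: height_def mult_ac)
    also have "\<dots> \<le> exp (3 * real Q * y + (76 * real Q * y + (72 * real Q * y + 2 * y)))"
      using box P main[of 2 "W * (2 * real n)"] W2 pJD P0 Co0
      by (intro le_exp_mult mult_nonneg_nonneg) auto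
    also have "\<dots> = exp ((151 * real Q + 2) * y)" by (simp add: algebra_simps)
    also have "\<dots> \<le> exp (152 * real Q * y)" using Q2 by (intro lin) linarith
    finally show ?thesis .
  qed
  have My: "real M \<le> y" using cL(2) T1(2) y1(3) by linarith
  have pA: "prod A V \<le> exp (2 * real Q * y)"
  proof -
    have "prod A V = A v0 * prod A V1" using finV v0 by (simp add: prod.remove)
    also have "prod A V1 \<le> (\<Prod>i\<in>V1. exp (real G))"
      using AG A1 by (intro prod_mono) (auto intro: order_trans[OF zero_le_one])
    also have "(\<Prod>i\<in>V1. exp (real G)) = exp (real r * real G)"
      using finV v0 r by (simp add: exp_of_nat_mult)
    finally have "prod A V \<le> A v0 * exp (real r * real G)"
      using A1[OF v0] by (simp add: mult_left_mono)
    also have "\<dots> \<le> exp (real M + real r * real G)" using AM A1[OF v0] by (intro le_exp_mult) auto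
    also have "\<dots> \<le> exp (2 * real Q * y)" using My rQ Qy by simp
    finally show ?thesis .
  qed
  have G1: "G1 \<le> y + real Q"
  proof -
    have "(\<Sum>i\<in>V1. ln (A i)) \<le> real r * real G"
      using sum_mono[of V1 "\<lambda>i. ln (A i)" "\<lambda>_. real G"] lnG finV v0 r by simp
    then show ?thesis unfolding G1_def using lnM My rQ finV v0 by (simp add: sum.remove)
  qed
  \<comment> \<open>Origin of the exponent \<open>3 * r + 9\<close>: \<open>L\<close> contains
    \<open>J ^ (3 * r + 4)\<close>, \<open>y\<close> has two more factors \<open>J\<close>, and
    \<open>J ^ 3\<close> is the margin granted to \<open>Lam\<close>.\<close>
  have Z: "real (J ^ (3 * r + 9) * h * M) = real J ^ 3 * y"
  proof -
    have "J ^ (3 * r + 9) = J ^ (3 * r + 4) * J ^ 5"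
      unfolding power_add[symmetric] by (rule arg_cong[of _ _ "(^) J"]) simp
    moreover have "J ^ 5 = J ^ 3 * J * J" by (simp add: power_eq_if)
    ultimately have "J ^ (3 * r + 9) * h * M = J ^ 3 * (J * (h * T'))"
      unfolding T'_def L c by (simp only: mult_ac)
    then show ?thesis unfolding y_def by (metis of_nat_mult of_nat_power)
  qed
  have Lam: "\<bar>Lam\<bar> \<le> exp (- (real J ^ 3 * y))" using LamZ unfolding Z .
  have cy: "real c \<le> exp (1 * y)"
  proof -
    have "real c \<le> exp (real c)" by (rule le_exp_of_nat)
    also have "\<dots> \<le> exp (1 * y)" using cL(1) T1(2) y1(3) by simp
    finally show ?thesis .
  qed
  have n66: "w * real n \<le> exp (4 * y)" if "0 \<le> w" "w \<le> 132" for w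
  proof -
    have "w * real n \<le> exp (4 * real J)" using pow_n[of w 1] that by simp
    also have "\<dots> \<le> exp (4 * y)" using y1(4) by simp
    finally show ?thesis .
  qed
  \<comment> \<open>Interpolation multiplies \<open>Lam\<close> by
    \<open>(32 * n) ^ (n * T')\<close>, whose logarithm can reach \<open>4 * J\<^sup>2 * y\<close>;
    the margin \<open>J ^ 3\<close> is there to outweigh this.\<close>
  have J3: "8 + real Q + 4 * real J ^ 2 + 2 * real J \<le> real J ^ 3"
  proof -
    have j: "1 \<le> real J" using J1 by simp
    have "real J ^ 2 * (real Q + 10) \<le> real J ^ 2 * (real J - 4)"
      using J14 by (intro mult_left_mono) auto
    moreover have "real J * (real Q + 10) \<le> real J ^ 2 * (real Q + 10)"
      using j by (intro mult_right_mono) (auto simp: power2_eq_square)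
    moreover have "1 * (real Q + 8) \<le> real J * (real Q + 8)" using j by (intro mult_right_mono) auto
    ultimately show ?thesis by (simp add: algebra_simps power3_eq_cube power2_eq_square)
  qed
  have Lam1: "66 * real n * (real c * \<bar>Lam\<bar>) \<le> 1"
  proof -
    have "66 * real n * (real c * \<bar>Lam\<bar>) \<le> exp (4 * y + (1 * y + - (real J ^ 3 * y)))"
      using n66[of 66] cy Lam by (intro le_exp_mult) auto
    also have "\<dots> = exp ((5 - real J ^ 3) * y)" by (simp add: algebra_simps)
    also have "\<dots> \<le> exp (0 * y)" using J3 by (intro lin) (smt (verit) of_nat_0_le_iff zero_le_power)
    finally show ?thesis by simp
  qed
  have gain: "gain n (2 * J * T') T' \<le> 2 * exp (- 2 * real J * y)"
  proof -
    have "12 * (2 * real n * (real c * \<bar>Lam\<bar>)) * exp (real (2 * J * T') + G1) * (32 * real n) ^ (n * T')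
        = (24 * real n) * (real c * (\<bar>Lam\<bar> * (exp (real (2 * J * T') + G1) * (32 * real n) ^ (n * T'))))"
      by (simp add: mult_ac)
    also have "\<dots> \<le> exp (4 * y + (1 * y + (- (real J ^ 3 * y) + ((3 * y + real Q * y) + 4 * real J * real N))))"
    proof (intro le_exp_mult)
      have "real (2 * J * T') \<le> 2 * y" using y1(6) by simp
      then show "exp (real (2 * J * T') + G1) \<le> exp (3 * y + real Q * y)" using G1 Qy by simp
      show "(32 * real n) ^ (n * T') \<le> exp (4 * real J * real N)" unfolding N_def by (rule pow_n) auto
    qed (use n66[of 24] cy Lam in auto)
    also have "\<dots> = exp ((8 + real Q + 4 * real J ^ 2 - real J ^ 3) * y)"
      unfolding nT by (simp add: algebra_simps power2_eq_square)
    also have "\<dots> \<le> exp (- 2 * real J * y)" using J3 by (intro lin) linarith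
    finally have 1: "12 * (2 * real n * (real c * \<bar>Lam\<bar>)) * exp (real (2 * J * T') + G1) * (32 * real n) ^ (n * T')
        \<le> exp (- 2 * real J * y)" .
    have "exp (2::real) \<le> 8"
    proof -
      have "exp (2::real) = exp 1 * exp 1" by (simp add: mult_exp_exp)
      also have "\<dots> \<le> (2.8::real) * 2.8" using e_less_272 by (intro mult_mono) auto
      finally show ?thesis by simp
    qed
    then have "(1 / 8 :: real) \<le> exp (- 2)" by (simp add: exp_minus field_simps)
    then have "(1 / 8 :: real) ^ N \<le> exp (- 2) ^ N" by (intro power_mono) auto
    also have "\<dots> = exp (- 2 * real J * y)" by (simp add: exp_of_nat_mult[symmetric] nT mult_ac)
    finally show ?thesis using 1 unfolding gain_def N_def by simp
  qed
  have small: "majorant P Co W n * gain n (2 * J * T') T' * 2 ^ (J * D) *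
      (2 ^ card V * height P Co W n J * prod A V) ^ (2 ^ Suc (card V) - 1) < 1"
  proof -
    \<comment> \<open>\<kappa> bounds the logarithm of the losses and of the height. Liouville's
      exponent raises the total to \<open>(k + 1) * \<kappa> \<le> J * y\<close>, against a gain of
      \<open>2 * J * y\<close>.\<close>
    define \<kappa> where "\<kappa> = 160 * real Q * y"
    define k :: nat where "k = 2 ^ Suc (card V) - 1"
    have k: "real k + 1 = 2 ^ (r + 2)" unfolding k_def r by (simp add: of_nat_diff)
    have g0: "0 \<le> gain n (2 * J * T') T'" unfolding gain_def by simp
    have "majorant P Co W n * 2 ^ (J * D) \<le> exp (151 * real Q * y + 2 * y)"
      using maj pJD P0 Co0 by (intro le_exp_mult) (auto simp: majorant_def)
    also have "\<dots> = exp ((151 * real Q + 2) * y)" by (simp add: algebra_simps)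
    also have "\<dots> \<le> exp \<kappa>" unfolding \<kappa>_def using Q2 by (intro lin) linarith
    finally have 1: "majorant P Co W n * 2 ^ (J * D) \<le> exp \<kappa>" .
    have AV: "0 \<le> prod A V" using A1 by (intro prod_nonneg) (auto intro: order_trans[OF zero_le_one])
    have h0: "0 \<le> height P Co W n J" unfolding height_def using P0 Co0 by simp
    have "2 ^ card V * height P Co W n J * prod A V
        \<le> exp (real (Suc r) + 152 * real Q * y + 2 * real Q * y)"
      using pow2[of "Suc r"] hei pA AV h0 unfolding r by (intro le_exp_mult mult_nonneg_nonneg) auto
    also have "\<dots> \<le> exp \<kappa>"
    proof -
      have "real (Suc r) \<le> 2 * real Q" using rQ Q2 unfolding of_nat_Suc by linarith
      then have "real (Suc r) \<le> 2 * (real Q * y)" using Qy(2) by linarith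
      moreover have "0 \<le> real Q * y" using y1 by simp
      ultimately have "real (Suc r) + 152 * (real Q * y) + 2 * (real Q * y) \<le> 160 * (real Q * y)"
        by linarith
      then show ?thesis unfolding \<kappa>_def by (simp only: exp_le_cancel_iff mult.assoc)
    qed
    finally have "(2 ^ card V * height P Co W n J * prod A V) ^ k \<le> exp \<kappa> ^ k"
      using AV h0 by (intro power_mono) auto
    then have 2: "(2 ^ card V * height P Co W n J * prod A V) ^ k \<le> exp (real k * \<kappa>)"
      by (simp add: exp_of_nat_mult)
    have "majorant P Co W n * gain n (2 * J * T') T' * 2 ^ (J * D) *
      (2 ^ card V * height P Co W n J * prod A V) ^ k
      = gain n (2 * J * T') T' * (majorant P Co W n * 2 ^ (J * D) *
      (2 ^ card V * height P Co W n J * prod A V) ^ k)" by (simp add: mult_ac)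
    also have "\<dots> \<le> 2 * exp (- 2 * real J * y) * exp (\<kappa> + real k * \<kappa>)"
      using gain 1 2 g0 AV h0 P0 Co0
      by (intro mult_mono le_exp_mult mult_nonneg_nonneg zero_le_power) (auto simp: majorant_def)
    also have "\<kappa> + real k * \<kappa> = (160 * real Q * 2 ^ (r + 2)) * y"
      unfolding k[symmetric] \<kappa>_def by (simp add: algebra_simps)
    also have "2 * exp (- 2 * real J * y) * exp ((160 * real Q * 2 ^ (r + 2)) * y)
        \<le> 2 * exp (- 2 * real J * y) * exp (real J * y)"
      using lin[OF QJ] by (intro mult_left_mono) auto
    also have "\<dots> = 2 * exp (- (real J * y))" by (simp add: mult_exp_exp mult.assoc)
    also have "\<dots> < 1"
    proof -
      have "1 * 1 \<le> real J * y" using J1 y1 by (intro mult_mono) auto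
      then have "2 < 1 + real J * y + 1" by simp
      moreover have "1280 * 1 \<le> real J * y" using J1280 y1 by (intro mult_mono) auto
      ultimately have "2 < exp (real J * y)" using exp_ge_add_one_self[of "real J * y"] by linarith
      then show ?thesis by (simp add: exp_minus field_simps)
    qed
    finally show ?thesis unfolding k_def .
  qed
  show False
  proof (rule linear_form_contradiction[OF Co W X X1 _ _ Co0 n1 Lam1 _ _ _ _ P_def small])
    show "c < 2 ^ J" unfolding c by (rule J2)
    show "0 < T'" using T1 by simp
    show "1 \<le> D" unfolding D using h J1 L1 by simp
    show "L < J * T'"
    proof -
      have "2 * L \<le> J * T'" using J1280 T1 by (intro mult_le_mono) auto
      then show ?thesis using L1 by simp
    qed
    show "D \<le> n * (J * T')"
    proof -
      have "2 \<le> J * J * J" using mult_le_mono[OF mult_le_mono[OF J1280 J1] J1] by simp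
      then have "2 * (h * T') \<le> (J * J * J) * (h * T')" by (rule mult_le_mono1)
      then show ?thesis unfolding D n_def T'_def by (simp add: power2_eq_square mult_ac)
    qed
    show "4 * (n * (2 * J * T') ^ card V) \<le> D * card box"
    proof -
      \<comment> \<open>This comparison dictates the exponent in \<open>c\<close>: in
        \<open>r\<close> coordinates the orders exceed the exponents by the factor
        \<open>2 * J\<^sup>2\<close>, a further \<open>4 * J ^ 3\<close> is lost, and the range of
        the exponent of \<open>a v0\<close> has to make up for all of it.\<close>
      have "4 * J ^ 3 * (2 * J ^ 2) ^ r \<le> J ^ 4 * (J ^ 3) ^ r"
      proof (intro mult_le_mono power_mono)
        show "4 * J ^ 3 \<le> J ^ 4" using J1280 by (simp add: power_eq_if)
        show "2 * J ^ 2 \<le> J ^ 3" using J1280 by (simp add: power_eq_if)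
      qed auto
      also have "\<dots> = c" unfolding c by (simp add: power_add power_mult)
      finally have cc: "4 * J ^ 3 * (2 * J ^ 2) ^ r \<le> c" .
      have "4 * (n * (2 * J * T') ^ card V) = (4 * J ^ 3 * (2 * J ^ 2) ^ r) * (2 * h * (J * L) * L ^ r)"
        unfolding n_def T'_def r
        by (simp add: power_mult_distrib power_add power2_eq_square power3_eq_cube mult_ac)
      also have "\<dots> \<le> (c + 1) * (2 * h * (J * L) * (L + 1) ^ r)"
        using cc by (intro mult_le_mono power_mono) auto
      also have "\<dots> = D * card box" unfolding D card_box r diff_Suc_1 by (simp only: mult_ac)
      finally show ?thesis .
    qed
  qed
qed

end

section \<open>Reduction to independent square classes\<close>

text \<open>Bounds both conjugates, where \<open>zgold\<close> bounds the coordinates. It passes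
  from a square to its root with \<open>sqrt H\<close> in place of \<open>H\<close>, so no constants
  pile up when roots are taken repeatedly.\<close>

definition house :: "real \<Rightarrow> real \<Rightarrow> bool" where
  "house H x \<longleftrightarrow> (\<exists>u v :: int. x = of_int u + of_int v * golden \<and> \<bar>x\<bar> \<le> H \<and>
     \<bar>of_int u + of_int v * (1 - golden)\<bar> \<le> H)"

text \<open>The difference of the conjugates is \<open>v * sqrt 5\<close>; so \<open>v\<close> is at
  most \<open>H\<close> and \<open>u\<close> at most \<open>3 * H\<close> in absolute value.\<close>

lemma house_imp_coords:
  assumes "house H x"
  shows "\<exists>u v :: int. x = of_int u + of_int v * golden \<and> \<bar>of_int u\<bar> + 2 * \<bar>of_int v\<bar> \<le> 5 * H"
proof -
  from assms obtain u v :: int where *: "x = of_int u + of_int v * golden" "\<bar>x\<bar> \<le> H"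
    "\<bar>of_int u + of_int v * (1 - golden)\<bar> \<le> H" unfolding house_def by blast
  have "of_int v * (2 * golden - 1) = x - (of_int u + of_int v * (1 - golden))"
    unfolding * by (simp add: algebra_simps)
  then have "\<bar>of_int v\<bar> * (2 * golden - 1) \<le> 2 * H"
  proof -
    have "\<bar>of_int v\<bar> * (2 * golden - 1) = \<bar>of_int v * (2 * golden - 1)\<bar>"
      unfolding abs_mult using golden_bounds by simp
    then show ?thesis using \<open>of_int v * (2 * golden - 1) = _\<close> *(2,3) by linarith
  qed
  moreover have "\<bar>of_int v\<bar> * 2 \<le> \<bar>of_int v\<bar> * (2 * golden - 1)"
    using golden_bounds by (intro mult_left_mono) auto
  ultimately have v: "\<bar>real_of_int v\<bar> \<le> H" by linarith
  have "\<bar>of_int v * golden\<bar> \<le> \<bar>real_of_int v\<bar> * 2"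
    unfolding abs_mult using golden_bounds by (intro mult_left_mono) auto
  then have "\<bar>real_of_int u\<bar> \<le> H + 2 * H" using *(1,2) v by linarith
  then show ?thesis using * v by (intro exI[of _ u] exI[of _ v]) auto
qed

lemma house_imp_zgold: "house H x \<Longrightarrow> zgold (5 * H) x"
  using house_imp_coords[of H x] unfolding zgold_def .

lemma zgold_imp_house:
  assumes "zgold H x"
  shows "house H x"
proof -
  from assms obtain u v :: int where *:
    "x = of_int u + of_int v * golden" "\<bar>of_int u\<bar> + 2 * \<bar>of_int v\<bar> \<le> H"
    unfolding zgold_def by blast
  have "\<bar>of_int v * (1 - golden)\<bar> \<le> \<bar>real_of_int v\<bar> * 2"
    unfolding abs_mult using golden_bounds by (intro mult_left_mono) auto
  then have "\<bar>of_int u + of_int v * (1 - golden)\<bar> \<le> H" using *(2) by linarith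
  then show ?thesis using zgold_abs_le[OF assms] *(1) unfolding house_def by blast
qed

lemma house_mult:
  assumes "house H x" "house H' y"
  shows "house (H * H') (x * y)"
proof -
  from assms(1) obtain u v :: int where x: "x = of_int u + of_int v * golden" "\<bar>x\<bar> \<le> H"
    "\<bar>of_int u + of_int v * (1 - golden)\<bar> \<le> H" unfolding house_def by blast
  from assms(2) obtain u' v' :: int where y: "y = of_int u' + of_int v' * golden" "\<bar>y\<bar> \<le> H'"
    "\<bar>of_int u' + of_int v' * (1 - golden)\<bar> \<le> H'" unfolding house_def by blast
  have e: "(of_int u + of_int v * t) * (of_int u' + of_int v' * t)
      = of_int (u * u' + v * v') + of_int (u * v' + v * u' + v * v') * t"
    if "t * t = t + 1" for t :: real
  proof -
    have "(of_int u + of_int v * t) * (of_int u' + of_int v' * t)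
      = of_int u * of_int u' + of_int v * of_int v' * (t * t) + (of_int u * of_int v' + of_int v * of_int u') * t"
      by (simp add: algebra_simps)
    then show ?thesis unfolding that by (simp add: algebra_simps)
  qed
  have g': "(1 - golden) * (1 - golden) = (1 - golden) + 1"
    using golden_square by (simp add: algebra_simps)
  show ?thesis unfolding house_def
  proof (intro exI conjI)
    show "x * y = of_int (u * u' + v * v') + of_int (u * v' + v * u' + v * v') * golden"
      unfolding x y by (rule e[OF golden_square])
    show "\<bar>x * y\<bar> \<le> H * H'" unfolding abs_mult using x y by (intro mult_mono) auto
    show "\<bar>of_int (u * u' + v * v') + of_int (u * v' + v * u' + v * v') * (1 - golden)\<bar> \<le> H * H'"
      unfolding e[OF g', symmetric] abs_mult using x y by (intro mult_mono) auto
  qed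
qed

lemma house_mono: "house H x \<Longrightarrow> H \<le> H' \<Longrightarrow> house H' x"
  unfolding house_def by force

lemma rat_square_int:
  fixes x :: real
  assumes "x \<in> \<rat>" "x\<^sup>2 = of_int n"
  shows "x \<in> \<int>"
proof -
  obtain m d :: nat where md: "d \<noteq> 0" "\<bar>x\<bar> = real m / real d" "coprime m d"
    using assms(1) by (rule Rats_abs_nat_div_natE)
  have "(real m / real d)\<^sup>2 = of_int n" using assms(2) md(2) by (metis power2_abs)
  then have "(real m)\<^sup>2 = of_int n * (real d)\<^sup>2" using md(1) by (simp add: power_divide field_simps)
  then have "real_of_int (int m ^ 2) = real_of_int (n * int d ^ 2)" by simp
  then have "int m ^ 2 = n * int d ^ 2" by (simp only: of_int_eq_iff)
  then have "int d ^ 2 dvd int m ^ 2" by simp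
  then have "d dvd m" by simp
  then have "d dvd 1" using md(3) by (metis coprime_def dvd_refl)
  then have "d = 1" by simp
  then have "\<bar>x\<bar> \<in> \<int>" using md(2) by simp
  then show ?thesis by (metis Ints_minus abs_if minus_minus)
qed

lemma golden_conj: "of_int u + of_int v * (1 - golden) = (of_int u + of_int v / 2) - of_int v / 2 * sqrt 5"
  by (simp add: golden_def field_simps)

lemma golden_coords: "of_int u + of_int v * golden = (of_int u + of_int v / 2) + of_int v / 2 * sqrt 5"
  by (simp add: golden_def field_simps)

text \<open>The ring \<open>Z[golden]\<close> is integrally closed.\<close>

lemma house_sqrt:
  assumes x: "x \<in> Qsqrt5" and y: "house H (x\<^sup>2)"
  shows "house (sqrt H) x"
proof -
  obtain p q where pq: "x = p + q * sqrt 5" "p \<in> \<rat>" "q \<in> \<rat>" using x unfolding Qsqrt5_def by blast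
  from y obtain u v :: int where uv: "x\<^sup>2 = of_int u + of_int v * golden" "\<bar>x\<^sup>2\<bar> \<le> H"
    "\<bar>of_int u + of_int v * (1 - golden)\<bar> \<le> H" unfolding house_def by blast
  have "(p\<^sup>2 + 5 * q\<^sup>2 - (of_int u + of_int v / 2)) + (2 * p * q - of_int v / 2) * sqrt 5 = 0"
    using uv(1) unfolding golden_coords pq(1) by (simp add: power2_eq_square algebra_simps)
  then have c: "p\<^sup>2 + 5 * q\<^sup>2 = of_int u + of_int v / 2" "2 * p * q = of_int v / 2"
    using rat_sqrt5_eq_0[of "p\<^sup>2 + 5 * q\<^sup>2 - (of_int u + of_int v / 2)" "2 * p * q - of_int v / 2"] pq
    by (auto simp: power2_eq_square)
  \<comment> \<open>\<open>N\<close> is the norm of \<open>x\<close> and its square the norm of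
    \<open>x\<^sup>2\<close>. Thus \<open>N\<close>, and then the trace \<open>2 * p\<close>, are
    rational with integral squares, hence integers.\<close>
  define N where "N = p\<^sup>2 - 5 * q\<^sup>2"
  have "N\<^sup>2 = (p\<^sup>2 + 5 * q\<^sup>2)\<^sup>2 - 5 * (2 * p * q)\<^sup>2"
    unfolding N_def by (simp add: power2_eq_square algebra_simps)
  also have "\<dots> = of_int (u\<^sup>2 + u * v - v\<^sup>2)"
    unfolding c by (simp add: power2_eq_square field_simps)
  finally have N2: "N\<^sup>2 = of_int (u\<^sup>2 + u * v - v\<^sup>2)" .
  have "N \<in> \<int>" by (rule rat_square_int[OF _ N2]) (use pq in \<open>simp add: N_def\<close>)
  then obtain n where n: "N = of_int n" by (elim Ints_cases)
  have "(2 * p)\<^sup>2 = 2 * (p\<^sup>2 + 5 * q\<^sup>2) + 2 * N" by (simp add: N_def power2_eq_square)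
  also have "\<dots> = of_int (2 * u + v + 2 * n)" unfolding c n by simp
  finally have t2: "(2 * p)\<^sup>2 = of_int (2 * u + v + 2 * n)" .
  have "2 * p \<in> \<int>" by (rule rat_square_int[OF _ t2]) (use pq in simp)
  then obtain t where t: "2 * p = of_int t" by (elim Ints_cases)
  have s5: "5 * (2 * q)\<^sup>2 = of_int (t\<^sup>2 - 4 * n)"
    unfolding of_int_diff of_int_power t[symmetric] of_int_mult n[symmetric] N_def
    by (simp add: power2_eq_square)
  then have q2: "(10 * q)\<^sup>2 = of_int (5 * (t\<^sup>2 - 4 * n))" by (simp add: power2_eq_square)
  have "10 * q \<in> \<int>" by (rule rat_square_int[OF _ q2]) (use pq in simp)
  then obtain w where w: "10 * q = of_int w" by (elim Ints_cases)
  have "real_of_int (w\<^sup>2) = of_int (5 * (t\<^sup>2 - 4 * n))"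
    unfolding of_int_power w[symmetric] using s5 by (simp add: power2_eq_square)
  then have w5: "w\<^sup>2 = 5 * (t\<^sup>2 - 4 * n)" by (simp only: of_int_eq_iff)
  \<comment> \<open>The factor 5 makes \<open>2 * q\<close> an integer; a congruence modulo 2 then
    gives \<open>2 * p\<close> and \<open>2 * q\<close> the same parity, which is integrality in the
    basis 1, \<open>golden\<close>.\<close>
  then have "5 dvd w\<^sup>2" by simp
  then have "5 dvd w" using prime_dvd_power[of 5 w 2] by simp
  then obtain s where s: "w = 5 * s" by blast
  then have sq: "2 * q = of_int s" using w by simp
  have "5 * s\<^sup>2 = t\<^sup>2 - 4 * n" using w5 s by (simp add: power2_eq_square)
  then have "t\<^sup>2 = 5 * s\<^sup>2 + 4 * n" by simp
  then have "even (t\<^sup>2) \<longleftrightarrow> even (5 * s\<^sup>2)" by simp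
  then have "even (t - s)" by (simp add: power2_eq_square)
  then obtain k where k: "t - s = 2 * k" by blast
  have "real_of_int t - of_int s = 2 * of_int k" using k by (metis of_int_diff of_int_mult of_int_numeral)
  then have pe: "p = of_int k + of_int s / 2" "q = of_int s / 2" using t sq by linarith+
  have xe: "x = of_int k + of_int s * golden"
    unfolding golden_coords pq(1) pe by simp
  define x' where "x' = of_int k + of_int s * (1 - golden)"
  have x'e: "x' = p - q * sqrt 5" unfolding x'_def golden_conj pe by simp
  have "x'\<^sup>2 = (p\<^sup>2 + 5 * q\<^sup>2) - (2 * p * q) * sqrt 5"
    unfolding x'e by (simp add: power2_eq_square algebra_simps)
  then have "x'\<^sup>2 = of_int u + of_int v * (1 - golden)" unfolding c golden_conj .
  then have "x'\<^sup>2 \<le> H" using uv(3) by linarith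
  then have "\<bar>x'\<bar> \<le> sqrt H" by (simp add: real_le_rsqrt)
  moreover have "\<bar>x\<bar> \<le> sqrt H" using uv(2) by (intro real_le_rsqrt) simp
  ultimately show ?thesis unfolding house_def using xe x'_def by blast
qed

text \<open>Northcott's finiteness, with an explicit count read off from the box of
  coordinates.\<close>

lemma finite_house_ge:
  assumes "5 * H \<le> real K"
  shows "finite {x. house H x} \<and> card {x. house H x} \<le> (2 * K + 1)\<^sup>2"
proof -
  let ?f = "\<lambda>(u :: int, v :: int). of_int u + of_int v * golden"
  let ?B = "{- int K..int K} \<times> {- int K..int K}"
  have "{x. house H x} \<subseteq> ?f ` ?B"
  proof
    fix x assume "x \<in> {x. house H x}"
    then obtain u v :: int where uv: "x = of_int u + of_int v * golden"
      "\<bar>real_of_int u\<bar> + 2 * \<bar>real_of_int v\<bar> \<le> 5 * H"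
      using house_imp_coords[of H x] by blast
    then have "real_of_int \<bar>u\<bar> \<le> real_of_int (int K)" "real_of_int \<bar>v\<bar> \<le> real_of_int (int K)"
      using assms by auto
    then have "\<bar>u\<bar> \<le> int K" "\<bar>v\<bar> \<le> int K" by (simp_all only: of_int_le_iff)
    then show "x \<in> ?f ` ?B" using uv(1) by (intro image_eqI[of _ _ "(u, v)"]) auto
  qed
  moreover have "card (?f ` ?B) \<le> card ?B" by (intro card_image_le) auto
  moreover have "card ?B = (2 * K + 1)\<^sup>2"
    by (simp add: card_cartesian_product power2_eq_square nat_add_distrib nat_mult_distrib)
  ultimately show ?thesis
    by (metis (no_types, lifting) card_mono finite_SigmaI finite_atLeastAtMost_int finite_imageI
        finite_subset order_trans)
qed

section \<open>Repeated extraction of square roots\<close>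

locale generators =
  fixes I :: "'i set" and g :: "'i \<Rightarrow> real" and G :: nat
  assumes finI: "finite I" and g1: "\<And>i. i \<in> I \<Longrightarrow> 1 \<le> g i"
    and gG: "\<And>i. i \<in> I \<Longrightarrow> zgold (exp (real G)) (g i)" and indI: "sqrt_independent g I"
begin

text \<open>\<beta> is a root of order \<open>2 ^ m\<close> of \<alpha> times the product of the
  \<open>g i ^ e i\<close>, stated in the form in which it is substituted into a linear form. The
  bound on \<open>e i\<close> controls the new coefficients.\<close>

definition root_of :: "real \<Rightarrow> nat \<Rightarrow> real \<Rightarrow> ('i \<Rightarrow> nat) \<Rightarrow> bool" where
  "root_of \<alpha> m \<beta> e \<longleftrightarrow> 1 \<le> \<beta> \<and> (\<forall>i\<in>I. e i < 2 ^ m) \<and>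
     2 ^ m * ln \<beta> = ln \<alpha> + (\<Sum>i\<in>I. real (e i) * ln (g i))"

text \<open>\<beta> is dependent on the \<open>g i\<close> modulo squares of Q(sqrt 5), so that one
  more square root can be taken.\<close>

definition splits :: "real \<Rightarrow> bool" where
  "splits \<beta> \<longleftrightarrow> (\<exists>E\<subseteq>I. \<exists>k\<in>Qsqrt5. \<beta> * prod g E = k\<^sup>2)"

text \<open>The next root is the absolute value of \<open>k\<close>. It lies in Z[golden] by
  integral closedness, and its logarithmic height is half of what \<beta> and
  \<open>prod g E\<close> have together; the latter adds at most \<open>card I * G\<close>.\<close>

lemma root_of_step:
  assumes r: "root_of \<alpha> m \<beta> e" and h: "house H \<beta>" and s: "splits \<beta>"
  shows "\<exists>\<gamma> e'. root_of \<alpha> (Suc m) \<gamma> e' \<and> house (sqrt (H * exp (real (card I * G)))) \<gamma>"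
proof -
  from s obtain E k where E: "E \<subseteq> I" "k \<in> Qsqrt5" "\<beta> * prod g E = k\<^sup>2" unfolding splits_def by blast
  define \<gamma> where "\<gamma> = \<bar>k\<bar>"
  have \<gamma>Q: "\<gamma> \<in> Qsqrt5" unfolding \<gamma>_def using E(2) is_subfield_closed(7)[OF is_subfield_Qsqrt5]
    by (auto simp: abs_if)
  have g2: "\<gamma>\<^sup>2 = \<beta> * prod g E" unfolding \<gamma>_def using E(3) by simp
  have finE: "finite E" using E(1) finI finite_subset by blast
  have gE: "1 \<le> prod g E" using E(1) g1 by (intro prod_ge_1) auto
  have \<beta>1: "1 \<le> \<beta>" using r by (simp add: root_of_def)
  have "1 * 1 \<le> \<beta> * prod g E" using gE \<beta>1 by (intro mult_mono) auto
  then have "1 \<le> \<gamma>\<^sup>2" using g2 by simp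
  then have \<gamma>1: "1 \<le> \<gamma>" unfolding \<gamma>_def using power2_le_imp_le[of 1 "\<bar>k\<bar>"] by simp
  have "zgold (\<Prod>i\<in>E. exp (real G)) (prod g E)" using E(1) gG by (intro zgold_prod) auto
  then have "zgold (exp (real (card E * G))) (prod g E)" by (simp add: exp_of_nat_mult[symmetric])
  moreover have "card E \<le> card I" using E(1) finI by (rule card_mono[rotated])
  then have "exp (real (card E * G)) \<le> exp (real (card I * G))"
    by (simp add: mult_right_mono del: of_nat_mult add: of_nat_mult)
  ultimately have "house (exp (real (card I * G))) (prod g E)"
    by (intro zgold_imp_house) (rule zgold_mono)
  then have "house (H * exp (real (card I * G))) (\<gamma>\<^sup>2)" unfolding g2 using h by (intro house_mult)
  then have hg: "house (sqrt (H * exp (real (card I * G)))) \<gamma>" by (rule house_sqrt[OF \<gamma>Q])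
  \<comment> \<open>Twice \<open>ln \<gamma>\<close> is \<open>ln \<beta>\<close> plus the
    \<open>ln (g i)\<close> for \<open>i \<in> E\<close>; multiplied by \<open>2 ^ m\<close> this
    raises the exponents in \<open>E\<close> by \<open>2 ^ m\<close>, and they stay below
    \<open>2 ^ Suc m\<close>.\<close>
  define e' where "e' i = e i + (if i \<in> E then 2 ^ m else 0)" for i
  have "2 * ln \<gamma> = ln (\<gamma>\<^sup>2)" using \<gamma>1 by (simp add: ln_realpow)
  also have "\<dots> = ln \<beta> + ln (prod g E)" unfolding g2 using \<beta>1 gE by (intro ln_mult_pos) auto
  also have "ln (prod g E) = (\<Sum>i\<in>E. ln (g i))"
  proof (rule ln_prod[OF finE])
    fix i assume "i \<in> E"
    then have "1 \<le> g i" using E(1) g1 by auto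
    then show "g i \<noteq> 0" by simp
  qed
  finally have two: "2 * ln \<gamma> = ln \<beta> + (\<Sum>i\<in>E. ln (g i))" .
  have "2 ^ Suc m * ln \<gamma> = 2 ^ m * (2 * ln \<gamma>)" by simp
  also have "\<dots> = 2 ^ m * ln \<beta> + 2 ^ m * (\<Sum>i\<in>E. ln (g i))"
    unfolding two by (rule distrib_left)
  also have "\<dots> = ln \<alpha> + ((\<Sum>i\<in>I. real (e i) * ln (g i)) + (\<Sum>i\<in>I. if i \<in> E then 2 ^ m * ln (g i) else 0))"
    using r finI E(1) unfolding root_of_def
    by (simp add: sum_distrib_left sum.inter_restrict[symmetric] Int_absorb1)
  also have "(\<Sum>i\<in>I. real (e i) * ln (g i)) + (\<Sum>i\<in>I. if i \<in> E then 2 ^ m * ln (g i) else 0)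
      = (\<Sum>i\<in>I. real (e' i) * ln (g i))"
    unfolding sum.distrib[symmetric] by (rule sum.cong) (auto simp: e'_def algebra_simps)
  finally have "root_of \<alpha> (Suc m) \<gamma> e'"
    unfolding root_of_def using \<gamma>1 r by (auto simp: root_of_def e'_def intro: less_trans)
  then show ?thesis using hg by blast
qed

text \<open>A logarithmic height \<open>x\<close> becomes \<open>(x + card I * G) / 2\<close> in one
  step, and this map sends \<open>M / 2 ^ m + card I * G\<close> to
  \<open>M / 2 ^ Suc m + card I * G\<close>.\<close>

lemma root_of_exists:
  assumes \<alpha>: "1 \<le> \<alpha>" "house (exp M) \<alpha>"
    and all: "\<And>m \<beta> e. m < N \<Longrightarrow> root_of \<alpha> m \<beta> e \<Longrightarrow> house (exp (M / 2 ^ m + real (card I * G))) \<beta> \<Longrightarrow> splits \<beta>"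
    and m: "m \<le> N"
  shows "\<exists>\<beta> e. root_of \<alpha> m \<beta> e \<and> house (exp (M / 2 ^ m + real (card I * G))) \<beta>"
  using m
proof (induction m)
  case 0
  have "root_of \<alpha> 0 \<alpha> (\<lambda>_. 0)" using \<alpha> by (simp add: root_of_def)
  moreover have "house (exp (M + real (card I * G))) \<alpha>" using \<alpha>(2) by (rule house_mono) simp
  ultimately show ?case by auto
next
  case (Suc m)
  then obtain \<beta> e where b: "root_of \<alpha> m \<beta> e" "house (exp (M / 2 ^ m + real (card I * G))) \<beta>" by auto
  have "sqrt (exp (M / 2 ^ m + real (card I * G)) * exp (real (card I * G)))
      = exp (M / 2 ^ Suc m + real (card I * G))"
  proof (rule real_sqrt_unique)
    show "(exp (M / 2 ^ Suc m + real (card I * G)))\<^sup>2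
        = exp (M / 2 ^ m + real (card I * G)) * exp (real (card I * G))"
      by (simp add: power2_eq_square mult_exp_exp)
  qed simp
  then show ?case using root_of_step[OF b all[OF _ b]] Suc.prems by simp
qed


text \<open>Substituting \<open>root_of\<close> leaves the value of the linear form unchanged: with
  \<beta> in place of \<alpha> its coefficients are \<open>2 ^ m\<close> and
  \<open>b i + e i\<close>, and the numbers are now independent modulo squares. The option type adds
  \<beta> to the index set as \<open>None\<close>.\<close>

lemma linear_form_lower_independent:
  fixes b :: "'i \<Rightarrow> int" and M' h J B' m :: nat
  assumes root: "root_of \<alpha> m \<beta> e" and ns: "\<not> splits \<beta>" and zb: "zgold (exp (real M')) \<beta>"
    and b: "\<And>i. i \<in> I \<Longrightarrow> \<bar>b i\<bar> + 2 ^ m \<le> int B'" and B'm: "2 ^ m \<le> B'"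
    and M': "1 \<le> M'" and G1: "1 \<le> G" and h: "1 \<le> h"
    and hB: "ln (2 * real (J ^ (3 * card I + 4) * M') * real B') \<le> real h" and Jh: "ln (real h) \<le> real J"
    and J: "160 * 2 ^ (card I + 2) * (card I * G + 2) \<le> J" and J2: "J ^ (3 * card I + 4) < 2 ^ J"
  shows "exp (- real (J ^ (3 * card I + 9) * h * M')) < \<bar>ln \<alpha> - (\<Sum>i\<in>I. of_int (b i) * ln (g i))\<bar>"
proof -
  define V where "V = insert None (Some ` I)"
  define a where "a = case_option \<beta> g"
  define A where "A = case_option (exp (real M')) (\<lambda>i :: 'i. exp (real G))"
  define b' where "b' = case_option (2 ^ m :: int) (\<lambda>i. b i + int (e i))"
  define c where "c = J ^ (3 * card I + 4)"
  define L where "L = c * M'"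
  define D where "D = 2 * h * (J * L)"
  have \<beta>1: "1 \<le> \<beta>" using root by (simp add: root_of_def)
  interpret log_form V None a A b' D L c
  proof
    show "finite V" unfolding V_def using finI by simp
    show "None \<in> V" by (simp add: V_def)
    show "0 < b' None" by (simp add: b'_def)
    show "1 \<le> a i" if "i \<in> V" for i using that g1 \<beta>1 by (auto simp: V_def a_def)
    show "zgold (A i) (a i)" if "i \<in> V" for i using that gG zb by (auto simp: V_def a_def A_def)
    show "sqrt_independent a V" unfolding sqrt_independent_def
    proof (intro allI impI)
      fix E assume E: "E \<subseteq> V" "E \<noteq> {}"
      define E' where "E' = {i \<in> I. Some i \<in> E}"
      have finE': "finite E'" "E' \<subseteq> I" using finI by (auto simp: E'_def)
      have pE': "prod a (Some ` E') = prod g E'" by (simp add: prod.reindex a_def)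
      show "\<not> (\<exists>k\<in>Qsqrt5. prod a E = k\<^sup>2)"
      proof (cases "None \<in> E")
        case True
        have "E = insert None (Some ` E')"
        proof
          show "E \<subseteq> insert None (Some ` E')"
          proof
            fix x assume "x \<in> E"
            then show "x \<in> insert None (Some ` E')" using E(1) by (cases x) (auto simp: V_def E'_def)
          qed
        qed (use True in \<open>auto simp: E'_def\<close>)
        then have "prod a E = \<beta> * prod g E'" using finE' pE' by (simp add: a_def)
        then show ?thesis using ns finE'(2) unfolding splits_def by metis
      next
        case False
        have e: "E = Some ` E'"
        proof
          show "E \<subseteq> Some ` E'"
          proof
            fix x assume "x \<in> E"
            then show "x \<in> Some ` E'" using E(1) False by (cases x) (auto simp: V_def E'_def)
          qed
        qed (auto simp: E'_def)
        then have "E' \<noteq> {}" using E(2) by auto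
        then show ?thesis using indI finE'(2) unfolding sqrt_independent_def e pE' by blast
      qed
    qed
  qed
  have V1: "V - {None} = Some ` I" by (auto simp: V_def)
  have sV1: "(\<Sum>i\<in>V - {None}. of_int (b' i) * ln (a i)) = (\<Sum>i\<in>I. of_int (b i + int (e i)) * ln (g i))"
    unfolding V1 by (subst sum.reindex) (auto simp: b'_def a_def)
  have "Lam = 2 ^ m * ln \<beta> - (\<Sum>i\<in>I. of_int (b i + int (e i)) * ln (g i))"
    unfolding Lam_def sV1 by (simp add: b'_def a_def)
  also have "\<dots> = ln \<alpha> - (\<Sum>i\<in>I. of_int (b i) * ln (g i))"
    using root by (simp add: root_of_def sum.distrib algebra_simps)
  finally have Lam: "Lam = ln \<alpha> - (\<Sum>i\<in>I. of_int (b i) * ln (g i))" .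
  have "exp (- real (J ^ (3 * card I + 9) * h * M')) < \<bar>Lam\<bar>"
  proof (rule linear_form_lower_aux[where r = "card I" and G = G and B = B'])
    show "card V = Suc (card I)" unfolding V_def using finI by (simp add: card_image)
    show "A i \<le> exp (real G)" if "i \<in> V - {None}" for i using that unfolding V1 A_def by auto
    show "\<bar>b' i\<bar> \<le> int B'" if "i \<in> V" for i
    proof (cases i)
      case None
      have "int (2 ^ m) \<le> int B'" using B'm by (rule zle_int[THEN iffD2])
      then show ?thesis using None by (simp add: b'_def)
    next
      case (Some j)
      then have j: "j \<in> I" using that by (auto simp: V_def)
      then have "e j < 2 ^ m" using root by (auto simp: root_of_def)
      then have "int (e j) < 2 ^ m" by (metis of_nat_less_iff of_nat_numeral of_nat_power)
      then have "\<bar>b j + int (e j)\<bar> \<le> int B'" using b[OF j] by linarith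
      then show ?thesis by (simp add: b'_def Some)
    qed
    show "ln (2 * real L * real B') \<le> real h" unfolding L_def c_def by (rule hB)
  qed (use M' G1 h Jh J J2 in \<open>auto simp: A_def c_def L_def D_def\<close>)
  then show ?thesis unfolding Lam .
qed

text \<open>Without a varying number, a generator with nonzero coefficient takes the place of
  \<open>v0\<close>, and a sign makes its coefficient positive. There is one number less, so
  \<open>r\<close> is \<open>card I - 1\<close>; the bound is then weakened to the shape of the
  independent case.\<close>

lemma linear_form_lower_dependent:
  fixes f :: "'i \<Rightarrow> int" and M' h J B' :: nat
  assumes f: "\<And>i. i \<in> I \<Longrightarrow> \<bar>f i\<bar> \<le> int B'" and nz: "(\<Sum>i\<in>I. of_int (f i) * ln (g i)) \<noteq> 0"
    and G1: "1 \<le> G" and h: "1 \<le> h" and M': "G \<le> M'"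
    and hB: "ln (2 * real (J ^ (3 * card I + 4) * M') * real B') \<le> real h" and Jh: "ln (real h) \<le> real J"
    and J: "160 * 2 ^ (card I + 2) * (card I * G + 2) \<le> J" and J2: "J ^ (3 * card I + 4) < 2 ^ J"
  shows "exp (- real (J ^ (3 * card I + 9) * h * M')) < \<bar>\<Sum>i\<in>I. of_int (f i) * ln (g i)\<bar>"
proof -
  obtain i0 where i0: "i0 \<in> I" "f i0 \<noteq> 0"
    using nz by (metis (no_types, lifting) mult_eq_0_iff of_int_0 sum.neutral)
  define \<sigma> where "\<sigma> = sgn (f i0)"
  have \<sigma>: "\<bar>\<sigma>\<bar> = 1" "\<sigma> * f i0 = \<bar>f i0\<bar>" unfolding \<sigma>_def using i0 by (auto simp: sgn_if)
  define r where "r = card I - 1"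
  have r: "card I = Suc r" unfolding r_def using i0 finI by (metis Suc_pred card_gt_0_iff empty_iff diff_Suc_1 Suc_pred')
  define b' where "b' i = (if i = i0 then \<bar>f i0\<bar> else - (\<sigma> * f i))" for i
  define c where "c = J ^ (3 * r + 4)"
  define L where "L = c * G"
  define D where "D = 2 * h * (J * L)"
  have J1: "1 \<le> J"
  proof -
    have "1 * 1 * 1 \<le> 160 * 2 ^ (card I + 2) * (card I * G + 2)" by (intro mult_le_mono) auto
    then show ?thesis using J by simp
  qed
  interpret log_form I i0 g "\<lambda>_. exp (real G)" b' D L c
    by standard (use finI i0 g1 gG indI in \<open>auto simp: b'_def\<close>)
  have "Lam = of_int \<sigma> * (\<Sum>i\<in>I. of_int (f i) * ln (g i))"
  proof -
    have "(\<Sum>i\<in>I - {i0}. of_int (b' i) * ln (g i)) = - of_int \<sigma> * (\<Sum>i\<in>I - {i0}. of_int (f i) * ln (g i))"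
      unfolding sum_distrib_left by (rule sum.cong) (auto simp: b'_def)
    moreover have "real_of_int (b' i0) = of_int \<sigma> * of_int (f i0)"
      using arg_cong[OF \<sigma>(2), of real_of_int] by (simp add: b'_def)
    ultimately show ?thesis unfolding Lam_def using finI i0
      by (simp add: sum.remove algebra_simps)
  qed
  moreover have "\<bar>real_of_int \<sigma>\<bar> = 1" using \<sigma>(1) by (metis of_int_1 of_int_abs)
  ultimately have Lam: "\<bar>Lam\<bar> = \<bar>\<Sum>i\<in>I. of_int (f i) * ln (g i)\<bar>" by (simp add: abs_mult)
  have B'1: "1 \<le> B'" using f[OF i0(1)] i0(2) by simp
  have cle: "J ^ (3 * r + 4) \<le> J ^ (3 * card I + 4)" using J1 by (intro power_increasing) (auto simp: r)
  have "exp (- real (J ^ (3 * r + 9) * h * G)) < \<bar>Lam\<bar>"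
  proof (rule linear_form_lower_aux[where r = r and G = G and B = B'])
    show "\<bar>b' i\<bar> \<le> int B'" if "i \<in> I" for i
      using f[OF that] f[OF i0(1)] \<sigma>(1) by (auto simp: b'_def abs_mult)
    have L0: "1 \<le> L" unfolding L_def c_def using J1 G1 by simp
    have "L \<le> J ^ (3 * card I + 4) * M'" unfolding L_def c_def using cle M' by (intro mult_le_mono)
    then have "real L \<le> real (J ^ (3 * card I + 4) * M')" by (rule of_nat_mono)
    then have "2 * real L * real B' \<le> 2 * real (J ^ (3 * card I + 4) * M') * real B'"
      by (intro mult_right_mono mult_left_mono) auto
    moreover have "0 < 2 * real L * real B'" using L0 B'1 by simp
    ultimately have "ln (2 * real L * real B') \<le> ln (2 * real (J ^ (3 * card I + 4) * M') * real B')"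
      by (meson ln_le_cancel_iff less_le_trans)
    then show "ln (2 * real L * real B') \<le> real h" using hB by linarith
    have "160 * 2 ^ (r + 2) * (r * G + 2) \<le> 160 * 2 ^ (card I + 2) * (card I * G + 2)"
      by (intro mult_le_mono power_increasing add_le_mono) (auto simp: r)
    then show "160 * 2 ^ (r + 2) * (r * G + 2) \<le> J" using J by linarith
    show "J ^ (3 * r + 4) < 2 ^ J" using cle J2 by linarith
  qed (use G1 h Jh r in \<open>auto simp: c_def L_def D_def\<close>)
  moreover have "J ^ (3 * r + 9) * h * G \<le> J ^ (3 * card I + 9) * h * M'"
    using J1 M' by (intro mult_le_mono power_increasing) (auto simp: r)
  then have "real (J ^ (3 * r + 9) * h * G) \<le> real (J ^ (3 * card I + 9) * h * M')" by (rule of_nat_mono)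
  ultimately have "exp (- real (J ^ (3 * card I + 9) * h * M')) < \<bar>Lam\<bar>"
    by (meson exp_le_cancel_iff le_less_trans neg_le_iff_le)
  then show ?thesis unfolding Lam .
qed

text \<open>A root at some stage before \<open>N\<close> that does not split falls under the
  independent case. Otherwise the roots from stage \<open>m1\<close> on have bounded house and
  outnumber the elements of that house, so one occurs at two stages. The two relations express a
  positive multiple of \<open>ln \<alpha>\<close> by the \<open>ln (g i)\<close>; dividing the
  resulting estimate by that multiple costs the extra \<open>exp (- h)\<close>.\<close>

theorem linear_form_lower:
  fixes b :: "'i \<Rightarrow> int" and M K m1 N h J B B' M' :: nat
  assumes \<alpha>: "1 \<le> \<alpha>" "zgold (exp (real M)) \<alpha>" and b: "\<And>i. i \<in> I \<Longrightarrow> \<bar>b i\<bar> \<le> int B" and B: "1 \<le> B"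
    and nz: "ln \<alpha> - (\<Sum>i\<in>I. of_int (b i) * ln (g i)) \<noteq> 0"
    and G1: "1 \<le> G" and h: "1 \<le> h" and cI: "1 \<le> card I"
    and K: "5 * exp (1 + real (card I * G)) \<le> real K" and m1: "M \<le> 2 ^ m1"
    and N: "N = m1 + (2 * K + 1)\<^sup>2 + 1" and M': "M' = M + card I * G + 2" and B': "B' = 2 ^ (2 * N + 2) * B"
    and hB: "ln (2 * real (J ^ (3 * card I + 4) * M') * real B') \<le> real h" and Jh: "ln (real h) \<le> real J"
    and J: "160 * 2 ^ (card I + 2) * (card I * G + 2) \<le> J" and J2: "J ^ (3 * card I + 4) < 2 ^ J"
  shows "exp (- real (J ^ (3 * card I + 9) * h * M') - real h)
    < \<bar>ln \<alpha> - (\<Sum>i\<in>I. of_int (b i) * ln (g i))\<bar>"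
proof -
  define Z where "Z = real (J ^ (3 * card I + 9) * h * M')"
  let ?H = "\<lambda>m. exp (real M / 2 ^ m + real (card I * G))"
  have h\<alpha>: "house (exp (real M)) \<alpha>" using \<alpha>(2) by (rule zgold_imp_house)
  have NB: "2 ^ m + B \<le> B'" "2 ^ m \<le> B'" if "m \<le> N" for m
  proof -
    have "2 ^ m \<le> (2::nat) ^ (2 * N + 1)" using that by (intro power_increasing) auto
    moreover have "2 ^ (2 * N + 1) * 1 \<le> 2 ^ (2 * N + 1) * B" using B by (intro mult_le_mono2)
    moreover have "1 * B \<le> 2 ^ (2 * N + 1) * B" by (intro mult_le_mono1) simp
    moreover have "B' = 2 ^ (2 * N + 1) * B + 2 ^ (2 * N + 1) * B" unfolding B' by simp
    ultimately show "2 ^ m + B \<le> B'" by linarith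
    then show "2 ^ m \<le> B'" by linarith
  qed
  show ?thesis
  proof (cases "\<exists>m<N. \<exists>\<beta> e. root_of \<alpha> m \<beta> e \<and> house (?H m) \<beta> \<and> \<not> splits \<beta>")
    case True
    then obtain m \<beta> e where m: "m < N" "root_of \<alpha> m \<beta> e" "house (?H m) \<beta>" "\<not> splits \<beta>" by blast
    \<comment> \<open>The factor 5 between \<open>house\<close> and \<open>zgold\<close> is absorbed
      in \<open>exp 2\<close>: the summand 2 in \<open>M'\<close>.\<close>
    have "5 \<le> exp (2::real)" using exp_lower_Taylor_quadratic[of 2] by simp
    then have "5 * ?H m \<le> exp 2 * exp (real M + real (card I * G))"
      by (intro mult_mono) (auto simp: divide_le_eq mult_le_cancel_left1)
    also have "\<dots> = exp (real M')" unfolding M' by (simp add: mult_exp_exp)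
    finally have zb: "zgold (exp (real M')) \<beta>" using house_imp_zgold[OF m(3)] zgold_mono by blast
    have "exp (- Z) < \<bar>ln \<alpha> - (\<Sum>i\<in>I. of_int (b i) * ln (g i))\<bar>"
      unfolding Z_def
    proof (rule linear_form_lower_independent[OF m(2,4) zb _ _ _ G1 h hB Jh J J2])
      show "\<bar>b i\<bar> + 2 ^ m \<le> int B'" if "i \<in> I" for i
      proof -
        have "int (2 ^ m + B) \<le> int B'" using NB(1)[of m] m(1) by (intro zle_int[THEN iffD2]) simp
        then show ?thesis using b[OF that] by simp
      qed
    qed (use NB(2)[of m] m(1) M' in auto)
    moreover have "exp (- Z - real h) \<le> exp (- Z)" by simp
    ultimately show ?thesis unfolding Z_def[symmetric] by linarith
  next
    case False
    have "\<exists>\<beta> e. root_of \<alpha> m \<beta> e \<and> house (?H m) \<beta>" if "m \<le> N" for m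
      using root_of_exists[OF \<alpha>(1) h\<alpha>, of N m] False that by blast
    then obtain \<beta> e where be: "\<And>m. m \<le> N \<Longrightarrow> root_of \<alpha> m (\<beta> m) (e m)" "\<And>m. m \<le> N \<Longrightarrow> house (?H m) (\<beta> m)"
      by metis
    have sub: "\<beta> ` {m1..N} \<subseteq> {x. house (exp (1 + real (card I * G))) x}"
    proof
      fix x assume "x \<in> \<beta> ` {m1..N}"
      then obtain m where m: "m1 \<le> m" "m \<le> N" "x = \<beta> m" by auto
      have "real M \<le> real (2 ^ m1)" using m1 by (rule of_nat_mono)
      also have "\<dots> \<le> 2 ^ m" using m(1) by (simp add: power_increasing)
      finally have "real M / 2 ^ m \<le> 1" by simp
      then show "x \<in> {x. house (exp (1 + real (card I * G))) x}"
        using house_mono[OF be(2)[OF m(2)]] m(3) by simp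
    qed
    have "card (\<beta> ` {m1..N}) \<le> (2 * K + 1)\<^sup>2"
      using finite_house_ge[OF K] card_mono[OF _ sub] by linarith
    also have "\<dots> < card {m1..N}" unfolding N by simp
    finally have "\<not> inj_on \<beta> {m1..N}" by (rule pigeonhole)
    then obtain m m' where mm: "m < m'" "m' \<le> N" "\<beta> m = \<beta> m'"
      unfolding inj_on_def by (metis atLeastAtMost_iff linorder_neqE_nat)
    define d where "d = m' - m"
    \<comment> \<open>As \<open>2 ^ d\<close> is the quotient of \<open>2 ^ m'\<close> by
      \<open>2 ^ m\<close>, this is the coefficient of \<open>ln \<alpha>\<close> that remains when
      \<open>ln (\<beta> m)\<close> is eliminated.\<close>
    define u :: int where "u = 2 ^ d - 1"
    have u1: "1 \<le> u" unfolding u_def d_def using mm(1) by (simp add: power_increasing[of 1 "m' - m" "2::int"] one_le_power self_le_power)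
    have e1: "2 ^ m * ln (\<beta> m) = ln \<alpha> + (\<Sum>i\<in>I. real (e m i) * ln (g i))"
      "2 ^ m' * ln (\<beta> m) = ln \<alpha> + (\<Sum>i\<in>I. real (e m' i) * ln (g i))"
      using be(1)[of m] be(1)[of m'] mm by (simp_all add: root_of_def)
    have "(2::real) ^ m' = 2 ^ d * 2 ^ m" unfolding d_def using mm(1) by (simp add: power_add[symmetric])
    then have "2 ^ d * (ln \<alpha> + (\<Sum>i\<in>I. real (e m i) * ln (g i))) = ln \<alpha> + (\<Sum>i\<in>I. real (e m' i) * ln (g i))"
      using e1 by (metis mult.assoc)
    then have ua: "of_int u * ln \<alpha> = (\<Sum>i\<in>I. real (e m' i) * ln (g i)) - 2 ^ d * (\<Sum>i\<in>I. real (e m i) * ln (g i))"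
      unfolding u_def by (simp add: algebra_simps)
    define f where "f i = int (e m' i) - 2 ^ d * int (e m i) - u * b i" for i
    have sf: "(\<Sum>i\<in>I. of_int (f i) * ln (g i)) = of_int u * (ln \<alpha> - (\<Sum>i\<in>I. of_int (b i) * ln (g i)))"
      unfolding right_diff_distrib ua f_def
      by (simp add: sum_subtractf sum.distrib sum_distrib_left algebra_simps)
    have fB: "\<bar>f i\<bar> \<le> int B'" if i: "i \<in> I" for i
    proof -
      have "e m' i \<le> 2 ^ m'" "e m i \<le> 2 ^ m"
        using be(1)[of m] be(1)[of m'] mm i unfolding root_of_def by (auto intro: less_imp_le)
      then have "int (e m' i) \<le> int (2 ^ m')" "int (e m i) \<le> int (2 ^ m)"
        by (simp_all only: zle_int)
      then have "int (e m' i) \<le> 2 ^ m'" "int (e m i) \<le> 2 ^ m" by (simp_all only: of_nat_power of_nat_numeral)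
      then have "2 ^ d * int (e m i) \<le> 2 ^ d * 2 ^ m" by (intro mult_left_mono) auto
      also have "\<dots> = 2 ^ m'" unfolding d_def using mm(1) by (simp add: power_add[symmetric])
      finally have 1: "2 ^ d * int (e m i) \<le> 2 ^ m'" .
      have "(2::int) ^ m' \<le> 2 ^ N" "(2::int) ^ d \<le> 2 ^ N" using mm(2) unfolding d_def by (auto intro: power_increasing)
      moreover have "\<bar>u\<bar> \<le> 2 ^ N" using u1 \<open>2 ^ d \<le> 2 ^ N\<close> unfolding u_def by linarith
      then have "\<bar>u * b i\<bar> \<le> 2 ^ N * int B"
        unfolding abs_mult using b[OF i] by (intro mult_mono) auto
      moreover have "0 \<le> 2 ^ d * int (e m i)" by simp
      moreover have "(2::int) ^ N * 1 \<le> 2 ^ N * int B" using B by (intro mult_left_mono) auto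
      ultimately have "\<bar>f i\<bar> \<le> 3 * (2 ^ N * int B)"
        unfolding f_def using 1 \<open>int (e m' i) \<le> 2 ^ m'\<close> by linarith
      also have "\<dots> \<le> 2 ^ (2 * N + 2) * int B"
      proof -
        have "3 * (2::int) ^ N \<le> 2 ^ 2 * 2 ^ (2 * N)" by (intro mult_mono power_increasing) auto
        then have "3 * 2 ^ N * int B \<le> (2 ^ 2 * 2 ^ (2 * N)) * int B" by (intro mult_right_mono) auto
        then show ?thesis by (simp add: power_add mult_ac)
      qed
      finally show ?thesis unfolding B' by simp
    qed
    have "exp (- Z) < \<bar>\<Sum>i\<in>I. of_int (f i) * ln (g i)\<bar>"
      unfolding Z_def
    proof (rule linear_form_lower_dependent[OF fB _ G1 h _ hB Jh J J2])
      show "(\<Sum>i\<in>I. of_int (f i) * ln (g i)) \<noteq> 0" unfolding sf using u1 nz by simp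
      have "1 * G \<le> card I * G" using cI by (rule mult_le_mono1)
      then show "G \<le> M'" unfolding M' by linarith
    qed
    also have "\<dots> = of_int u * \<bar>ln \<alpha> - (\<Sum>i\<in>I. of_int (b i) * ln (g i))\<bar>"
      unfolding sf using u1 by (simp add: abs_mult)
    also have "\<dots> \<le> exp (real h) * \<bar>ln \<alpha> - (\<Sum>i\<in>I. of_int (b i) * ln (g i))\<bar>"
    proof (rule mult_right_mono)
      have J1: "1 \<le> J"
      proof -
        have "1 * 1 * 1 \<le> 160 * 2 ^ (card I + 2) * (card I * G + 2)" by (intro mult_le_mono) auto
        then show ?thesis using J by simp
      qed
      have "1 * 1 \<le> J ^ (3 * card I + 4) * M'" using J1 M' by (intro mult_le_mono) auto
      then have "1 \<le> real (J ^ (3 * card I + 4) * M')" by (metis mult_1 of_nat_1 of_nat_mono)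
      then have "1 * real B' \<le> 2 * real (J ^ (3 * card I + 4) * M') * real B'" by (intro mult_right_mono) auto
      moreover have "1 \<le> B'" using NB(1)[of 0] B by simp
      ultimately have "real B' \<le> exp (ln (2 * real (J ^ (3 * card I + 4) * M') * real B'))"
        using \<open>1 \<le> real (J ^ (3 * card I + 4) * M')\<close> by simp
      also have "\<dots> \<le> exp (real h)" using hB by simp
      finally have "real B' \<le> exp (real h)" .
      moreover have "of_int u \<le> real B'"
      proof -
        have "2 ^ d \<le> B'" using NB(2)[of d] mm(2) by (simp add: d_def)
        then have "real (2 ^ d) \<le> real B'" by (rule of_nat_mono)
        moreover have "real_of_int u = real (2 ^ d) - 1" by (simp add: u_def)
        ultimately show ?thesis by linarith
      qed
      ultimately show "of_int u \<le> exp (real h)" by linarith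
    qed simp
    finally have "exp (- Z) * exp (- real h) < exp (real h) * \<bar>ln \<alpha> - (\<Sum>i\<in>I. of_int (b i) * ln (g i))\<bar> * exp (- real h)"
      by (intro mult_strict_right_mono) auto
    then show ?thesis unfolding Z_def[symmetric] by (simp add: exp_minus exp_diff field_simps)
  qed
qed

end

section \<open>Zeckendorf representations of S-units\<close>

lemma golden_inverse: "\<bar>1 - golden\<bar> = golden - 1" "(2 - golden) * (golden * golden) = 1"
proof -
  show "\<bar>1 - golden\<bar> = golden - 1" using golden_bounds by simp
  have "(2 - golden) * (golden * golden) = 2 * golden + 2 - (golden * golden) - golden"
    unfolding golden_square by (simp add: algebra_simps golden_square)
  then show "(2 - golden) * (golden * golden) = 1" by (simp add: golden_square)
qed

lemma sqrt5_golden: "sqrt 5 = 2 * golden - 1"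
  by (simp add: golden_def field_simps)

lemma sqrt5_fib: "sqrt 5 * real (fib n) = golden ^ n - (1 - golden) ^ n"
proof -
  have "real (fib n) = (golden ^ n - (1 - golden) ^ n) / sqrt 5"
    using fib_closed_form[of n] by (simp add: golden_def field_simps)
  then show ?thesis by simp
qed

lemma sum_golden_power: "(\<Sum>j\<le>n. golden ^ j) \<le> golden ^ (n + 2)"
proof (induction n)
  case 0
  have "1 * 1 \<le> golden * golden" using golden_bounds by (intro mult_mono) auto
  then show ?case by (simp add: power2_eq_square)
next
  case (Suc n)
  have "golden ^ (n + 2) + golden ^ Suc n = golden ^ Suc n * (golden + 1)" by (simp add: algebra_simps)
  also have "\<dots> = golden ^ (Suc n + 2)" unfolding golden_square[symmetric] by (simp add: mult_ac)
  finally show ?case using Suc by simp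
qed

text \<open>A geometric series with ratio \<open>golden - 1\<close>; its sum
  \<open>1 / (2 - golden)\<close> equals \<open>golden * golden\<close>.\<close>

lemma sum_conj_power:
  assumes "finite D"
  shows "\<bar>\<Sum>j\<in>D. (1 - golden) ^ j\<bar> \<le> golden * golden"
proof -
  let ?x = "golden - 1"
  have x: "0 \<le> ?x" "?x \<le> 1" using golden_bounds by auto
  obtain n where "\<forall>j\<in>D. j \<le> n" using assms unfolding finite_nat_set_iff_bounded_le by auto
  then have n: "D \<subseteq> {..n}" by auto
  have "(\<Sum>j\<in>D. \<bar>(1 - golden) ^ j\<bar>) = (\<Sum>j\<in>D. ?x ^ j)"
    by (simp only: power_abs golden_inverse(1))
  then have "\<bar>\<Sum>j\<in>D. (1 - golden) ^ j\<bar> \<le> (\<Sum>j\<in>D. ?x ^ j)"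
    using sum_abs[of "\<lambda>j. (1 - golden) ^ j" D] by linarith
  also have "\<dots> \<le> (\<Sum>j\<le>n. ?x ^ j)" using n x by (intro sum_mono2) auto
  also have "\<dots> \<le> golden * golden"
  proof -
    have "(1 - ?x) * (\<Sum>j\<le>n. ?x ^ j) = 1 - ?x ^ Suc n" by (rule sum_gp_basic)
    also have "\<dots> \<le> (2 - golden) * (golden * golden)" using x unfolding golden_inverse(2) by simp
    finally have "(2 - golden) * (\<Sum>j\<le>n. ?x ^ j) \<le> (2 - golden) * (golden * golden)" by simp
    then show ?thesis using golden_bounds by simp
  qed
  finally show ?thesis .
qed

lemma golden_power_coords:
  "\<exists>u v :: int. golden ^ n = of_int u + of_int v * golden \<and>
     (1 - golden) ^ n = of_int u + of_int v * (1 - golden)"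
proof (induction n)
  case 0
  have "golden ^ 0 = of_int 1 + of_int 0 * golden \<and> (1 - golden) ^ 0 = of_int 1 + of_int 0 * (1 - golden)"
    by simp
  then show ?case by blast
next
  case (Suc n)
  then obtain u v :: int where uv: "golden ^ n = of_int u + of_int v * golden"
    "(1 - golden) ^ n = of_int u + of_int v * (1 - golden)" by blast
  have e: "t * (of_int u + of_int v * t) = of_int v + of_int (u + v) * t" if "t * t = t + 1" for t :: real
  proof -
    have "t * (of_int u + of_int v * t) = of_int u * t + of_int v * (t * t)" by (simp add: algebra_simps)
    then show ?thesis unfolding that by (simp add: algebra_simps)
  qed
  have g': "(1 - golden) * (1 - golden) = (1 - golden) + 1"
    using golden_square by (simp add: algebra_simps)
  show ?case unfolding power_Suc uv e[OF golden_square] e[OF g'] by blast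
qed

lemma sum_golden_power_coords:
  assumes "finite D"
  shows "\<exists>u v :: int. (\<Sum>j\<in>D. golden ^ f j) = of_int u + of_int v * golden \<and>
     (\<Sum>j\<in>D. (1 - golden) ^ f j) = of_int u + of_int v * (1 - golden)"
  using assms
proof (induction D rule: finite_induct)
  case empty
  have "(\<Sum>j\<in>{}. golden ^ f j) = of_int 0 + of_int 0 * golden \<and>
      (\<Sum>j\<in>{}. (1 - golden) ^ f j) = of_int 0 + of_int 0 * (1 - golden)" by simp
  then show ?case by blast
next
  case (insert x D)
  then obtain u v :: int where uv: "(\<Sum>j\<in>D. golden ^ f j) = of_int u + of_int v * golden"
     "(\<Sum>j\<in>D. (1 - golden) ^ f j) = of_int u + of_int v * (1 - golden)" by blast
  obtain u' v' :: int where uv': "golden ^ f x = of_int u' + of_int v' * golden"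
    "(1 - golden) ^ f x = of_int u' + of_int v' * (1 - golden)" using golden_power_coords by blast
  have "(\<Sum>j\<in>insert x D. golden ^ f j) = of_int (u' + u) + of_int (v' + v) * golden \<and>
      (\<Sum>j\<in>insert x D. (1 - golden) ^ f j) = of_int (u' + u) + of_int (v' + v) * (1 - golden)"
    unfolding sum.insert[OF insert(1,2)] uv uv' by (simp add: algebra_simps)
  then show ?case by blast
qed

text \<open>The difference consists of the powers of \<open>golden\<close> at the digits below
  \<open>q1\<close>, minus the conjugate powers at all digits, which amount to at most
  \<open>golden\<^sup>2\<close>. Equality would give the value \<open>- sqrt 5 * n\<close> to the
  conjugate sum, and for \<open>n \<ge> 2\<close> this exceeds the same bound.\<close>

lemma zeckendorf_truncation:
  assumes Z: "is_zeckendorf n D" and q1: "q1 \<in> D" and q: "q < q1" "\<And>j. j \<in> D \<Longrightarrow> j < q1 \<Longrightarrow> j \<le> q"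
  shows "\<bar>sqrt 5 * real n - (\<Sum>j\<in>{j\<in>D. q1 \<le> j}. golden ^ j)\<bar> \<le> golden ^ (q + 4)"
    and "2 \<le> n \<Longrightarrow> sqrt 5 * real n \<noteq> (\<Sum>j\<in>{j\<in>D. q1 \<le> j}. golden ^ j)"
proof -
  have fin: "finite D" and nD: "n = (\<Sum>j\<in>D. fib j)" using Z by (auto simp: is_zeckendorf_def)
  let ?A = "{j\<in>D. q1 \<le> j}" and ?B = "{j\<in>D. j < q1}"
  have "sqrt 5 * real n = (\<Sum>j\<in>D. golden ^ j) - (\<Sum>j\<in>D. (1 - golden) ^ j)"
    unfolding nD by (simp add: sum_distrib_left sqrt5_fib sum_subtractf)
  also have "(\<Sum>j\<in>D. golden ^ j) = (\<Sum>j\<in>?A. golden ^ j) + (\<Sum>j\<in>?B. golden ^ j)"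
  proof -
    have "D = ?A \<union> ?B" "?A \<inter> ?B = {}" by auto
    then show ?thesis using fin by (metis (no_types, lifting) finite_Un sum.union_disjoint)
  qed
  finally have e: "sqrt 5 * real n - (\<Sum>j\<in>?A. golden ^ j) = (\<Sum>j\<in>?B. golden ^ j) - (\<Sum>j\<in>D. (1 - golden) ^ j)"
    by simp
  have g1: "1 \<le> golden" using golden_bounds by simp
  have "(\<Sum>j\<in>?B. golden ^ j) \<le> (\<Sum>j\<le>q. golden ^ j)"
    using q(2) g1 by (intro sum_mono2) auto
  then have B: "0 \<le> (\<Sum>j\<in>?B. golden ^ j)" "(\<Sum>j\<in>?B. golden ^ j) \<le> golden ^ (q + 2)"
    using sum_golden_power[of q] g1 by (auto intro!: sum_nonneg)
  have "golden * golden \<le> golden ^ (q + 2) * golden"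
  proof -
    have "golden * 1 \<le> golden ^ (q + 2)" using g1 power_increasing[of 1 "q + 2" golden] by simp
    then show ?thesis using g1 by (intro mult_right_mono) auto
  qed
  moreover have "golden ^ (q + 2) + golden ^ (q + 2) * golden = golden ^ (q + 2) * (golden * golden)"
    unfolding golden_square by (simp add: algebra_simps)
  moreover have "golden ^ (q + 2) * (golden * golden) = golden ^ (q + 4)" by (simp add: power_add power_eq_if)
  ultimately show "\<bar>sqrt 5 * real n - (\<Sum>j\<in>?A. golden ^ j)\<bar> \<le> golden ^ (q + 4)"
    unfolding e using B sum_conj_power[OF fin] by linarith
  show "sqrt 5 * real n \<noteq> (\<Sum>j\<in>?A. golden ^ j)" if n2: "2 \<le> n"
  proof
    assume eq: "sqrt 5 * real n = (\<Sum>j\<in>?A. golden ^ j)"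
    have finA: "finite ?A" using fin by simp
    obtain u v :: int where uv: "(\<Sum>j\<in>?A. golden ^ j) = of_int u + of_int v * golden"
      "(\<Sum>j\<in>?A. (1 - golden) ^ j) = of_int u + of_int v * (1 - golden)"
      using sum_golden_power_coords[OF finA, of "\<lambda>j. j"] by blast
    have "(of_int u + of_int v / 2) + (of_int v / 2 - real n) * sqrt 5 = 0"
      using eq unfolding uv golden_coords by (simp add: algebra_simps)
    then have "of_int u + of_int v / 2 = (0::real) \<and> of_int v / 2 - real n = 0"
      by (intro rat_sqrt5_eq_0) auto
    then have "of_int u + of_int v / 2 = (0::real)" "of_int v / 2 = real n" by auto
    then have "(\<Sum>j\<in>?A. (1 - golden) ^ j) = - (real n * sqrt 5)"
      unfolding uv golden_conj by (simp only: diff_0)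
    then have "real n * sqrt 5 \<le> golden * golden" using sum_conj_power[OF finA] by simp
    moreover have "2 * (2 * golden - 1) \<le> real n * sqrt 5"
      unfolding sqrt5_golden using n2 golden_bounds by (intro mult_mono) auto
    ultimately have "2 * (2 * golden - 1) \<le> golden * golden" by (rule order_trans[rotated])
    then have "2 * (2 * golden - 1) \<le> golden + 1" unfolding golden_square .
    then have "3 * golden \<le> 3" by simp
    then show False using golden_bounds(1) by simp
  qed
qed

lemma abs_ln_le:
  fixes x :: real
  assumes "\<bar>x - 1\<bar> \<le> \<delta>" "\<delta> \<le> 1 / 2"
  shows "\<bar>ln x\<bar> \<le> 2 * \<delta>"
proof -
  have x: "1 / 2 \<le> x" using assms by linarith
  have "ln x \<le> x - 1" using x by (intro ln_le_minus_one) auto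
  moreover have "ln (1 / x) \<le> 1 / x - 1" using x by (intro ln_le_minus_one) auto
  then have "- ln x \<le> (1 - x) / x" using x by (simp add: ln_div diff_divide_distrib)
  moreover have "(1 - x) / x \<le> 2 * \<delta>"
  proof -
    have "1 - x \<le> \<delta> * 1" using assms by linarith
    also have "\<dots> \<le> \<delta> * (2 * x)" using x assms by (intro mult_left_mono) auto
    finally show ?thesis using x by (simp add: divide_le_eq mult_ac)
  qed
  ultimately show ?thesis using assms by linarith
qed

text \<open>The indices \<open>0\<close> and \<open>1\<close>, not being prime, are free to stand for \<open>sqrt 5\<close> and \<open>golden\<close>; the
  prime \<open>5\<close> is left out because it is a square.\<close>

definition gen_set :: "nat set \<Rightarrow> nat set" where
  "gen_set S = {0, 1} \<union> (S - {5})"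

definition gen :: "nat \<Rightarrow> real" where
  "gen i = (if i = 0 then sqrt 5 else if i = 1 then golden else real i)"

lemma squarefree_prod_primes:
  fixes E :: "nat set"
  assumes "finite E" "\<And>p. p \<in> E \<Longrightarrow> prime p" "\<And>p. p \<in> E \<Longrightarrow> p \<noteq> 5"
  shows "\<not> 5 dvd \<Prod>E" "\<Prod>E = m ^ 2 \<Longrightarrow> E = {}"
proof -
  show "\<not> 5 dvd \<Prod>E"
  proof
    assume "5 dvd \<Prod>E"
    then obtain p where "p \<in> E" "5 dvd p" using prime_dvd_prod_iff[OF assms(1), of 5 "\<lambda>x. x"] by auto
    then show False using assms(2,3) primes_dvd_imp_eq[of 5 p] by auto
  qed
  assume m: "\<Prod>E = m ^ 2"
  show "E = {}"
  proof (rule ccontr)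
    assume "E \<noteq> {}"
    then obtain p where p: "p \<in> E" by blast
    have pp: "prime p" using assms(2) p by blast
    have pE: "\<Prod>E = p * \<Prod>(E - {p})" using assms(1) p by (rule prod.remove)
    then have "p dvd m ^ 2" using m by (metis dvd_triv_left)
    then have "p dvd m" using pp prime_dvd_power by blast
    then obtain k where "m = p * k" ..
    then have "\<Prod>(E - {p}) = p * (k * k)"
      using m pE pp by (simp add: power2_eq_square prime_gt_0_nat)
    then have "p dvd \<Prod>(E - {p})" by simp
    then obtain q where "q \<in> E - {p}" "p dvd q"
      using prime_dvd_prod_iff[of "E - {p}" p "\<lambda>x. x"] assms(1) pp by auto
    then show False using assms(2) primes_dvd_imp_eq[of p q] pp by auto
  qed
qed

text \<open>A rational number that is a square in Q(sqrt 5) is a rational square or 5 times one,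
  unlike a nonempty product of distinct primes other than 5. With \<open>sqrt 5\<close> alone the
  rational part \<open>p\<^sup>2 + 5 * q\<^sup>2\<close> would be 0. With \<open>golden\<close>
  alone the norm is negative, with both it is 5 times a rational square, whereas the norm of a
  square is a rational square.\<close>

lemma sqrt_independent_gen:
  assumes S: "finite S" "\<And>p. p \<in> S \<Longrightarrow> prime p"
  shows "sqrt_independent gen (gen_set S)"
  unfolding sqrt_independent_def
proof (intro allI impI notI)
  fix E assume E: "E \<subseteq> gen_set S" "E \<noteq> {}" and sq: "\<exists>k\<in>Qsqrt5. prod gen E = k\<^sup>2"
  define F where "F = E - {0, 1}"
  define P where "P = \<Prod>F"
  have F: "finite F" "\<And>p. p \<in> F \<Longrightarrow> prime p" "\<And>p. p \<in> F \<Longrightarrow> p \<noteq> 5"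
    using E(1) S finite_subset[of F S] by (auto simp: F_def gen_set_def)
  have P0: "0 < P" unfolding P_def using F(2) by (intro prod_pos) (auto simp: prime_gt_0_nat)
  obtain p q where pq: "p \<in> \<rat>" "q \<in> \<rat>" "prod gen E = (p + q * sqrt 5)\<^sup>2"
    using sq unfolding Qsqrt5_def by blast
  have gF: "prod gen F = real P"
  proof -
    have "prod gen F = (\<Prod>i\<in>F. real i)" by (rule prod.cong) (auto simp: gen_def F_def)
    then show ?thesis unfolding P_def by simp
  qed
  have sqe: "(p + q * sqrt 5)\<^sup>2 = (p\<^sup>2 + 5 * q\<^sup>2) + 2 * p * q * sqrt 5"
    by (simp add: power2_eq_square algebra_simps)
  have cmp: "x = p\<^sup>2 + 5 * q\<^sup>2 \<and> y = 2 * p * q"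
    if "prod gen E = x + y * sqrt 5" "x \<in> \<rat>" "y \<in> \<rat>" for x y
    using rat_sqrt5_eq_0[of "x - (p\<^sup>2 + 5 * q\<^sup>2)" "y - 2 * p * q"] that pq sqe
    by (simp add: algebra_simps power2_eq_square)
  have norm: "x\<^sup>2 - 5 * y\<^sup>2 = (p\<^sup>2 - 5 * q\<^sup>2)\<^sup>2"
    if "x = p\<^sup>2 + 5 * q\<^sup>2 \<and> y = 2 * p * q" for x y :: real
    using that by (simp add: power2_eq_square algebra_simps)
  have PR: "real P \<in> \<rat>" by simp
  consider "0 \<notin> E" "1 \<notin> E" | "0 \<in> E" "1 \<notin> E" | "0 \<notin> E" "1 \<in> E" | "0 \<in> E" "1 \<in> E" by blast
  then show False
  proof cases
    case 1
    then have EF: "E = F" by (auto simp: F_def)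
    have c: "real P = p\<^sup>2 + 5 * q\<^sup>2" "0 = 2 * p * q"
      using cmp[of "real P" 0] gF EF by auto
    show False
    proof (cases "q = 0")
      case True
      then have "p\<^sup>2 = of_int (int P)" using c by simp
      then have "p \<in> \<int>" using pq(1) rat_square_int by blast
      then obtain z where "p = of_int z" by (elim Ints_cases)
      then have "real_of_int (int P) = of_int (z\<^sup>2)" using \<open>p\<^sup>2 = _\<close> by simp
      then have "int P = z\<^sup>2" by (simp only: of_int_eq_iff)
      then have "P = (nat \<bar>z\<bar>)\<^sup>2" by (metis nat_int nat_power_eq abs_ge_zero power2_abs)
      then have "F = {}" using squarefree_prod_primes(2)[OF F, of "nat \<bar>z\<bar>"] unfolding P_def by simp
      then show False using E(2) EF by simp
    next
      case False
      then have "real P = 5 * q\<^sup>2" using c by simp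
      then have "(5 * q)\<^sup>2 = of_int (int (5 * P))" by (simp add: power2_eq_square)
      have "5 * q \<in> \<int>"
        by (rule rat_square_int[OF _ \<open>(5 * q)\<^sup>2 = _\<close>]) (use pq(2) in simp)
      then obtain z where z: "5 * q = of_int z" by (elim Ints_cases)
      then have "real_of_int (int (5 * P)) = of_int (z\<^sup>2)" using \<open>(5 * q)\<^sup>2 = _\<close> by simp
      then have z2: "int (5 * P) = z\<^sup>2" by (simp only: of_int_eq_iff)
      then have "5 dvd z\<^sup>2" by (metis dvd_triv_left of_nat_mult of_nat_numeral)
      then have "5 dvd z" using prime_dvd_power[of 5 z 2] by simp
      then obtain k where "z = 5 * k" ..
      then have "int P = 5 * k\<^sup>2" using z2 by (simp add: power2_eq_square)
      then have "int 5 dvd int P" by simp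
      then have "5 dvd P" by (simp only: int_dvd_int_iff)
      then show False using squarefree_prod_primes(1)[OF F] unfolding P_def by simp
    qed
  next
    case 2
    then have "E = insert 0 F" "0 \<notin> F" by (auto simp: F_def)
    then have "prod gen E = 0 + real P * sqrt 5" using F(1) gF by (simp add: gen_def)
    then have "0 = p\<^sup>2 + 5 * q\<^sup>2" "real P = 2 * p * q" using cmp[OF _ _ PR] by auto
    then have "p = 0" by (smt (verit) zero_le_power2 zero_eq_power2)
    then show False using \<open>real P = 2 * p * q\<close> P0 by simp
  next
    case 3
    then have "E = insert 1 F" "1 \<notin> F" by (auto simp: F_def)
    then have "prod gen E = real P / 2 + (real P / 2) * sqrt 5"
      using F(1) gF by (simp add: gen_def golden_def field_simps)
    then have "(real P / 2)\<^sup>2 - 5 * (real P / 2)\<^sup>2 = (p\<^sup>2 - 5 * q\<^sup>2)\<^sup>2"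
      by (intro norm cmp) auto
    then show False using P0 by (smt (verit) zero_le_power2 zero_less_power2 of_nat_0_less_iff half_gt_zero)
  next
    case 4
    then have "E = insert 0 (insert 1 F)" "0 \<notin> F" "1 \<notin> F" by (auto simp: F_def)
    then have "prod gen E = sqrt 5 * (golden * real P)"
      using F(1) gF by (simp add: gen_def)
    then have "prod gen E = 5 * real P / 2 + (real P / 2) * sqrt 5"
      by (simp add: golden_def field_simps)
    then have "(5 * real P / 2)\<^sup>2 - 5 * (real P / 2)\<^sup>2 = (p\<^sup>2 - 5 * q\<^sup>2)\<^sup>2"
      by (intro norm cmp) auto
    then have "5 * (real P)\<^sup>2 = (p\<^sup>2 - 5 * q\<^sup>2)\<^sup>2" by (simp add: power2_eq_square field_simps)
    then have "sqrt (5 * (real P)\<^sup>2) = \<bar>p\<^sup>2 - 5 * q\<^sup>2\<bar>" by (simp only: real_sqrt_abs)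
    then have "sqrt 5 = \<bar>p\<^sup>2 - 5 * q\<^sup>2\<bar> / real P" using P0 by (simp add: real_sqrt_mult field_simps)
    moreover have "\<bar>p\<^sup>2 - 5 * q\<^sup>2\<bar> / real P \<in> \<rat>" using pq by auto
    ultimately show False using sqrt5_irrational by simp
  qed
qed

lemma generators_gen:
  assumes S: "finite S" "\<And>p. p \<in> S \<Longrightarrow> prime p" and G: "2 \<le> G" "\<And>p. p \<in> S \<Longrightarrow> p \<le> G"
  shows "generators (gen_set S) gen G"
proof
  show "finite (gen_set S)" using S by (simp add: gen_set_def)
  show "sqrt_independent gen (gen_set S)" using S by (rule sqrt_independent_gen)
  have g5: "5 \<le> exp (real G)"
  proof -
    have "5 \<le> exp (2::real)" using exp_lower_Taylor_quadratic[of 2] by simp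
    also have "\<dots> \<le> exp (real G)" using G(1) by simp
    finally show ?thesis .
  qed
  fix i assume i: "i \<in> gen_set S"
  have big: "1 < i \<Longrightarrow> i \<in> S" using i by (auto simp: gen_set_def)
  show "1 \<le> gen i" using golden_bounds by (auto simp: gen_def)
  consider "i = 0" | "i = 1" | "1 < i" by linarith
  then show "zgold (exp (real G)) (gen i)"
  proof cases
    case 1
    have "zgold 5 (sqrt 5)" by (rule zgoldI[of _ "-1" 2]) (auto simp: sqrt5_golden)
    then show ?thesis using 1 g5 zgold_mono by (simp add: gen_def)
  next
    case 2
    have "2 \<le> exp (real G)" using g5 by linarith
    then show ?thesis using 2 zgold_golden zgold_mono by (simp add: gen_def)
  next
    case 3
    have "real i \<le> real G" using G(2) big 3 by simp
    then have "real i \<le> exp (real G)" using le_exp_of_nat[of G] by linarith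
    then have "zgold (exp (real G)) (of_int (int i))" by (intro zgold_of_int) simp
    then show ?thesis using 3 by (simp add: gen_def)
  qed
qed

text \<open>The prime 5 is the square of the generator \<open>sqrt 5\<close>, so its multiplicity
  counts twice, and the factor \<open>sqrt 5\<close> on the left adds 1. The factorisation may be
  taken over \<open>insert 5 S\<close>, the exponent of 5 being 0 if 5 is not in
  \<open>S\<close>.\<close>

lemma ln_S_unit:
  assumes S: "finite S" "\<And>p. p \<in> S \<Longrightarrow> prime p" and n: "integral_S_unit S (int n)" "0 < n"
  shows "ln (sqrt 5 * real n) = (\<Sum>i\<in>gen_set S.
    real (if i = 0 then 1 + 2 * multiplicity 5 n else if i = 1 then 0 else multiplicity i n) * ln (gen i))"
proof -
  have pf: "prime_factors n \<subseteq> S"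
  proof
    fix p assume "p \<in> prime_factors n"
    then have "prime p" "p dvd n" by (auto simp: in_prime_factors_iff)
    then show "p \<in> S" using n(1) unfolding integral_S_unit_def by (auto simp: int_dvd_int_iff)
  qed
  have m0: "multiplicity p n = 0" if "prime p" "p \<notin> S" for p
  proof -
    have "\<not> p dvd n" using n(1) that unfolding integral_S_unit_def by (auto simp: int_dvd_int_iff)
    then show ?thesis by (simp add: not_dvd_imp_multiplicity_0)
  qed
  let ?S = "insert 5 S"
  have "n = (\<Prod>p\<in>prime_factors n. p ^ multiplicity p n)"
    using n(2) by (simp add: prime_factorization_nat[symmetric])
  also have "\<dots> = (\<Prod>p\<in>?S. p ^ multiplicity p n)"
  proof (rule prod.mono_neutral_left)
    show "\<forall>p\<in>?S - prime_factors n. p ^ multiplicity p n = 1"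
    proof
      fix p assume "p \<in> ?S - prime_factors n"
      then have "prime p" "p \<notin> prime_factors n" using S(2) by auto
      then have "\<not> p dvd n" using n(2) by (auto simp: in_prime_factors_iff)
      then show "p ^ multiplicity p n = 1" by (simp add: not_dvd_imp_multiplicity_0)
    qed
  qed (use S pf in auto)
  finally have "real n = real (\<Prod>p\<in>?S. p ^ multiplicity p n)" by (rule arg_cong)
  then have "real n = (\<Prod>p\<in>?S. real p ^ multiplicity p n)" by (simp only: of_nat_power of_nat_prod)
  then have "ln (real n) = (\<Sum>p\<in>?S. ln (real p ^ multiplicity p n))"
    using S prime_gt_0_nat by (auto intro!: ln_prod)
  also have "\<dots> = (\<Sum>p\<in>?S. real (multiplicity p n) * ln (real p))"
    using S prime_gt_0_nat by (intro sum.cong refl) (force simp: ln_realpow)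
  also have "\<dots> = real (multiplicity 5 n) * ln 5 + (\<Sum>p\<in>S - {5}. real (multiplicity p n) * ln (real p))"
    using S by (subst sum.insert_remove) auto
  also have "ln (5::real) = 2 * ln (sqrt 5)" by (simp add: ln_sqrt)
  finally have ln: "ln (real n) = 2 * real (multiplicity 5 n) * ln (sqrt 5)
    + (\<Sum>p\<in>S - {5}. real (multiplicity p n) * ln (real p))" by simp
  have S01: "0 \<notin> S" "1 \<notin> S" using S(2) not_prime_0 not_prime_1 by blast+
  have s: "(\<Sum>i\<in>S - {5}. real (if i = 0 then 1 + 2 * multiplicity 5 n else if i = 1 then 0 else multiplicity i n) * ln (gen i))
      = (\<Sum>p\<in>S - {5}. real (multiplicity p n) * ln (real p))"
  proof (rule sum.cong[OF refl])
    fix i assume "i \<in> S - {5}"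
    then have "i \<in> S" by simp
    then have "i \<noteq> 0" "i \<noteq> 1" using S01 by metis+
    then show "real (if i = 0 then 1 + 2 * multiplicity 5 n else if i = 1 then 0 else multiplicity i n) * ln (gen i)
        = real (multiplicity i n) * ln (real i)" by (simp add: gen_def)
  qed
  have "ln (sqrt 5 * real n) = ln (sqrt 5) + ln (real n)" using n(2) by (intro ln_mult_pos) auto
  also have "\<dots> = (1 + 2 * real (multiplicity 5 n)) * ln (sqrt 5)
    + (\<Sum>p\<in>S - {5}. real (multiplicity p n) * ln (real p))" unfolding ln by (simp add: algebra_simps)
  also have "\<dots> = (\<Sum>i\<in>insert 0 (insert 1 (S - {5})). real (if i = 0 then 1 + 2 * multiplicity 5 n else if i = 1 then 0 else multiplicity i n) * ln (gen i))"
    using S01 S(1) s by (simp add: gen_def)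
  finally show ?thesis unfolding gen_set_def by simp
qed

text \<open>Only the gaps between the leading index and the truncation points enter; \<open>0\<close> serves as the
  truncation point below all digits.\<close>

lemma gap_chain:
  fixes D :: "nat set" and C R :: real
  assumes D: "finite D" "D \<noteq> {}" "0 \<notin> D" and C: "0 \<le> C" and R: "1 \<le> R"
    and step: "\<And>q1 q. q1 \<in> D \<Longrightarrow> q < q1 \<Longrightarrow> (\<And>j. j \<in> D \<Longrightarrow> j < q1 \<Longrightarrow> j \<le> q) \<Longrightarrow>
      real (Max D - q) + C \<le> R * (real (Max D - q1) + C)"
  shows "real (Max D) + C \<le> C * R ^ card D"
proof -
  \<comment> \<open>Induction towards \<open>Max D\<close>: the bound at \<open>q\<close> follows
    from the one at the next digit \<open>q1\<close> above it, at the cost of a factor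
    \<open>R\<close>.\<close>
  have main: "real (Max D - q) + C \<le> C * R ^ card {j\<in>D. q < j}" if "q \<in> insert 0 D" for q
    using that
  proof (induction "Max D - q" arbitrary: q rule: less_induct)
    case less
    show ?case
    proof (cases "q < Max D")
      case False
      then have e: "{j\<in>D. q < j} = {}" using D(1) by (auto simp: not_less intro: order_trans[OF Max_ge])
      show ?thesis using False unfolding e by simp
    next
      case True
      let ?U = "{j\<in>D. q < j}"
      have U: "finite ?U" "?U \<noteq> {}" using D True Max_in by auto
      define q1 where "q1 = Min ?U"
      have q1: "q1 \<in> D" "q < q1" using Min_in[OF U] by (auto simp: q1_def)
      have q1m: "q1 \<le> Max D" using D(1) q1(1) by simp
      have below: "j \<le> q" if "j \<in> D" "j < q1" for j
      proof (rule ccontr)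
        assume "\<not> j \<le> q"
        then have "q1 \<le> j" unfolding q1_def using U that by (intro Min_le) auto
        then show False using that by simp
      qed
      have eq: "?U = insert q1 {j\<in>D. q1 < j}"
        using q1 below by (auto simp: not_less) (metis leI le_less_trans le_neq_implies_less less_irrefl)
      have "card ?U = Suc (card {j\<in>D. q1 < j})" unfolding eq using D(1) by (subst card_insert_disjoint) auto
      moreover have "real (Max D - q) + C \<le> R * (real (Max D - q1) + C)"
        by (rule step[OF q1 below])
      moreover have "real (Max D - q1) + C \<le> C * R ^ card {j\<in>D. q1 < j}"
        using less.hyps[of q1] q1 q1m by simp
      then have "R * (real (Max D - q1) + C) \<le> R * (C * R ^ card {j\<in>D. q1 < j})"
        using R by (intro mult_left_mono) auto
      ultimately show ?thesis by (simp add: mult_ac)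
    qed
  qed
  have "{j\<in>D. 0 < j} = D" using D(3) by (metis (mono_tags, lifting) Collect_mem_eq Collect_cong gr0I)
  then show ?thesis using main[of 0] by simp
qed

lemma fib_Suc_le_pow2: "fib (Suc n) \<le> 2 ^ n"
proof (induction n rule: fib.induct)
  case (3 n)
  then show ?case by simp
qed auto

text \<open>For \<open>q < q1\<close> without a digit in between, the digits from \<open>q1\<close>
  on make up \<alpha>, and the ratio \<open>x\<close> of \<open>sqrt 5 * n\<close> to
  \<open>golden ^ q1 * \<alpha>\<close> is exponentially close to 1 in \<open>t - q\<close>. The
  lower bound for \<open>\<bar>ln x\<bar>\<close> has an exponent linear in \<open>t - q1\<close>;
  comparing the two gives the step of \<open>gap_chain\<close>.\<close>

lemma zeckendorf_gap_bound:
  fixes S D :: "nat set" and n G K m1 N h J B B' C :: nat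
  assumes S: "finite S" "\<And>p. p \<in> S \<Longrightarrow> prime p" and n: "integral_S_unit S (int n)" "2 \<le> n"
    and Z: "is_zeckendorf n D" and G: "2 \<le> G" "\<And>p. p \<in> S \<Longrightarrow> p \<le> G"
    and r: "r = card (gen_set S)" and t: "t = Max D" and C: "C = r * G + 3" and h: "1 \<le> h"
    and K: "5 * exp (1 + real (r * G)) \<le> real K" and m1: "t + 1 \<le> 2 ^ m1"
    and N: "N = m1 + (2 * K + 1)\<^sup>2 + 1" and B: "B = 2 * t + 1" and B': "B' = 2 ^ (2 * N + 2) * B"
    and hB: "ln (2 * real (J ^ (3 * r + 4) * (t + C)) * real B') \<le> real h" and Jh: "ln (real h) \<le> real J"
    and J: "160 * 2 ^ (r + 2) * (r * G + 2) \<le> J" and J2: "J ^ (3 * r + 4) < 2 ^ J"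
  shows "real t + real C \<le> real C * (14 * real (J ^ (3 * r + 9) * h)) ^ card D"
proof -
  interpret generators "gen_set S" gen G by (rule generators_gen[OF S G])
  have fin: "finite D" using Z by (simp add: is_zeckendorf_def)
  have ne: "D \<noteq> {}" using zeckendorf_empty_iff[OF Z] n(2) by simp
  have D2: "2 \<le> j" if "j \<in> D" for j using Z that by (simp add: is_zeckendorf_def)
  have tD: "t \<in> D" unfolding t using fin ne by simp
  have tm: "j \<le> t" if "j \<in> D" for j unfolding t using fin that by simp
  have nt: "n < 2 ^ t"
    using zeckendorf_Max(2)[OF Z ne] fib_Suc_le_pow2[of "Max D"] unfolding t by linarith
  have J1: "1 \<le> J"
  proof -
    have "1 * 1 * 1 \<le> 160 * 2 ^ (r + 2) * (r * G + 2)" by (intro mult_le_mono) auto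
    then show ?thesis using J by simp
  qed
  define R where "R = 14 * real (J ^ (3 * r + 9) * h)"
  have Jh1: "1 \<le> real (J ^ (3 * r + 9) * h)"
  proof -
    have "1 * 1 \<le> J ^ (3 * r + 9) * h" using J1 h by (intro mult_le_mono) auto
    then show ?thesis by (metis mult_1 of_nat_1 of_nat_mono)
  qed
  have r1: "1 \<le> r"
  proof -
    have "0 \<in> gen_set S" by (simp add: gen_set_def)
    then show ?thesis unfolding r using finI by (metis One_nat_def Suc_leI card_gt_0_iff empty_iff)
  qed
  have g1: "1 < golden" "0 < golden" using golden_bounds by auto
  have lng: "1 / 3 \<le> ln golden"
  proof -
    have "ln (1 / golden) \<le> 1 / golden - 1" using g1 by (intro ln_le_minus_one) auto
    moreover have "1 / golden \<le> 2 / 3" using golden_bounds by (simp add: field_simps)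
    ultimately show ?thesis using g1 by (simp add: ln_div)
  qed
  have mult_t: "multiplicity p n \<le> t" if p: "prime p" for p
  proof -
    have "p ^ multiplicity p n \<le> n" using n(2) by (intro dvd_imp_le multiplicity_dvd) auto
    moreover have "2 ^ multiplicity p n \<le> p ^ multiplicity p n"
      using prime_ge_2_nat[OF p] by (intro power_mono) auto
    ultimately have "(2::nat) ^ multiplicity p n < 2 ^ t" using nt by linarith
    then show ?thesis by simp
  qed
  have "real (Max D) + real C \<le> real C * R ^ card D"
  proof (rule gap_chain[OF fin ne])
    show "0 \<notin> D" using D2 by fastforce
    show "1 \<le> R" unfolding R_def using Jh1 by simp
    fix q1 q assume q1: "q1 \<in> D" and q: "q < q1" and below: "\<And>j. j \<in> D \<Longrightarrow> j < q1 \<Longrightarrow> j \<le> q"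
    define A where "A = {j\<in>D. q1 \<le> j}"
    define \<alpha> where "\<alpha> = (\<Sum>j\<in>A. golden ^ (j - q1))"
    \<comment> \<open>\<alpha> is a sum of distinct powers of \<open>golden\<close> with exponents
      up to \<open>t - q1\<close>, and \<open>golden\<close> has size 2; so the size of \<alpha> is
      at most \<open>2 ^ M\<close>.\<close>
    define M where "M = t - q1 + 1"
    have finA: "finite A" "q1 \<in> A" "t \<in> A" using fin q1 tD tm by (auto simp: A_def)
    have ga: "golden ^ q1 * \<alpha> = (\<Sum>j\<in>A. golden ^ j)"
      unfolding \<alpha>_def sum_distrib_left by (rule sum.cong) (auto simp: A_def power_add[symmetric])
    have "golden ^ (q1 - q1) \<le> \<alpha>"
      unfolding \<alpha>_def using finA g1 by (intro member_le_sum) auto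
    then have \<alpha>1: "1 \<le> \<alpha>" by simp
    have z\<alpha>: "zgold (exp (real M)) \<alpha>"
    proof (rule zgold_mono)
      show "zgold (\<Sum>j\<in>A. 2 ^ (j - q1)) \<alpha>"
        unfolding \<alpha>_def by (intro zgold_sum zgold_power zgold_golden)
      have "inj_on (\<lambda>j. j - q1) A" by (rule inj_onI) (auto simp: A_def)
      then have "(\<Sum>j\<in>A. 2 ^ (j - q1)) = (\<Sum>i\<in>(\<lambda>j. j - q1) ` A. (2::nat) ^ i)"
        by (simp add: sum.reindex)
      also have "\<dots> \<le> (\<Sum>i<M. 2 ^ i)"
        using tm by (intro sum_mono2) (auto simp: A_def M_def less_Suc_eq_le diff_le_mono)
      also have "\<dots> \<le> 2 ^ M" unfolding lessThan_atLeast0 sum_power2 by simp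
      finally have "real (\<Sum>j\<in>A. 2 ^ (j - q1)) \<le> real (2 ^ M)" by (rule of_nat_mono)
      then have "(\<Sum>j\<in>A. 2 ^ (j - q1)) \<le> (2::real) ^ M" by simp
      also have "\<dots> \<le> exp 1 ^ M" using exp_ge_add_one_self[of "1::real"] by (intro power_mono) auto
      also have "\<dots> = exp (real M)" by (simp add: exp_of_nat_mult[symmetric])
      finally show "(\<Sum>j\<in>A. 2 ^ (j - q1)) \<le> exp (real M)" .
    qed
    define e :: "nat \<Rightarrow> nat" where
      "e i = (if i = 0 then 1 + 2 * multiplicity 5 n else if i = 1 then 0 else multiplicity i n)" for i
    \<comment> \<open>The index 1 is \<open>golden\<close>; its coefficient carries the power
      \<open>golden ^ q1\<close> that was split off from \<alpha>.\<close>
    define b :: "nat \<Rightarrow> int" where "b i = (if i = 1 then - int q1 else int (e i))" for i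
    have prI: "prime i" if "i \<in> gen_set S" "i \<noteq> 0" "i \<noteq> 1" for i
      using that S(2) by (auto simp: gen_set_def)
    have bB: "\<bar>b i\<bar> \<le> int B" if i: "i \<in> gen_set S" for i
    proof -
      have "prime (5::nat)" by simp
      then have "multiplicity 5 n \<le> t" by (rule mult_t)
      moreover have "multiplicity i n \<le> t" if "i \<noteq> 0" "i \<noteq> 1" using mult_t[OF prI[OF i that]] .
      moreover have "q1 \<le> t" using tm[OF q1] .
      ultimately show ?thesis unfolding b_def e_def B by auto
    qed
    have sb: "(\<Sum>i\<in>gen_set S. of_int (b i) * ln (gen i)) = ln (sqrt 5 * real n) - real q1 * ln golden"
    proof -
      have "1 \<in> gen_set S" by (simp add: gen_set_def)
      then have "(\<Sum>i\<in>gen_set S. of_int (b i) * ln (gen i))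
        = of_int (b 1) * ln (gen 1) + (\<Sum>i\<in>gen_set S - {1}. of_int (b i) * ln (gen i))"
        using finI by (simp add: sum.remove)
      also have "(\<Sum>i\<in>gen_set S - {1}. of_int (b i) * ln (gen i)) = (\<Sum>i\<in>gen_set S - {1}. real (e i) * ln (gen i))"
        by (rule sum.cong) (auto simp: b_def)
      also have "\<dots> = (\<Sum>i\<in>gen_set S. real (e i) * ln (gen i))"
        using finI \<open>1 \<in> gen_set S\<close> by (simp add: sum.remove[of _ 1] e_def)
      also have "\<dots> = ln (sqrt 5 * real n)"
        unfolding e_def using n(2) by (intro ln_S_unit[symmetric] S n(1)) auto
      finally show ?thesis by (simp add: b_def gen_def)
    qed
    define x where "x = sqrt 5 * real n / (golden ^ q1 * \<alpha>)"
    have ga0: "0 < golden ^ q1 * \<alpha>" using g1 \<alpha>1 by simp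
    have n0: "0 < sqrt 5 * real n" using n(2) by simp
    define \<Lambda> where "\<Lambda> = ln \<alpha> - (\<Sum>i\<in>gen_set S. of_int (b i) * ln (gen i))"
    have Lx: "\<Lambda> = - ln x"
    proof -
      have "ln x = ln (sqrt 5 * real n) - ln (golden ^ q1 * \<alpha>)"
        unfolding x_def by (rule ln_divide_pos[OF n0 ga0])
      also have "ln (golden ^ q1 * \<alpha>) = real q1 * ln golden + ln \<alpha>"
        using g1 \<alpha>1 by (subst ln_mult_pos) (auto simp: ln_realpow)
      finally show ?thesis unfolding \<Lambda>_def sb by simp
    qed
    note tr = zeckendorf_truncation[OF Z q1 q below, folded A_def ga]
    have "x \<noteq> 1" unfolding x_def using tr(2) n(2) ga0 by (auto simp: divide_eq_1_iff)
    moreover have "0 < x" unfolding x_def using ga0 n0 by (rule divide_pos_pos[rotated])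
    ultimately have nz: "\<Lambda> \<noteq> 0" unfolding Lx by simp
    define Z' where "Z' = real (J ^ (3 * r + 9) * h * (M + r * G + 2))"
    have low: "exp (- Z' - real h) < \<bar>\<Lambda>\<bar>"
      unfolding Z'_def \<Lambda>_def r
    proof (rule linear_form_lower[where K = K and ?m1.0 = m1 and N = N and B = B and B' = B' and M = M])
      show "ln (2 * real (J ^ (3 * card (gen_set S) + 4) * (M + card (gen_set S) * G + 2)) * real B') \<le> real h"
      proof -
        have "J ^ (3 * r + 4) * (M + r * G + 2) \<le> J ^ (3 * r + 4) * (t + C)"
          unfolding C M_def by (intro mult_le_mono2) simp
        then have "real (J ^ (3 * r + 4) * (M + r * G + 2)) \<le> real (J ^ (3 * r + 4) * (t + C))"
          by (rule of_nat_mono)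
        then have "2 * real (J ^ (3 * r + 4) * (M + r * G + 2)) * real B'
          \<le> 2 * real (J ^ (3 * r + 4) * (t + C)) * real B'" by (intro mult_right_mono) auto
        moreover have "0 < 2 * real (J ^ (3 * r + 4) * (M + r * G + 2)) * real B'"
        proof -
          have "0 < J ^ (3 * r + 4) * (M + r * G + 2)" "0 < B'" unfolding B' B using J1 by simp_all
          then have "0 < real (J ^ (3 * r + 4) * (M + r * G + 2))" "0 < real B'"
            by (simp_all only: of_nat_0_less_iff)
          then show ?thesis by (intro mult_pos_pos[OF mult_pos_pos[OF zero_less_numeral]])
        qed
        ultimately show ?thesis using hB unfolding r
          by (meson ln_le_cancel_iff less_le_trans order_trans)
      qed
      have "M \<le> t + 1" by (simp add: M_def)
      then show "M \<le> 2 ^ m1" using m1 by linarith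
    qed (use \<alpha>1 z\<alpha> bB nz h K N B' Jh J J2 G r r1 B in \<open>auto simp: \<Lambda>_def\<close>)
    \<comment> \<open>This is the origin of \<open>C\<close>: the height parameter of the linear
      form is \<open>t - q1\<close> plus a constant independent of the truncation, and that constant
      becomes the shift in \<open>gap_chain\<close>.\<close>
    have MC: "real (M + r * G + 2) = real (t - q1) + real C" unfolding M_def C by simp
    have Z1: "real C \<le> Z'" "1 \<le> Z'" "real h \<le> Z'" "3 \<le> Z'"
    proof -
      have c3: "3 \<le> real C" unfolding C by simp
      have "1 * (real (t - q1) + real C) \<le> real (J ^ (3 * r + 9) * h) * (real (t - q1) + real C)"
        using Jh1 by (intro mult_right_mono) auto
      also have "\<dots> = Z'" unfolding Z'_def MC[symmetric] by (simp only: of_nat_mult)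
      finally have z: "real (t - q1) + real C \<le> Z'" by simp
      then show "real C \<le> Z'" by simp
      then show "3 \<le> Z'" "1 \<le> Z'" using c3 by linarith+
      have "h \<le> J ^ (3 * r + 9) * h * (M + r * G + 2)"
        using mult_le_mono[OF mult_le_mono[of 1 "J ^ (3 * r + 9)" h h], of 1 "M + r * G + 2"] J1 by simp
      then show "real h \<le> Z'" unfolding Z'_def by (rule of_nat_mono)
    qed
    \<comment> \<open>For \<open>t - q\<close> below 6 the bound is trivial; from 6 on the relative
      error is at most 1/2, as \<open>abs_ln_le\<close> requires.\<close>
    have "real (t - q) + real C \<le> 14 * Z'"
    proof (cases "q + 6 \<le> t")
      case False
      then have "real (t - q) \<le> 6" by simp
      then show ?thesis using Z1 by linarith
    next
      case True
      define d where "d = t - (q + 4)"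
      have d: "t = q + 4 + d" "2 \<le> d" using True by (auto simp: d_def)
      have gt: "golden ^ t \<le> golden ^ q1 * \<alpha>"
        unfolding ga using finA g1 by (intro member_le_sum) auto
      have "golden ^ q1 * \<alpha> \<noteq> 0" using ga0 by (rule less_imp_neq[symmetric])
      then have "golden ^ q1 * \<alpha> / (golden ^ q1 * \<alpha>) = 1" by (rule divide_self)
      then have "x - 1 = (sqrt 5 * real n - golden ^ q1 * \<alpha>) / (golden ^ q1 * \<alpha>)"
        unfolding x_def diff_divide_distrib by (rule arg_cong[OF sym])
      then have "\<bar>x - 1\<bar> = \<bar>sqrt 5 * real n - golden ^ q1 * \<alpha>\<bar> / (golden ^ q1 * \<alpha>)"
        using ga0 by (simp only: abs_divide abs_of_pos)
      also have "\<dots> \<le> golden ^ (q + 4) / golden ^ t"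
        using tr(1) gt g1 by (intro frac_le) auto
      also have "\<dots> = 1 / golden ^ d" unfolding d(1) using g1 by (simp add: power_add)
      finally have x1: "\<bar>x - 1\<bar> \<le> 1 / golden ^ d" .
      have "2 \<le> golden ^ 2" using golden_bounds by (simp add: power2_eq_square golden_square)
      also have "\<dots> \<le> golden ^ d" using d(2) g1 by (intro power_increasing) auto
      finally have "1 / golden ^ d \<le> 1 / 2" by (intro divide_left_mono) auto
      then have "\<bar>\<Lambda>\<bar> \<le> 2 * (1 / golden ^ d)" unfolding Lx using abs_ln_le[OF x1] by simp
      then have "exp (- Z' - real h) < 2 / golden ^ d" using low by simp
      then have "ln (exp (- Z' - real h)) < ln (2 / golden ^ d)" using g1 by (subst ln_less_cancel_iff) auto
      also have "\<dots> = ln 2 - real d * ln golden" using g1 by (simp add: ln_div ln_realpow)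
      finally have "real d * ln golden < ln 2 + Z' + real h" by simp
      moreover have "real d * (1 / 3) \<le> real d * ln golden" using lng by (intro mult_left_mono) auto
      moreover have "ln (2::real) \<le> 1" using ln_le_minus_one[of "2::real"] by simp
      \<comment> \<open>With \<open>t - q = d + 4\<close> and the summand \<open>C\<close> the total
        is at most \<open>7 + 3 * Z' + 3 * h + C\<close>. Each of 1, \<open>h\<close> and
        \<open>C\<close> is at most \<open>Z'\<close>, which gives the constant 14.\<close>
      ultimately have "real d \<le> 3 + 3 * Z' + 3 * real h" by linarith
      moreover have "real (t - q) = real d + 4" using d(1) by simp
      ultimately show ?thesis using Z1 by linarith
    qed
    then show "real (Max D - q) + real C \<le> R * (real (Max D - q1) + real C)"
      unfolding R_def t[symmetric] Z'_def of_nat_mult[of _ "M + r * G + 2"] MC by (simp add: mult_ac)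
  qed auto
  then show ?thesis unfolding R_def t .
qed

section \<open>An effectively computable threshold\<close>

text \<open>\<open>total_recursive\<close> is about a function on all lists, yet only lists of
  length \<open>n\<close> matter. Closing under agreement on those allows a computed function to be
  written in any convenient form.\<close>

definition computes :: "nat \<Rightarrow> (nat list \<Rightarrow> nat) \<Rightarrow> bool" where
  "computes n F \<longleftrightarrow> (\<exists>f. total_recursive n f \<and> (\<forall>xs. length xs = n \<longrightarrow> f xs = F xs))"

lemma computes_proj: "i < n \<Longrightarrow> computes n (\<lambda>xs. xs ! i)"
  unfolding computes_def using total_recursive.proj by blast

lemma computes_comp1:
  assumes "computes 1 (\<lambda>xs. H (xs ! 0))" "computes n F"
  shows "computes n (\<lambda>xs. H (F xs))"
proof -
  from assms obtain h f where h: "total_recursive 1 h" "\<And>xs. length xs = 1 \<Longrightarrow> h xs = H (xs ! 0)"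
    and f: "total_recursive n f" "\<And>xs. length xs = n \<Longrightarrow> f xs = F xs" unfolding computes_def by blast
  have "total_recursive n (\<lambda>xs. h (map (\<lambda>g. g xs) [f]))"
    using h(1) f(1) by (intro total_recursive.comp) auto
  then show ?thesis unfolding computes_def using h(2) f(2)
    by (intro exI[of _ "\<lambda>xs. h (map (\<lambda>g. g xs) [f])"]) auto
qed

lemma computes_comp2:
  assumes "computes 2 (\<lambda>xs. H (xs ! 0) (xs ! 1))" "computes n F" "computes n F'"
  shows "computes n (\<lambda>xs. H (F xs) (F' xs))"
proof -
  from assms obtain h f f' where h: "total_recursive 2 h" "\<And>xs. length xs = 2 \<Longrightarrow> h xs = H (xs ! 0) (xs ! 1)"
    and f: "total_recursive n f" "\<And>xs. length xs = n \<Longrightarrow> f xs = F xs"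
    and f': "total_recursive n f'" "\<And>xs. length xs = n \<Longrightarrow> f' xs = F' xs" unfolding computes_def by blast
  have "total_recursive n (\<lambda>xs. h (map (\<lambda>g. g xs) [f, f']))"
    using h(1) f(1) f'(1) by (intro total_recursive.comp) (auto simp: numeral_2_eq_2)
  then show ?thesis unfolding computes_def using h(2) f(2) f'(2)
    by (intro exI[of _ "\<lambda>xs. h (map (\<lambda>g. g xs) [f, f'])"]) auto
qed

lemma computes_Suc: "computes n F \<Longrightarrow> computes n (\<lambda>xs. Suc (F xs))"
  by (rule computes_comp1[where H = Suc]) (unfold computes_def, use total_recursive.succ in blast)

lemma computes_const: "computes n (\<lambda>xs. k)"
proof (induction k)
  case 0
  show ?case unfolding computes_def using total_recursive.zero by blast
qed (rule computes_Suc)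

lemma computes_rec:
  assumes "computes n F" "computes (Suc (Suc n)) (\<lambda>xs. H (xs ! 0) (xs ! 1) (tl (tl xs)))"
  shows "computes (Suc n) (\<lambda>xs. rec_nat (F (tl xs)) (\<lambda>k r. H k r (tl xs)) (hd xs))"
proof -
  from assms obtain f h where f: "total_recursive n f" "\<And>xs. length xs = n \<Longrightarrow> f xs = F xs"
    and h: "total_recursive (Suc (Suc n)) h"
      "\<And>xs. length xs = Suc (Suc n) \<Longrightarrow> h xs = H (xs ! 0) (xs ! 1) (tl (tl xs))"
    unfolding computes_def by blast
  have "total_recursive (Suc n) (\<lambda>xs. rec_nat (f (tl xs)) (\<lambda>k r. h (k # r # tl xs)) (hd xs))"
    using f(1) h(1) by (rule total_recursive.prim_rec)
  moreover have "rec_nat (f (tl xs)) (\<lambda>k r. h (k # r # tl xs)) m = rec_nat (F (tl xs)) (\<lambda>k r. H k r (tl xs)) m"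
    if "length xs = Suc n" for xs m
    using that f(2) h(2) by (induction m) auto
  ultimately show ?thesis unfolding computes_def by blast
qed

lemma computes_add:
  assumes "computes n F" "computes n F'"
  shows "computes n (\<lambda>xs. F xs + F' xs)"
proof (rule computes_comp2[OF _ assms])
  have "computes (Suc 1) (\<lambda>xs. rec_nat (tl xs ! 0) (\<lambda>k r. Suc r) (hd xs))"
    by (rule computes_rec[where H = "\<lambda>k r ys. Suc r"]) (auto intro: computes_proj computes_Suc)
  moreover have "rec_nat y (\<lambda>k r. Suc r) x = x + y" for x y :: nat by (induction x) auto
  moreover have "tl xs ! 0 = xs ! 1" "hd xs = xs ! 0" if "length xs = Suc 1" for xs :: "nat list"
    using that by (cases xs; auto simp: nth_tl)+
  ultimately show "computes 2 (\<lambda>xs. xs ! 0 + xs ! 1)"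
    unfolding computes_def numeral_2_eq_2 One_nat_def by metis
qed

lemma computes_mult:
  assumes "computes n F" "computes n F'"
  shows "computes n (\<lambda>xs. F xs * F' xs)"
proof (rule computes_comp2[OF _ assms])
  have "computes (Suc (Suc 1)) (\<lambda>xs. xs ! 1 + xs ! 2)"
    by (intro computes_add computes_proj) auto
  moreover have "tl (tl xs) ! 0 = xs ! 2" if "length xs = Suc (Suc 1)" for xs :: "nat list"
    using that by (auto simp: nth_tl numeral_2_eq_2)
  ultimately have "computes (Suc (Suc 1)) (\<lambda>xs. xs ! 1 + tl (tl xs) ! 0)"
    unfolding computes_def by metis
  then have "computes (Suc 1) (\<lambda>xs. rec_nat 0 (\<lambda>k r. r + tl xs ! 0) (hd xs))"
    by (intro computes_rec[where H = "\<lambda>k r ys. r + ys ! 0"] computes_const)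
  moreover have "rec_nat 0 (\<lambda>k r. r + y) x = x * y" for x y :: nat by (induction x) auto
  moreover have "tl xs ! 0 = xs ! 1" "hd xs = xs ! 0" if "length xs = Suc 1" for xs :: "nat list"
    using that by (cases xs; auto simp: nth_tl)+
  ultimately show "computes 2 (\<lambda>xs. xs ! 0 * xs ! 1)"
    unfolding computes_def numeral_2_eq_2 One_nat_def by metis
qed

lemma computes_pow2:
  assumes "computes n F"
  shows "computes n (\<lambda>xs. 2 ^ F xs)"
proof (rule computes_comp1[OF _ assms])
  have "computes (Suc (Suc 0)) (\<lambda>xs. xs ! 1 + xs ! 1)"
    by (intro computes_add computes_proj) auto
  then have "computes (Suc 0) (\<lambda>xs. rec_nat 1 (\<lambda>k r. r + r) (hd xs))"
    by (intro computes_rec[where H = "\<lambda>k r ys. r + r"] computes_const)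
  moreover have "rec_nat 1 (\<lambda>k r. r + r) x = (2::nat) ^ x" for x :: nat by (induction x) auto
  moreover have "hd xs = xs ! 0" if "length xs = Suc 0" for xs :: "nat list"
    using that by (cases xs) auto
  ultimately show "computes 1 (\<lambda>xs. 2 ^ (xs ! 0))"
    unfolding computes_def One_nat_def by metis
qed

section \<open>Elementary estimates and explicit constants\<close>

lemma exp_le_pow2: "exp (real x) \<le> real (2 ^ 2 ^ x)"
proof -
  have "2 * x \<le> 2 ^ x"
  proof (induction x)
    case (Suc x)
    have "x = 0 \<or> (2::nat) \<le> 2 ^ x" by (cases x) auto
    then show ?case using Suc by auto
  qed simp
  have "exp (real x) = exp 1 ^ x" by (simp add: exp_of_nat_mult[symmetric])
  also have "\<dots> \<le> 4 ^ x" using e_less_272 by (intro power_mono) auto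
  also have "\<dots> = 2 ^ (2 * x)" by (simp add: power_mult)
  also have "\<dots> \<le> 2 ^ 2 ^ x" using \<open>2 * x \<le> 2 ^ x\<close> by (intro power_increasing) auto
  finally show ?thesis by simp
qed

text \<open>Since \<open>ln J < 2 * sqrt J\<close> and \<open>3 * m \<le> sqrt J\<close>, for
  positive \<open>m\<close> the number \<open>m * ln J\<close> is below \<open>2 / 3 * J\<close>,
  and 2/3 is at most \<open>ln 2\<close>.\<close>

lemma power_less_pow2:
  fixes J m :: nat
  assumes "9 * m ^ 2 \<le> J" "1 \<le> J"
  shows "J ^ m < 2 ^ J"
proof (cases "m = 0")
  case True
  then show ?thesis using assms one_less_power[of "2::nat" J] by simp
next
  case False
  have J: "1 \<le> real J" using assms by simp
  have "ln (real J) = 2 * ln (sqrt (real J))" using J by (simp add: ln_sqrt)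
  also have "\<dots> \<le> 2 * (sqrt (real J) - 1)" using J ln_le_minus_one[of "sqrt (real J)"] by simp
  finally have "ln (real J) < 2 * sqrt (real J)" by simp
  then have "real m * ln (real J) < real m * (2 * sqrt (real J))" using False by simp
  also have "\<dots> = 2 / 3 * ((3 * real m) * sqrt (real J))" by simp
  also have "\<dots> \<le> 2 / 3 * (sqrt (real J) * sqrt (real J))"
  proof -
    have "(3 * real m)\<^sup>2 \<le> real J" using of_nat_mono[OF assms(1), where 'a = real] by (simp add: power_mult_distrib)
    then have "3 * real m \<le> sqrt (real J)" by (rule real_le_rsqrt)
    then show ?thesis by (intro mult_left_mono mult_right_mono) auto
  qed
  also have "\<dots> = 2 / 3 * real J" using J by simp
  also have "\<dots> \<le> real J * ln 2" using ln2_ge_two_thirds J by (simp add: mult_left_mono mult.commute)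
  finally have "ln (real J ^ m) < ln (2 ^ J)" using J by (simp add: ln_realpow)
  then have "real J ^ m < 2 ^ J" using J by (subst (asm) ln_less_cancel_iff) auto
  then have "real (J ^ m) < real (2 ^ J)" by simp
  then show ?thesis by (simp only: of_nat_less_iff)
qed

lemma golden_pow_le_fib: "1 \<le> t \<Longrightarrow> golden ^ t \<le> golden\<^sup>2 * real (fib t)"
proof (induction t rule: fib.induct)
  case 2
  show ?case using golden_bounds by (simp add: power2_eq_square)
next
  case (3 n)
  show ?case
  proof (cases "n = 0")
    case True
    then show ?thesis by (simp add: power2_eq_square numeral_2_eq_2)
  next
    case False
    have "golden ^ Suc (Suc n) = golden ^ n * (golden * golden)" by simp
    also have "\<dots> = golden ^ Suc n + golden ^ n" unfolding golden_square by (simp add: algebra_simps)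
    also have "\<dots> \<le> golden\<^sup>2 * real (fib (Suc n)) + golden\<^sup>2 * real (fib n)"
      using 3 False by (intro add_mono) auto
    finally show ?thesis by (simp add: algebra_simps)
  qed
qed simp

text \<open>\<open>Q\<close> bounds the primes, the number \<open>r\<close> of generators and the
  reciprocal of \<epsilon>. The first summand is what the linear form estimate demands of
  \<open>J\<close>, the second what \<open>power_less_pow2\<close> demands for the exponent
  \<open>3 * r + 4\<close>.\<close>

definition thr_J :: "nat \<Rightarrow> nat" where
  "thr_J Q = 160 * 2 ^ (Q + 2) * (Q * Q + 2) + 9 * ((3 * Q + 4) * (3 * Q + 4))"

text \<open>Majorises \<open>5 * exp (1 + r * Q)\<close> by means of
  \<open>exp 1 \<le> 4\<close>.\<close>

definition thr_K :: "nat \<Rightarrow> nat" where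
  "thr_K Q = 5 * 2 ^ (2 * (1 + Q * Q))"

text \<open>The part of \<open>2 * N + 2\<close> that does not depend on \<open>n\<close>; the rest
  is \<open>2 * m1\<close>.\<close>

definition thr_c :: "nat \<Rightarrow> nat" where
  "thr_c Q = 2 * ((2 * thr_K Q + 1) * (2 * thr_K Q + 1)) + 4"

text \<open>The size required of \<open>w = ln (ln (ln n))\<close>. The first summands dominate the
  constants in \<open>h\<close> and \<open>J\<close>, the square makes the error of order
  \<open>sqrt w\<close> in \<open>ln R\<close> at most \<open>\<epsilon> / 2 * w\<close>, and the
  last one dominates \<open>2 * C * Q\<close>.\<close>

definition thr_W :: "nat \<Rightarrow> nat" where
  "thr_W Q = 17 + thr_c Q + (3 * Q + 4) + thr_J Q
     + (2 * (9 * Q + 33) * Q) * (2 * (9 * Q + 33) * Q) + 2 * (Q * Q + 3) * Q"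

text \<open>Three nested exponentials, each replaced by two powers of 2 through
  \<open>exp x \<le> 2 ^ 2 ^ x\<close>, so that only functions known to be recursive occur.\<close>

definition threshold :: "nat \<Rightarrow> nat" where
  "threshold Q = 2 ^ 2 ^ 2 ^ 2 ^ 2 ^ 2 ^ thr_W Q"

lemma computes_threshold: "computes n F \<Longrightarrow> computes n (\<lambda>xs. threshold (F xs))"
  unfolding threshold_def thr_W_def thr_c_def thr_K_def thr_J_def
  by (intro computes_pow2 computes_add computes_mult computes_const)

lemma threshold_less:
  assumes "threshold Q < n"
  shows "real (thr_W Q) \<le> ln (ln (ln (real n)))" "0 < ln (ln (real n))" "0 < ln (real n)"
proof -
  let ?W = "thr_W Q"
  have "exp (exp (exp (real ?W))) \<le> exp (exp (real (2 ^ 2 ^ ?W)))"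
    using exp_le_pow2[of ?W] by simp
  also have "\<dots> \<le> exp (real (2 ^ 2 ^ 2 ^ 2 ^ ?W))" using exp_le_pow2[of "2 ^ 2 ^ ?W"] by simp
  also have "\<dots> \<le> real (threshold Q)" unfolding threshold_def by (rule exp_le_pow2)
  also have "\<dots> < real n" using assms by simp
  finally have e: "exp (exp (exp (real ?W))) < real n" .
  then have n0: "0 < real n" by (rule less_trans[rotated]) simp
  have 1: "exp (exp (real ?W)) < ln (real n)"
    using e n0 by (metis exp_less_cancel_iff exp_ln)
  then have l0: "0 < ln (real n)" by (rule less_trans[rotated]) simp
  have 2: "exp (real ?W) < ln (ln (real n))"
    using 1 l0 by (metis exp_less_cancel_iff exp_ln)
  then have l1: "0 < ln (ln (real n))" by (rule less_trans[rotated]) simp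
  have "real ?W < ln (ln (ln (real n)))"
    using 2 l1 by (metis exp_less_cancel_iff exp_ln)
  then show "real ?W \<le> ln (ln (ln (real n)))" by simp
  show "0 < ln (ln (real n))" "0 < ln (real n)" by (rule l1, rule l0)
qed

lemma ln_leI: "0 < x \<Longrightarrow> x \<le> exp y \<Longrightarrow> ln x \<le> y" for x y :: real
  by (metis exp_le_cancel_iff exp_ln)

lemma ex_pow2_between:
  assumes "1 \<le> x"
  shows "\<exists>m. x \<le> 2 ^ m \<and> (2::nat) ^ m \<le> 2 * x"
  using assms
proof (induction x rule: nat_induct_at_least)
  case base
  show ?case by (intro exI[of _ 0]) simp
next
  case (Suc x)
  then obtain m where m: "x \<le> 2 ^ m" "(2::nat) ^ m \<le> 2 * x" by blast
  show ?case
  proof (cases "Suc x \<le> 2 ^ m")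
    case True
    then show ?thesis using m by (intro exI[of _ m]) simp
  next
    case False
    then show ?thesis using m Suc by (intro exI[of _ "Suc m"]) simp
  qed
qed

lemma card_gen_set_le: "finite S \<Longrightarrow> card (gen_set S) \<le> card S + 2"
proof -
  assume S: "finite S"
  have "card (gen_set S) \<le> card {0, 1 :: nat} + card (S - {5})" unfolding gen_set_def by (rule card_Un_le)
  also have "card (S - {5}) \<le> card S" using S by (intro card_mono) auto
  finally show ?thesis by simp
qed

lemma thr_J_ge:
  assumes "r \<le> Q"
  shows "160 * 2 ^ (r + 2) * (r * Q + 2) \<le> thr_J Q" "9 * (3 * r + 4) ^ 2 \<le> thr_J Q" "640 \<le> thr_J Q"
proof -
  have "160 * 2 ^ (r + 2) * (r * Q + 2) \<le> 160 * 2 ^ (Q + 2) * (Q * Q + 2)"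
    using assms by (intro mult_le_mono power_increasing add_le_mono) auto
  then show "160 * 2 ^ (r + 2) * (r * Q + 2) \<le> thr_J Q" unfolding thr_J_def by linarith
  have "9 * (3 * r + 4) ^ 2 \<le> 9 * ((3 * Q + 4) * (3 * Q + 4))"
    unfolding power2_eq_square using assms by (intro mult_le_mono) auto
  then show "9 * (3 * r + 4) ^ 2 \<le> thr_J Q" unfolding thr_J_def by linarith
  have "160 * 2 ^ 2 * 2 \<le> 160 * 2 ^ (Q + 2) * (Q * Q + 2)"
    by (intro mult_le_mono power_increasing) auto
  then show "640 \<le> thr_J Q" unfolding thr_J_def by simp
qed

lemma thr_K_ge:
  assumes "r \<le> Q"
  shows "5 * exp (1 + real (r * Q)) \<le> real (thr_K Q)"
proof -
  have "exp (1 + real (r * Q)) = exp (real (1 + r * Q))" by simp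
  also have "\<dots> = exp 1 ^ (1 + r * Q)" by (simp only: exp_of_nat_mult[symmetric] mult_1_right)
  also have "\<dots> \<le> 4 ^ (1 + r * Q)" using e_less_272 by (intro power_mono) auto
  also have "\<dots> = 2 ^ (2 * (1 + r * Q))" by (simp add: power_mult del: mult_Suc_right)
  also have "\<dots> \<le> 2 ^ (2 * (1 + Q * Q))"
    using assms by (intro power_increasing mult_le_mono add_le_mono) auto
  finally show ?thesis unfolding thr_K_def by simp
qed

lemma exp_ge_cube: "0 \<le> w \<Longrightarrow> w ^ 3 / 27 \<le> exp w" for w :: real
proof -
  assume w: "0 \<le> w"
  have "(w / 3) ^ 3 \<le> exp (w / 3) ^ 3"
    using w exp_ge_add_one_self[of "w / 3"] by (intro power_mono) linarith+
  also have "\<dots> = exp w" by (simp add: exp_of_nat_mult[symmetric])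
  finally show ?thesis by (simp add: power_divide)
qed

lemma ln_double_le:
  fixes w :: real
  assumes "1 \<le> w"
  shows "ln (2 * w) \<le> 3 * sqrt w"
proof -
  have "ln (2 * w) = 2 * ln (sqrt (2 * w))" using assms by (simp add: ln_sqrt)
  also have "\<dots> \<le> 2 * (sqrt (2 * w) - 1)" using assms ln_le_minus_one[of "sqrt (2 * w)"] by simp
  also have "\<dots> \<le> 2 * (sqrt 2 * sqrt w)" by (simp add: real_sqrt_mult)
  also have "\<dots> \<le> 2 * (3 / 2 * sqrt w)"
  proof -
    have "sqrt 2 \<le> 3 / 2" by (rule real_le_lsqrt) (auto simp: power2_eq_square)
    then show ?thesis using assms by (intro mult_left_mono mult_right_mono) auto
  qed
  finally show ?thesis by simp
qed

text \<open>With \<open>l = ln (ln n)\<close> and \<open>w = ln l\<close>, the leading index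
  \<open>t\<close> has logarithm \<open>l + O(1)\<close>, and \<open>ln R\<close> is
  \<open>w + O(Q * sqrt w)\<close>. Taking logarithms in \<open>t \<le> C * R ^ k\<close> for
  \<open>k\<close> digits makes \<open>k\<close> at least nearly \<open>l / w\<close>.\<close>

lemma digits_lower:
  fixes S :: "nat set" and n Q :: nat and \<epsilon> :: real
  assumes S: "finite S" "\<And>p. p \<in> S \<Longrightarrow> prime p" and n: "integral_S_unit S (int n)" "threshold Q < n"
    and Q: "card S + 2 \<le> Q" "\<And>p. p \<in> S \<Longrightarrow> p \<le> Q" "2 \<le> Q" and \<epsilon>: "0 < \<epsilon>" "1 \<le> \<epsilon> * real Q"
  shows "(1 - \<epsilon>) * (ln (ln (real n)) / ln (ln (ln (real n)))) < real (zeckendorf_digits n)"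
proof -
  define l where "l = ln (ln (real n))"
  define w where "w = ln l"
  define W where "W = thr_W Q"
  have w: "real W \<le> w" and l0: "0 < l" and ln0: "0 < ln (real n)"
    using threshold_less[OF n(2)] unfolding W_def w_def l_def by auto
  have lw: "l = exp w" unfolding w_def using l0 by simp
  have nl: "ln (real n) = exp l" unfolding l_def using ln0 by simp
  have n2: "2 \<le> n"
  proof (rule ccontr)
    assume "\<not> 2 \<le> n"
    then have "n = 0 \<or> n = 1" by linarith
    then show False using ln0 by auto
  qed
  define r where "r = card (gen_set S)"
  have rQ: "r \<le> Q" unfolding r_def using card_gen_set_le[OF S(1)] Q(1) by linarith
  define C where "C = r * Q + 3"
  have CQ: "C \<le> Q * Q + 3" unfolding C_def using rQ by simp
  have Wge: "17 + thr_c Q + (3 * Q + 4) + thr_J Q \<le> W"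
    "(2 * (9 * Q + 33) * Q) * (2 * (9 * Q + 33) * Q) \<le> W" "2 * (Q * Q + 3) * Q < W"
    unfolding W_def thr_W_def by simp_all
  have w640: "640 \<le> w" using w Wge(1) thr_J_ge(3)[OF rQ] by linarith
  have wl: "w + 1 \<le> l" unfolding lw using exp_ge_add_one_self[of w] by linarith
  have ll: "l + 1 \<le> ln (real n)" unfolding nl using exp_ge_add_one_self[of l] by linarith
  obtain D where Z: "is_zeckendorf n D" using zeckendorf_exists by blast
  have k: "zeckendorf_digits n = card D" using Z by (rule zeckendorf_digits_eq)
  have ne: "D \<noteq> {}" using zeckendorf_empty_iff[OF Z] n2 by simp
  have finD: "finite D" using Z by (simp add: is_zeckendorf_def)
  have k1: "1 \<le> card D" using finD ne by (simp add: Suc_le_eq card_gt_0_iff)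
  define t where "t = Max D"
  have tn: "fib t \<le> n" "n < fib (Suc t)" using zeckendorf_Max[OF Z ne] by (auto simp: t_def)
  have nt: "ln (real n) \<le> real t"
  proof -
    have "n \<le> 2 ^ t" using tn(2) fib_Suc_le_pow2[of t] by linarith
    then have "real n \<le> 2 ^ t" using of_nat_mono[of n "2 ^ t", where 'a = real] by simp
    also have "\<dots> \<le> exp 1 ^ t" using exp_ge_add_one_self[of "1::real"] by (intro power_mono) auto
    also have "\<dots> = exp (real t)" by (simp add: exp_of_nat_mult[symmetric])
    finally show ?thesis using n2 by (intro ln_leI) auto
  qed
  have tl: "l \<le> real t" "640 \<le> real t" "w \<le> real t" using nt ll wl w640 by linarith+
  have t1: "1 \<le> t" using tl(2) by linarith
  have tn5: "real t \<le> 5 * ln (real n)"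
  proof -
    have g: "0 < golden" "1 < golden" using golden_bounds by auto
    have "ln (1 / golden) \<le> 1 / golden - 1" using g by (intro ln_le_minus_one) auto
    moreover have "1 / golden \<le> 2 / 3" using golden_bounds by (simp add: field_simps)
    ultimately have lng: "1 / 3 \<le> ln golden" using g by (simp add: ln_divide_pos)
    have "golden ^ t \<le> golden\<^sup>2 * real (fib t)" by (rule golden_pow_le_fib[OF t1])
    also have "\<dots> \<le> golden\<^sup>2 * real n" using tn(1) by (intro mult_left_mono) auto
    finally have "ln (golden ^ t) \<le> ln (golden\<^sup>2 * real n)"
      using g n2 by (subst ln_le_cancel_iff) auto
    then have "real t * ln golden \<le> 2 * ln golden + ln (real n)"
      using g n2 by (simp add: ln_realpow ln_mult_pos)
    then have "(real t - 2) * ln golden \<le> ln (real n)" by (simp add: left_diff_distrib)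
    moreover have "(real t - 2) * (1 / 3) \<le> (real t - 2) * ln golden"
      using lng tl by (intro mult_left_mono) auto
    ultimately have "real t - 2 \<le> 3 * ln (real n)" by simp
    then show ?thesis using ll wl w640 by linarith
  qed
  define lt where "lt = ln (real t)"
  have lt1: "l \<le> lt" unfolding lt_def l_def using nt ln0 t1 by (subst ln_le_cancel_iff) auto
  have e2: "5 \<le> exp (2::real)" using exp_lower_Taylor_quadratic[of 2] by simp
  have lt2: "lt \<le> 2 + l"
  proof -
    have "real t \<le> exp 2 * exp l" unfolding nl[symmetric]
      using tn5 mult_right_mono[OF e2, of "ln (real n)"] ln0 by linarith
    then show ?thesis unfolding lt_def using t1 by (intro ln_leI) (auto simp: mult_exp_exp)
  qed
  \<comment> \<open>The factor 8 serves \<open>hB\<close>: \<open>t + C\<close>, the two factors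
    \<open>2 ^ m1\<close> and \<open>B\<close> are each of order \<open>exp lt\<close>, which makes
    \<open>4 * lt\<close>; the remaining terms add up to at most \<open>4 * l\<close>.\<close>
  define h where "h = nat \<lceil>8 * lt\<rceil>"
  have lt0: "0 < lt" using lt1 l0 by linarith
  have h: "8 * lt \<le> real h" "real h \<le> 8 * lt + 1" unfolding h_def using lt0 by linarith+
  have h1: "1 \<le> h" using h(1) lt1 wl w640 by linarith
  have lnh: "ln (real h) \<le> w + 4"
  proof -
    have "real h \<le> 9 * l" using h(2) lt2 wl w640 by linarith
    also have "\<dots> \<le> exp 4 * exp w"
      using exp_lower_Taylor_quadratic[of 4] l0 unfolding lw by (intro mult_right_mono) auto
    finally show ?thesis using h1 by (intro ln_leI) (auto simp: mult_exp_exp add.commute)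
  qed
  \<comment> \<open>A constant plus about \<open>ln h\<close>, hence at most
    \<open>2 * w\<close>.\<close>
  define J where "J = thr_J Q + nat \<lceil>ln (real h)\<rceil>"
  have J: "thr_J Q \<le> J" "ln (real h) \<le> real J" unfolding J_def by (simp, linarith)
  have Jw: "real J \<le> 2 * w"
  proof -
    have "0 \<le> ln (real h)" using h1 by simp
    then have "real J \<le> real (thr_J Q) + (w + 5)" unfolding J_def using lnh by linarith
    moreover have "real (thr_J Q + 5) \<le> real W" using Wge(1) by (intro of_nat_mono) linarith
    ultimately show ?thesis using w by simp
  qed
  have J640: "640 \<le> J" using J(1) thr_J_ge(3)[OF rQ] by linarith
  have J2: "J ^ (3 * r + 4) < 2 ^ J"
    using thr_J_ge(2)[OF rQ] J(1) J640 by (intro power_less_pow2) linarith+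
  obtain m1 where m1: "t + 1 \<le> 2 ^ m1" "(2::nat) ^ m1 \<le> 2 * (t + 1)"
    using ex_pow2_between[of "t + 1"] by auto
  define K where "K = thr_K Q"
  define N where "N = m1 + (2 * K + 1)\<^sup>2 + 1"
  define B where "B = 2 * t + 1"
  define B' where "B' = 2 ^ (2 * N + 2) * B"
  have ww: "w * w * 3 \<le> 4 * l"
  proof -
    have "640 * (w * w) \<le> w * (w * w)" using w640 by (intro mult_right_mono) auto
    moreover have "w ^ 3 = w * (w * w)" by (simp add: power3_eq_cube mult.assoc)
    moreover have "w ^ 3 / 27 \<le> l" unfolding lw using w640 by (intro exp_ge_cube) auto
    moreover have "0 \<le> w * w" by simp
    ultimately show ?thesis by linarith
  qed
  have hB: "ln (2 * real (J ^ (3 * r + 4) * (t + C)) * real B') \<le> real h"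
  proof (rule ln_leI)
    have "0 < J ^ (3 * r + 4) * (t + C)" "0 < B'" using J640 t1 by (simp_all add: B'_def B_def)
    then have "0 < real (J ^ (3 * r + 4) * (t + C))" "0 < real B'" by (simp_all only: of_nat_0_less_iff)
    then show "0 < 2 * real (J ^ (3 * r + 4) * (t + C)) * real B'"
      by (intro mult_pos_pos[OF mult_pos_pos[OF zero_less_numeral]])
    have 1: "real (J ^ (3 * r + 4)) \<le> exp (2 * (w * w))"
    proof -
      have "real (J ^ (3 * r + 4)) = real J ^ (3 * r + 4)" by simp
      also have "\<dots> \<le> exp (real J) ^ (3 * r + 4)" by (intro power_mono le_exp_of_nat) auto
      also have "\<dots> = exp (real (3 * r + 4) * real J)" by (rule exp_of_nat_mult[symmetric])
      also have "real (3 * r + 4) * real J \<le> w * (2 * w)"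
      proof (intro mult_mono Jw)
        have "real (3 * r + 4) \<le> real W" using Wge(1) rQ by (intro of_nat_mono) linarith
        then show "real (3 * r + 4) \<le> w" using w by linarith
      qed (use w640 in auto)
      finally show ?thesis by (simp add: mult_ac)
    qed
    have tt: "real t = exp lt" unfolding lt_def using t1 by simp
    have 2: "real (t + C) \<le> 2 * exp lt"
    proof -
      have "1 * (Q * Q + 3) * 1 \<le> 2 * (Q * Q + 3) * Q" using Q(3) by (intro mult_le_mono) auto
      then have "Q * Q + 3 \<le> 2 * (Q * Q + 3) * Q" unfolding mult_1 mult_1_right .
      then have "C \<le> W" using CQ Wge(3) by (meson le_less_trans less_imp_le order_trans)
      then have "real C \<le> real W" by (rule of_nat_mono)
      then have "real C \<le> real t" using w tl by linarith
      then show ?thesis unfolding tt[symmetric] by simp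
    qed
    have 3: "real B' \<le> (16 * (exp lt * exp lt)) * exp (real (thr_c Q)) * (3 * exp lt)"
    proof -
      have "2 * N + 2 = m1 + m1 + thr_c Q"
        unfolding N_def K_def thr_c_def by (simp add: power2_eq_square algebra_simps)
      then have e: "real B' = (real (2 ^ m1) * real (2 ^ m1)) * 2 ^ thr_c Q * real B"
        unfolding B'_def by (simp add: power_add)
      have m: "real (2 ^ m1) \<le> 4 * exp lt"
      proof -
        have "real (2 ^ m1) \<le> real (2 * (t + 1))" using m1(2) by (rule of_nat_mono)
        then show ?thesis unfolding tt[symmetric] using tl by simp
      qed
      have "(2::real) ^ thr_c Q \<le> exp 1 ^ thr_c Q"
        using exp_ge_add_one_self[of "1::real"] by (intro power_mono) auto
      then have c: "(2::real) ^ thr_c Q \<le> exp (real (thr_c Q))" by (simp add: exp_of_nat_mult[symmetric])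
      have b: "real B \<le> 3 * exp lt" unfolding B_def tt[symmetric] using tl by simp
      have "real B' \<le> ((4 * exp lt) * (4 * exp lt)) * exp (real (thr_c Q)) * (3 * exp lt)"
        unfolding e using m c b by (intro mult_mono mult_nonneg_nonneg) auto
      then show ?thesis by simp
    qed
    have "2 * real (J ^ (3 * r + 4) * (t + C)) * real B'
      = 2 * (real (J ^ (3 * r + 4)) * real (t + C)) * real B'" by (simp only: of_nat_mult)
    also have "\<dots> \<le> 2 * (exp (2 * (w * w)) * (2 * exp lt)) * ((16 * (exp lt * exp lt)) * exp (real (thr_c Q)) * (3 * exp lt))"
      using 1 2 3 by (intro mult_mono mult_nonneg_nonneg) auto
    also have "\<dots> = 192 * exp (2 * (w * w) + 4 * lt + real (thr_c Q))"
      by (simp add: exp_add[symmetric] mult_exp_exp mult_ac)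
    also have "\<dots> \<le> exp 8 * exp (2 * (w * w) + 4 * lt + real (thr_c Q))"
    proof (rule mult_right_mono)
      have "(192::real) \<le> 5 ^ 4" by simp
      also have "(5::real) ^ 4 \<le> exp 2 ^ 4" using e2 by (intro power_mono) auto
      also have "\<dots> = exp 8" by (simp add: exp_of_nat_mult[symmetric])
      finally show "(192::real) \<le> exp 8" .
    qed simp
    also have "\<dots> = exp (8 + (2 * (w * w) + 4 * lt + real (thr_c Q)))" by (simp add: mult_exp_exp)
    also have "\<dots> \<le> exp (real h)"
    proof -
      have "real (8 + thr_c Q) \<le> real W" using Wge(1) by (intro of_nat_mono) linarith
      moreover have "1 * w \<le> w * w" using w640 by (intro mult_right_mono) auto
      ultimately have "8 + real (thr_c Q) \<le> w * w" using w unfolding of_nat_add of_nat_numeral by linarith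
      then have "8 + (2 * (w * w) + 4 * lt + real (thr_c Q)) \<le> real h" using ww lt1 h(1) by linarith
      then show ?thesis by simp
    qed
    finally show "2 * real (J ^ (3 * r + 4) * (t + C)) * real B' \<le> exp (real h)" .
  qed
  have J3: "160 * 2 ^ (r + 2) * (r * Q + 2) \<le> J" using thr_J_ge(1)[OF rQ] J(1) by linarith
  have K5: "5 * exp (1 + real (r * Q)) \<le> real K" unfolding K_def using rQ by (rule thr_K_ge)
  define R where "R = 14 * real (J ^ (3 * r + 9) * h)"
  have main: "real t + real C \<le> real C * R ^ card D"
    unfolding R_def
    by (rule zeckendorf_gap_bound[OF S n(1) n2 Z Q(3) Q(2) r_def t_def C_def h1 K5 m1(1) N_def B_def B'_def
          hB J(2) J3 J2]) auto
  have Jh0: "0 < real J" "0 < real h" using J640 h1 by auto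
  have R0: "0 < R" unfolding R_def using Jh0 by simp
  have "0 < C" by (simp add: C_def)
  then have C0: "0 < real C" by (simp only: of_nat_0_less_iff)
  have ltR: "lt \<le> real C + real (card D) * ln R"
  proof -
    have "real t \<le> real C * R ^ card D" using main C0 by linarith
    then have "lt \<le> ln (real C * R ^ card D)" unfolding lt_def
      using t1 R0 C0 by (subst ln_le_cancel_iff) auto
    also have "\<dots> = ln (real C) + real (card D) * ln R" using R0 C0 by (simp add: ln_mult_pos ln_realpow)
    also have "ln (real C) \<le> real C" using ln_le_minus_one[OF C0] by linarith
    finally show ?thesis by simp
  qed
  \<comment> \<open>The powers of \<open>J\<close> enter \<open>ln R\<close> through
    \<open>ln J\<close>, at most \<open>3 * sqrt w\<close>; the leading term \<open>w\<close> comes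
    from \<open>ln h\<close>.\<close>
  define s where "s = sqrt w"
  have s: "s * s = w" "10 \<le> s" unfolding s_def using w640 by (auto intro!: real_le_rsqrt)
  have lnR: "ln R \<le> w + (9 * real Q + 33) * s"
  proof -
    have "ln R = ln 14 + (real (3 * r + 9) * ln (real J) + ln (real h))"
      unfolding R_def using Jh0 by (simp add: ln_mult_pos ln_realpow)
    moreover have "ln (14::real) \<le> 4"
    proof (rule ln_leI)
      have "(14::real) \<le> 5 * 5" by simp
      also have "\<dots> \<le> exp 2 * exp 2" using e2 by (intro mult_mono) auto
      finally show "(14::real) \<le> exp 4" by (simp add: mult_exp_exp)
    qed simp
    moreover have "real (3 * r + 9) * ln (real J) \<le> (3 * real Q + 9) * (3 * s)"
    proof (intro mult_mono)
      have "ln (real J) \<le> ln (2 * w)" using Jw Jh0 by (subst ln_le_cancel_iff) auto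
      also have "\<dots> \<le> 3 * s" unfolding s_def using w640 by (intro ln_double_le) auto
      finally show "ln (real J) \<le> 3 * s" .
      show "0 \<le> ln (real J)" using J640 by simp
    qed (use rQ in auto)
    ultimately have "ln R \<le> 4 + ((3 * real Q + 9) * (3 * s) + (w + 4))" using lnh by linarith
    also have "(3 * real Q + 9) * (3 * s) = (9 * real Q + 27) * s" by (simp add: algebra_simps)
    also have "4 + ((9 * real Q + 27) * s + (w + 4)) \<le> w + ((9 * real Q + 27) * s + 6 * s)" using s(2) by linarith
    also have "\<dots> = w + (9 * real Q + 33) * s" by (simp add: algebra_simps)
    finally show ?thesis .
  qed
  have sw: "(9 * real Q + 33) * s \<le> \<epsilon> / 2 * w"
  proof -
    \<comment> \<open>Chosen so that inserting the factor \<open>\<epsilon> * Q \<ge> 1\<close>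
      turns the error into \<open>\<epsilon> / 2 * (u * s)\<close>, where
      \<open>u * s \<le> w\<close>.\<close>
    define u where "u = 2 * (9 * real Q + 33) * real Q"
    have u0: "0 \<le> u" unfolding u_def by simp
    have "real ((2 * (9 * Q + 33) * Q) * (2 * (9 * Q + 33) * Q)) \<le> real W" using Wge(2) by (rule of_nat_mono)
    then have "u * u \<le> w" unfolding u_def using w by simp
    then have "u \<le> s" unfolding s_def by (intro real_le_rsqrt) (simp add: power2_eq_square)
    then have us: "u * s \<le> w" unfolding s(1)[symmetric] using s(2) by (intro mult_right_mono) auto
    have "1 * ((9 * real Q + 33) * s) \<le> (\<epsilon> * real Q) * ((9 * real Q + 33) * s)"
      using \<epsilon>(2) s(2) by (intro mult_right_mono) auto
    also have "\<dots> = \<epsilon> / 2 * (u * s)" unfolding u_def by simp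
    also have "\<dots> \<le> \<epsilon> / 2 * w" using us \<epsilon>(1) by (intro mult_left_mono) auto
    finally show ?thesis by simp
  qed
  have w0: "0 < w" using w640 by linarith
  have up: "l \<le> real C + real (card D) * w * (1 + \<epsilon> / 2)"
  proof -
    have "ln R \<le> w * (1 + \<epsilon> / 2)" using lnR sw by (simp add: algebra_simps)
    then have "real (card D) * ln R \<le> real (card D) * (w * (1 + \<epsilon> / 2))" by (intro mult_left_mono) auto
    then show ?thesis using ltR lt1 by (simp add: mult.assoc)
  qed
  have "(1 - \<epsilon>) * (l / w) < real (card D)"
  proof (rule ccontr)
    assume "\<not> (1 - \<epsilon>) * (l / w) < real (card D)"
    then have le: "real (card D) \<le> (1 - \<epsilon>) * (l / w)" by simp
    then have kw: "real (card D) * w \<le> (1 - \<epsilon>) * l" using w0 by (simp add: field_simps)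
    have "0 < real (card D) * w" using k1 w0 by simp
    then have "0 < (1 - \<epsilon>) * l" using kw by linarith
    then have "\<epsilon> < 1" using l0 by (simp add: zero_less_mult_iff)
    \<comment> \<open>\<open>(1 - \<epsilon>) * (1 + \<epsilon> / 2)\<close> is at most
      \<open>1 - \<epsilon> / 2\<close>, so too few digits would leave
      \<open>\<epsilon> / 2 * l \<le> C\<close>, although \<open>l\<close> exceeds
      \<open>W\<close>.\<close>
    have "l \<le> real C + (1 - \<epsilon>) * l * (1 + \<epsilon> / 2)"
    proof -
      have "real (card D) * w * (1 + \<epsilon> / 2) \<le> (1 - \<epsilon>) * l * (1 + \<epsilon> / 2)"
        using kw \<epsilon>(1) by (intro mult_right_mono) auto
      then show ?thesis using up by linarith
    qed
    moreover have "(1 - \<epsilon>) * l * (1 + \<epsilon> / 2) = l - \<epsilon> / 2 * l - \<epsilon> * \<epsilon> / 2 * l"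
      by (simp add: field_simps)
    moreover have "0 \<le> \<epsilon> * \<epsilon> / 2 * l" using l0 by simp
    ultimately have "\<epsilon> / 2 * l \<le> real C" by linarith
    then have "\<epsilon> * l \<le> 2 * real C" by simp
    then have "(\<epsilon> * l) * real Q \<le> (2 * real C) * real Q" by (intro mult_right_mono) auto
    moreover have "1 * l \<le> (\<epsilon> * real Q) * l" using \<epsilon>(2) l0 by (intro mult_right_mono) auto
    ultimately have "l \<le> real (2 * C * Q)" by (simp add: mult_ac)
    also have "\<dots> \<le> real W"
    proof -
      have "2 * C * Q \<le> 2 * (Q * Q + 3) * Q" using CQ by simp
      then show ?thesis using Wge(3) by (intro of_nat_mono) linarith
    qed
    finally show False using w wl by linarith
  qed
  then show ?thesis unfolding k w_def l_def .
qed

text \<open>This spares decoding \<open>S\<close>: its code, a sum of distinct powers of 2, bounds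
  both the elements and their number.\<close>

lemma set_encode_ge:
  assumes "finite S"
  shows "p \<in> S \<Longrightarrow> p \<le> set_encode S" "card S \<le> set_encode S"
proof -
  show "p \<le> set_encode S" if "p \<in> S"
  proof -
    have "p \<le> 2 ^ p" using less_exp[of p] by simp
    also have "2 ^ p \<le> (\<Sum>q\<in>S. (2::nat) ^ q)" using assms that by (intro member_le_sum) auto
    finally show ?thesis by (simp add: set_encode_def)
  qed
  have "card S = (\<Sum>q\<in>S. 1)" by simp
  also have "\<dots> \<le> (\<Sum>q\<in>S. 2 ^ q)" by (intro sum_mono) simp
  finally show "card S \<le> set_encode S" by (simp add: set_encode_def)
qed

theorem theorem1p4:
  shows "\<exists>n0 :: nat list \<Rightarrow> nat. total_recursive 3 n0 \<and>
    (\<forall>(S :: nat set) (\<epsilon> :: real) (a :: nat) (b :: nat).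
       finite S \<and> (\<forall>p\<in>S. prime p) \<and> 0 < \<epsilon> \<and>
       0 < a \<and> 0 < b \<and> real a / real b \<le> \<epsilon> \<longrightarrow>
         0 < n0 [set_encode S, a, b] \<and>
         (\<forall>n :: nat. integral_S_unit S (int n) \<and> n0 [set_encode S, a, b] < n \<longrightarrow>
            (1 - \<epsilon>) * (ln (ln (real n)) / ln (ln (ln (real n))))
              < real (zeckendorf_digits n)))"
proof -
  have "computes 3 (\<lambda>xs. threshold (xs ! 0 + xs ! 1 + xs ! 2 + 2))"
    by (intro computes_threshold computes_add computes_proj computes_const) auto
  then obtain n0 where n0: "total_recursive 3 n0"
    "\<And>xs. length xs = 3 \<Longrightarrow> n0 xs = threshold (xs ! 0 + xs ! 1 + xs ! 2 + 2)"
    unfolding computes_def by blast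
  show ?thesis
  proof (intro exI[of _ n0] conjI allI impI n0(1))
    fix S :: "nat set" and \<epsilon> :: real and a b :: nat
    assume asm: "finite S \<and> (\<forall>p\<in>S. prime p) \<and> 0 < \<epsilon> \<and> 0 < a \<and> 0 < b \<and> real a / real b \<le> \<epsilon>"
    \<comment> \<open>The code takes care of \<open>S\<close>, and \<open>b\<close> of \<epsilon>:
      as \<open>a \<ge> 1\<close>, \<epsilon> is at least \<open>1 / b\<close>, so
      \<open>b \<le> Q\<close> yields \<open>1 \<le> \<epsilon> * Q\<close>.\<close>
    define Q where "Q = set_encode S + a + b + 2"
    have n0Q: "n0 [set_encode S, a, b] = threshold Q" using n0(2)[of "[set_encode S, a, b]"] by (simp add: Q_def)
    show "0 < n0 [set_encode S, a, b]" unfolding n0Q threshold_def by simp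
    fix n assume n: "integral_S_unit S (int n) \<and> n0 [set_encode S, a, b] < n"
    show "(1 - \<epsilon>) * (ln (ln (real n)) / ln (ln (ln (real n)))) < real (zeckendorf_digits n)"
    proof (rule digits_lower[where S = S and Q = Q])
      have "1 \<le> real a" using asm by simp
      also have "\<dots> \<le> \<epsilon> * real b" using asm by (simp add: divide_le_eq)
      also have "\<dots> \<le> \<epsilon> * real Q" using asm by (intro mult_left_mono) (auto simp: Q_def)
      finally show "1 \<le> \<epsilon> * real Q" .
      show "card S + 2 \<le> Q" using set_encode_ge(2)[of S] asm by (simp add: Q_def)
      show "p \<le> Q" if "p \<in> S" for p using set_encode_ge(1)[of S p] asm that by (simp add: Q_def)
    qed (use asm n n0Q in \<open>auto simp: Q_def\<close>)
  qed
qed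

end
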